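(* Let $\theta,\lambda,\Delta>0$, $a=\lambda\Delta$, let $\tau_\theta(t)=\int_0^tv_\theta(s)ds$ be the integrated OU-$\Gamma$ process (the OU process $v_\theta$ being driven by the homogeneous Gamma process $G_\theta$), and for $i=1,\ldots,n$ let $\tau_{\theta,i}:=\tau_\theta(i\Delta)-\tau_\theta((i-1)\Delta)$ and $r_i=e^{\lambda i\Delta}$, with $r_0=1$. Then for $i=1,\dots,n$ $$\lambda\tau_{\theta,i}=(1-e^{-\lambda\Delta})v_\theta((i-1)\Delta)+T_i[1-M_i],$$ with $$v_\theta((i-1)\Delta)=e^{-\lambda(i-1)\Delta}\left[v_\theta(0)+\sum_{j=1}^{i-1}r_jT_jM_j\right],$$ where $(T_i,M_i)$ are iid pairs independent of $v_\theta(0)$. Additionally, for each fixed $i$, $T_i$ and $M_i$ are independent with $T_i\overset{d}{=}T_{\theta a}$ and $M_i\overset{d}{=}M_{\theta a}$. Consequently likelihood inference for the model $X_i=\mu\Delta+\beta\tau_{\theta,i}+\tau_{\theta,i}^{1/2}\epsilon_i$, $i=1,\dots,n$, i.e. for the likelihood $E\left[\prod_{i=1}^n\phi(X_i|\mu\Delta+\beta\tau_{\theta,i},\tau_{\theta,i})\right]$, may be obtained from the joint distribution of $((X_i,T_i,M_i)_{i\le n},v_\theta(0))$, which has joint density $$\left[\prod_{i=1}^n\phi(X_i|\mu\Delta+\beta\tau_{\theta,i},\tau_{\theta,i})\,\mathscr G_{\theta a}(t_i)\,f_{M}(v_i)\right]f_{v_\theta(0)}(w),$$ where $\tau_{\theta,i}$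 is expressed, with $T_i=t_i$, $M_i=v_i$, $v_\theta(0)=w$, as $$\tau_{\theta,i}=\lambda^{-1}\left\{(1-e^{-\lambda\Delta})e^{-\lambda(i-1)\Delta}\left[w+\sum_{j=1}^{i-1}r_jt_jv_j\right]+t_i[1-v_i]\right\}.$$
   Context: $T_c$ is a Gamma$(c,1)$ random variable with density $\mathscr G_c(y)=y^{c-1}e^{-y}/\Gamma(c)$. $\phi(x|m,\sigma^2)$ is the Normal density with mean $m$ and variance $\sigma^2$; $\epsilon_i$ are iid standard Normal independent of $(\tau_{\theta,i})$; $\mu,\beta\in\mathbb R$. $G_\theta$ is the subordinator with $E[e^{-\omega G_\theta(t)}]=(1+\omega)^{-\theta t}$ and $v_\theta(t)=e^{-\lambda t}v_\theta(0)+e^{-\lambda t}\int_0^te^{\lambda y}G_\theta(d\lambda y)$ with $v_\theta(0)$ a positive random variable independent of $G_\theta$ (here $\int_s^{t} g(y)G_\theta(d\lambda y):=\int_{\lambda s}^{\lambda t}g(r/\lambda)G_\theta(dr)$), so that for $s<t$ $$\tau_\theta(t)-\tau_\theta(s)=\lambda^{-1}\left[(1-e^{-\lambda(t-s)})v_\theta(s)+\int_s^t(1-e^{-\lambda(t-y)})G_\theta(d\lambda y)\right].$$ $F_a$ is the distribution on $[e^{-a},1]$ with density $1/(au)$, $P_{\theta aF_a}$ is the Dirichlet process with shape measure $\theta aF_a$ (a Gamma random measure with shape measure $\theta a F_a$ divided by its total mass), and $M_{\theta a}=\int xP_{\theta aF_a}(dx)$, with density $f_M$. $f_{v_\theta(0)}$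 is the density of $v_\theta(0)$.
   Formalization: For the joint density of ((X_i,T_i,M_i),v_θ(0)), the ε_i are assumed independent of (v_θ(0), G_θ), not only of (τ_{θ,i}); with the latter alone ε could be a function of T, M, v_θ(0) and the claim fails. *)

theory Defs
  imports "HOL-Probability.Probability"
begin

text \<open>Independence of two random variables of possibly different types; \<open>indep_var\<close> forces both to
  have the same range type (cf. \<open>indep_var_eq\<close>).\<close>

definition indep_rv :: "'a measure \<Rightarrow> 'b measure \<Rightarrow> ('a \<Rightarrow> 'b) \<Rightarrow> 'c measure \<Rightarrow> ('a \<Rightarrow> 'c) \<Rightarrow> bool" where
  "indep_rv \<Omega> S X S' Y \<longleftrightarrow> X \<in> measurable \<Omega> S \<and> Y \<in> measurable \<Omega> S' \<and>
     prob_space.indep_set \<Omega> {X -` A \<inter> space \<Omega> |A. A \<in> sets S} {Y -` B \<inter> space \<Omega> |B. B \<in> sets S'}"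


section \<open>Gamma laws, Gamma random measures, means of Dirichlet processes\<close>

definition gamma_density :: "real \<Rightarrow> real \<Rightarrow> real" where
  "gamma_density c y = (if 0 < y then y powr (c - 1) * exp (- y) / Gamma c else 0)"

text \<open>The value at \<open>c = 0\<close> is the usual degenerate convention; it is needed because a Gamma
  random measure vanishes almost surely on the null sets of its shape measure.\<close>

definition gamma_law :: "real \<Rightarrow> real measure" where
  "gamma_law c = (if c = 0 then return borel 0 else density lborel (gamma_density c))"

definition gamma_random_measure :: "'a measure \<Rightarrow> real measure \<Rightarrow> ('a \<Rightarrow> real measure) \<Rightarrow> bool" where
  "gamma_random_measure \<Omega> \<nu> \<Gamma> \<longleftrightarrow>
     (\<forall>\<omega>\<in>space \<Omega>. sets (\<Gamma> \<omega>) = sets borel \<and> finite_measure (\<Gamma> \<omega>)) \<and>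
     (\<forall>A\<in>sets borel. (\<lambda>\<omega>. measure (\<Gamma> \<omega>) A) \<in> borel_measurable \<Omega> \<and>
        distr \<Omega> borel (\<lambda>\<omega>. measure (\<Gamma> \<omega>) A) = gamma_law (measure \<nu> A)) \<and>
     (\<forall>(A :: nat \<Rightarrow> real set) k. range A \<subseteq> sets borel \<longrightarrow> disjoint_family_on A {..<k} \<longrightarrow>
        prob_space.indep_vars \<Omega> (\<lambda>_. borel) (\<lambda>j \<omega>. measure (\<Gamma> \<omega>) (A j)) {..<k})"

definition dirichlet_process :: "'a measure \<Rightarrow> real measure \<Rightarrow> ('a \<Rightarrow> real measure) \<Rightarrow> bool" where
  "dirichlet_process \<Omega> \<nu> P \<longleftrightarrow>
     (\<exists>\<Gamma>. gamma_random_measure \<Omega> \<nu> \<Gamma> \<and>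
        (\<forall>\<omega>\<in>space \<Omega>. P \<omega> = scale_measure (1 / emeasure (\<Gamma> \<omega>) UNIV) (\<Gamma> \<omega>)))"

definition random_mean :: "('a \<Rightarrow> real measure) \<Rightarrow> 'a \<Rightarrow> real" where
  "random_mean P \<omega> = (\<integral>x. x \<partial>P \<omega>)"

definition F_dist :: "real \<Rightarrow> real measure" where
  "F_dist a = density lborel (\<lambda>u. ennreal (indicator {exp (- a)..1} u / (a * u)))"


section \<open>The Gamma subordinator and the OU-Gamma process\<close>

text \<open>Processes are indexed by the reals, but only the times \<open>t \<ge> 0\<close> matter.\<close>

definition subordinator :: "'a measure \<Rightarrow> (real \<Rightarrow> 'a \<Rightarrow> real) \<Rightarrow> bool" where
  "subordinator \<Omega> G \<longleftrightarrow>
     (\<forall>t\<ge>0. G t \<in> borel_measurable \<Omega>) \<and>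
     (\<forall>\<omega>\<in>space \<Omega>. G 0 \<omega> = 0 \<and> mono_on {0..} (\<lambda>t. G t \<omega>) \<and>
        (\<forall>t\<ge>0. continuous (at_right t) (\<lambda>s. G s \<omega>))) \<and>
     (\<forall>(t :: nat \<Rightarrow> real) k. 0 \<le> t 0 \<longrightarrow> incseq t \<longrightarrow>
        prob_space.indep_vars \<Omega> (\<lambda>_. borel) (\<lambda>j \<omega>. G (t (Suc j)) \<omega> - G (t j) \<omega>) {..<k}) \<and>
     (\<forall>s\<ge>0. \<forall>t\<ge>0. distr \<Omega> borel (\<lambda>\<omega>. G (s + t) \<omega> - G s \<omega>) = distr \<Omega> borel (G t))"

definition gamma_subordinator :: "'a measure \<Rightarrow> real \<Rightarrow> (real \<Rightarrow> 'a \<Rightarrow> real) \<Rightarrow> bool" where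
  "gamma_subordinator \<Omega> \<theta> G \<longleftrightarrow> subordinator \<Omega> G \<and>
     (\<forall>t\<ge>0. \<forall>u\<ge>0. (\<integral>\<omega>. exp (- u * G t \<omega>) \<partial>\<Omega>) = (1 + u) powr (- \<theta> * t))"

text \<open>Pathwise Lebesgue--Stieltjes integral over the half-open interval \<open>(s, t]\<close>.  A path \<open>g\<close> on
  \<open>[0, \<infinity>)\<close> is extended by the constant \<open>g 0\<close> to the left, so its measure lives on \<open>(0, \<infinity>)\<close>.\<close>

definition stieltjes_integral :: "(real \<Rightarrow> real) \<Rightarrow> real \<Rightarrow> real \<Rightarrow> (real \<Rightarrow> real) \<Rightarrow> real" where
  "stieltjes_integral g s t h = (LINT x:{s<..t}|interval_measure (\<lambda>y. g (max 0 y)). h x)"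

text \<open>The integral of \<open>h\<close> over \<open>(s, t]\<close> against \<open>G(d lam y)\<close>.\<close>

definition scaled_integral ::
    "real \<Rightarrow> (real \<Rightarrow> real) \<Rightarrow> real \<Rightarrow> real \<Rightarrow> (real \<Rightarrow> real) \<Rightarrow> real" where
  "scaled_integral lam g s t h = stieltjes_integral g (lam * s) (lam * t) (\<lambda>x. h (x / lam))"

definition OU :: "real \<Rightarrow> (real \<Rightarrow> 'a \<Rightarrow> real) \<Rightarrow> ('a \<Rightarrow> real) \<Rightarrow> real \<Rightarrow> 'a \<Rightarrow> real" where
  "OU lam G v0 t \<omega> = exp (- lam * t) * v0 \<omega>
     + exp (- lam * t) * scaled_integral lam (\<lambda>y. G y \<omega>) 0 t (\<lambda>y. exp (lam * y))"

definition integrated_OU :: "real \<Rightarrow> (real \<Rightarrow> 'a \<Rightarrow> real) \<Rightarrow> ('a \<Rightarrow> real) \<Rightarrow> real \<Rightarrow> 'a \<Rightarrow> real" where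
  "integrated_OU lam G v0 t \<omega> = (LINT s:{0..t}|lborel. OU lam G v0 s \<omega>)"

definition integrated_OU_incr ::
    "real \<Rightarrow> real \<Rightarrow> (real \<Rightarrow> 'a \<Rightarrow> real) \<Rightarrow> ('a \<Rightarrow> real) \<Rightarrow> nat \<Rightarrow> 'a \<Rightarrow> real" where
  "integrated_OU_incr lam \<Delta> G v0 i \<omega> =
     integrated_OU lam G v0 (real i * \<Delta>) \<omega> - integrated_OU lam G v0 (real (i - 1) * \<Delta>) \<omega>"


section \<open>The observation model\<close>

text \<open>\<open>normal_density\<close> takes the standard deviation; \<open>normal_pdf x m s2\<close> takes the variance.\<close>

definition normal_pdf :: "real \<Rightarrow> real \<Rightarrow> real \<Rightarrow> real" where
  "normal_pdf x m s2 = normal_density m (sqrt s2) x"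

definition iid_std_normal :: "'a measure \<Rightarrow> nat \<Rightarrow> (nat \<Rightarrow> 'a \<Rightarrow> real) \<Rightarrow> bool" where
  "iid_std_normal \<Omega> n \<epsilon> \<longleftrightarrow> prob_space.indep_vars \<Omega> (\<lambda>_. borel) \<epsilon> {1..n} \<and>
     (\<forall>i\<in>{1..n}. distributed \<Omega> lborel (\<epsilon> i) std_normal_density)"

definition observation :: "real \<Rightarrow> real \<Rightarrow> real \<Rightarrow> (nat \<Rightarrow> 'a \<Rightarrow> real) \<Rightarrow> (nat \<Rightarrow> 'a \<Rightarrow> real)
    \<Rightarrow> nat \<Rightarrow> 'a \<Rightarrow> real" where
  "observation \<mu> \<beta> \<Delta> \<tau> \<epsilon> i \<omega> = \<mu> * \<Delta> + \<beta> * \<tau> i \<omega> + sqrt (\<tau> i \<omega>) * \<epsilon> i \<omega>"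

text \<open>The expectation is taken in \<open>[0, \<infinity>]\<close>: at exceptional observation points the likelihood can be
  infinite (for \<open>n = 1\<close>, \<open>x 1 = \<mu> * \<Delta>\<close> and small \<open>\<theta> * lam * \<Delta>\<close>, if \<open>v0\<close> charges neighbourhoods
  of 0 heavily enough), where a Bochner integral would return 0.\<close>

definition likelihood :: "'a measure \<Rightarrow> real \<Rightarrow> real \<Rightarrow> real \<Rightarrow> (nat \<Rightarrow> 'a \<Rightarrow> real) \<Rightarrow> nat
    \<Rightarrow> (nat \<Rightarrow> real) \<Rightarrow> ennreal" where
  "likelihood \<Omega> \<mu> \<beta> \<Delta> \<tau> n x =
     (\<integral>\<^sup>+\<omega>. (\<Prod>i\<in>{1..n}. ennreal (normal_pdf (x i) (\<mu> * \<Delta> + \<beta> * \<tau> i \<omega>) (\<tau> i \<omega>))) \<partial>\<Omega>)"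

definition tau_expr :: "real \<Rightarrow> real \<Rightarrow> nat \<Rightarrow> (nat \<Rightarrow> real) \<Rightarrow> (nat \<Rightarrow> real) \<Rightarrow> real \<Rightarrow> real" where
  "tau_expr lam \<Delta> i t v w =
     (1 / lam) * ((1 - exp (- lam * \<Delta>)) * exp (- lam * real (i - 1) * \<Delta>)
         * (w + (\<Sum>j\<in>{1..i - 1}. exp (lam * real j * \<Delta>) * t j * v j))
       + t i * (1 - v i))"

definition joint_density :: "real \<Rightarrow> real \<Rightarrow> real \<Rightarrow> real \<Rightarrow> real \<Rightarrow> nat
    \<Rightarrow> (real \<Rightarrow> ennreal) \<Rightarrow> (real \<Rightarrow> ennreal)
    \<Rightarrow> (nat \<Rightarrow> real) \<Rightarrow> (nat \<Rightarrow> real) \<Rightarrow> (nat \<Rightarrow> real) \<Rightarrow> real \<Rightarrow> ennreal" where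
  "joint_density \<theta> lam \<Delta> \<mu> \<beta> n fM fv x t v w =
     (\<Prod>i\<in>{1..n}.
        ennreal (normal_pdf (x i) (\<mu> * \<Delta> + \<beta> * tau_expr lam \<Delta> i t v w) (tau_expr lam \<Delta> i t v w))
        * ennreal (gamma_density (\<theta> * (lam * \<Delta>)) (t i)) * fM (v i)) * fv w"

end

theory Submission
  imports Defs
begin

text \<open>
  Run on the clock of \<open>G\<close>, the \<open>i\<close>-th observation period is the block \<open>((i - 1) * a, i * a]\<close>.  Let
  \<open>T i\<close> be the increment of \<open>G\<close> over this block, \<open>S i\<close> the integral of \<open>exp (r - i * a)\<close> against
  \<open>G (dr)\<close> over it, and \<open>M i = S i / T i\<close>, a weighted mean of numbers in \<open>[exp (- a), 1]\<close>.  Splitting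
  the integral in the definition of the OU process into blocks gives the formula for the process at the
  grid times (\<open>OU_block_representation\<close>), and exchanging the time integral with the Stieltjes
  integral gives the formula for the increments of the integrated process
  (\<open>integrated_OU_incr_representation\<close>).  Both are identities for each path.

  The law of \<open>(S i, T i)\<close> is found by cutting the block into \<open>m\<close> equal pieces.  The increments of
  \<open>G\<close> over the pieces are independent with Laplace transform \<open>(1 + u) powr (- \<theta> * a / m)\<close>, and
  \<open>S i\<close> differs from the sum of the increments weighted by the values of the integrand at the right ends
  by at most \<open>(1 - exp (- a / m)) * T i\<close>.  The map \<open>r \<mapsto> exp (r - i * a)\<close> sends
  Lebesgue measure on the block to \<open>a\<close> times \<open>F_dist a\<close>, so a Gamma random measure \<open>\<Gamma>\<close>
  with shape \<open>\<theta> * a\<close> times \<open>F_dist a\<close> gives independent masses with the same law to the images of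
  the pieces, and its first moment and total mass have the same approximation.  The predicate
  \<open>gamma_mean_pair\<close> records exactly this common structure.  It determines the joint Laplace transform
  as a limit of explicit products (\<open>gamma_mean_pair_limit\<close>), hence the joint law
  (\<open>gamma_mean_pair_distr_eq\<close>), and so \<open>M i\<close> has the law of the mean of the Dirichlet process
  \<open>\<Gamma> / \<Gamma>(UNIV)\<close>.

  That \<open>M i\<close> and \<open>T i\<close> are independent is an instance of Basu's argument.  The limiting
  products show that weighting the law of \<open>(S i, T i)\<close> with \<open>exp (- s * T i)\<close> has, up to the factor
  \<open>(1 + s) powr (- \<theta> * a)\<close>, the same effect as dividing both variables by \<open>1 + s\<close>
  (\<open>gamma_mean_pair_tilt\<close>).  The ratio does not notice the division, so the conditional Laplace
  transform of \<open>T i\<close> given an event about \<open>M i\<close> is always the unconditional one.  Independence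
  of the pairs for different \<open>i\<close> is independence of increments, carried from Riemann sums to integrals
  by \<open>indep_vars_tendsto\<close>.

  For the model, \<open>v0 > 0\<close> makes every \<open>\<tau> i\<close> positive, so that given the latent variables
  the observations are independent and normal with nondegenerate variances
  (\<open>nn_integral_normal_mixture\<close>).  The likelihood and the joint density then follow from Tonelli's
  theorem and from the product form of the law of the latent variables.
\<close>

section \<open>Measures determined by continuous functions and by Laplace transforms\<close>

lemma closed_indicator_approx:
  fixes C :: "'b::metric_space set"
  assumes "closed C"
  obtains h :: "nat \<Rightarrow> 'b \<Rightarrow> real" where "\<And>p. continuous_on UNIV (h p)"
    "\<And>p x. 0 \<le> h p x" "\<And>p x. h p x \<le> 1" "\<And>x. (\<lambda>p. h p x) \<longlonglongrightarrow> indicator C x"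
proof (cases "C = {}")
  case True
  then show ?thesis by (intro that[of "\<lambda>_ _. 0"]) auto
next
  case False
  define h where "h p x = max 0 (1 - real p * infdist x C)" for p :: nat and x
  have "(\<lambda>p. h p x) \<longlonglongrightarrow> indicator C x" for x
  proof (cases "x \<in> C")
    case True
    then show ?thesis by (simp add: h_def)
  next
    case nin: False
    then have pos: "infdist x C > 0"
      using assms False by (metis in_closed_iff_infdist_zero infdist_nonneg less_le)
    obtain q :: nat where q: "1 < real q * infdist x C"
      using reals_Archimedean3[OF pos] by blast
    have "h p x = 0" if "p \<ge> q" for p
    proof -
      have "real q * infdist x C \<le> real p * infdist x C"
        using that pos by (intro mult_right_mono) auto
      then show ?thesis using q by (simp add: h_def)
    qed
    then have "eventually (\<lambda>p. h p x = indicator C x) sequentially"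
      using nin by (auto simp: eventually_sequentially)
    then show ?thesis by (rule tendsto_eventually)
  qed
  moreover have "continuous_on UNIV (h p)" for p
    unfolding h_def by (intro continuous_intros continuous_on_infdist)
  ultimately show ?thesis
    by (intro that[of h]) (auto simp: h_def infdist_nonneg)
qed

text \<open>Closed sets generate the Borel sets and are stable under intersection, and their indicators
  are limits of continuous functions with values in \<open>[0, 1]\<close>.\<close>

lemma finite_measure_eqI_continuous:
  fixes M N :: "'b::metric_space measure"
  assumes M: "finite_measure M" "sets M = sets borel" and N: "finite_measure N" "sets N = sets borel"
  assumes eq: "\<And>f :: 'b \<Rightarrow> real. continuous_on UNIV f \<Longrightarrow> (\<And>x. 0 \<le> f x) \<Longrightarrow> (\<And>x. f x \<le> 1) \<Longrightarrow>
    (\<integral>x. f x \<partial>M) = (\<integral>x. f x \<partial>N)"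
  shows "M = N"
proof (rule measure_eqI_generator_eq[where E="Collect closed" and \<Omega>=UNIV and A="\<lambda>_. UNIV"])
  interpret M: finite_measure M by fact
  interpret N: finite_measure N by fact
  have lim: "(\<lambda>p. \<integral>x. h p x \<partial>K) \<longlonglongrightarrow> measure K C"
    if K: "finite_measure K" "sets K = sets borel" and C: "closed C"
      and h: "\<And>p. continuous_on UNIV (h p)"
        "\<And>p x. 0 \<le> h p x" "\<And>p x. h p x \<le> 1" "\<And>x. (\<lambda>p. h p x) \<longlonglongrightarrow> indicator C x"
    for K C and h :: "nat \<Rightarrow> 'b \<Rightarrow> real"
  proof -
    interpret K: finite_measure K by fact
    have sp: "space K = UNIV" using K(2) sets_eq_imp_space_eq by fastforce
    have "(\<lambda>p. \<integral>x. h p x \<partial>K) \<longlonglongrightarrow> (\<integral>x. indicator C x \<partial>K)"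
      using C h K(2)
      by (intro integral_dominated_convergence[where w="\<lambda>_. 1"])
         (auto intro!: borel_measurable_indicator simp: borel_measurable_continuous_onI measurable_cong_sets[OF K(2) refl])
    then show ?thesis using C K(2) by (simp add: sp)
  qed
  fix X :: "'b set" assume "X \<in> Collect closed"
  then have "closed X" by simp
  then show "emeasure M X = emeasure N X"
  proof (rule closed_indicator_approx)
    fix h :: "nat \<Rightarrow> 'b \<Rightarrow> real"
    assume h: "\<And>p. continuous_on UNIV (h p)"
        "\<And>p x. 0 \<le> h p x" "\<And>p x. h p x \<le> 1" "\<And>x. (\<lambda>p. h p x) \<longlonglongrightarrow> indicator X x"
    have "measure M X = measure N X"
      using lim[OF M \<open>closed X\<close> h] lim[OF N \<open>closed X\<close> h]
      by (intro LIMSEQ_unique[of "\<lambda>p. \<integral>x. h p x \<partial>N"]) (simp_all add: eq[OF h(1-3)])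
    then show ?thesis by (simp add: M.emeasure_eq_measure N.emeasure_eq_measure)
  qed
next
  show "Int_stable (Collect closed :: 'b set set)" by (auto simp: Int_stable_def)
  show "sets M = sigma_sets UNIV (Collect closed)" "sets N = sigma_sets UNIV (Collect closed)"
    using M(2) N(2) by (simp_all add: borel_eq_closed)
  show "emeasure M UNIV \<noteq> \<infinity>" for i :: nat
    using finite_measure.emeasure_finite[OF M(1)] by simp
qed auto

text \<open>Under \<open>(x, y) \<mapsto> (exp (- x), exp (- y))\<close> the quadrant becomes a subset of the unit square, and
  the Laplace transforms at integer points become the moments of the image measures.  Polynomials are
  uniformly dense in the continuous functions on the square, so the moments determine these measures.\<close>

lemma laplace_transform_unique_2d:
  fixes M N :: "(real \<times> real) measure"
  assumes M: "finite_measure M" "sets M = sets borel" and N: "finite_measure N" "sets N = sets borel"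
  assumes posM: "AE z in M. 0 \<le> fst z \<and> 0 \<le> snd z" and posN: "AE z in N. 0 \<le> fst z \<and> 0 \<le> snd z"
  assumes eq: "\<And>i j :: nat. (\<integral>z. exp (- (real i * fst z + real j * snd z)) \<partial>M) =
     (\<integral>z. exp (- (real i * fst z + real j * snd z)) \<partial>N)"
  shows "M = N"
proof -
  define \<phi> :: "real \<times> real \<Rightarrow> real \<times> real" where "\<phi> z = (exp (- fst z), exp (- snd z))" for z
  define \<psi> :: "real \<times> real \<Rightarrow> real \<times> real" where "\<psi> z = (- ln (fst z), - ln (snd z))" for z
  define K :: "(real \<times> real) set" where "K = {0..1} \<times> {0..1}"
  have [measurable]: "\<phi> \<in> borel_measurable borel" "\<psi> \<in> borel_measurable borel"
    unfolding \<phi>_def \<psi>_def borel_prod[symmetric] by measurable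
  note [measurable_cong] = M(2) N(2)
  have inK: "\<phi> z \<in> K" if "0 \<le> fst z \<and> 0 \<le> snd z" for z
    using that by (auto simp: \<phi>_def K_def)
  \<comment> \<open>polynomials in two variables, on which both image measures agree\<close>
  define P :: "(real \<times> real \<Rightarrow> real) \<Rightarrow> bool" where
    "P f \<longleftrightarrow> (\<exists>(A :: (nat \<times> nat \<times> real) list). f = (\<lambda>z. \<Sum>(i,j,c)\<leftarrow>A. c * fst z ^ i * snd z ^ j))" for f
  have P_mono: "P (\<lambda>z. c * fst z ^ i * snd z ^ j)" for c i j
    unfolding P_def by (intro exI[of _ "[(i,j,c)]"]) simp
  have P_add: "P (\<lambda>z. f z + g z)" if "P f" "P g" for f g
  proof -
    from that obtain A B where "f = (\<lambda>z. \<Sum>(i,j,c)\<leftarrow>A. c * fst z ^ i * snd z ^ j)"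
      "g = (\<lambda>z. \<Sum>(i,j,c)\<leftarrow>B. c * fst z ^ i * snd z ^ j)" unfolding P_def by blast
    then show ?thesis unfolding P_def by (intro exI[of _ "A @ B"]) simp
  qed
  have P_mono_mult: "P (\<lambda>z. c * fst z ^ i * snd z ^ j * g z)" if "P g" for c i j g
  proof -
    from that obtain B where B: "g = (\<lambda>z. \<Sum>(i,j,c)\<leftarrow>B. c * fst z ^ i * snd z ^ j)" unfolding P_def by blast
    have "c * fst z ^ i * snd z ^ j * (\<Sum>(i,j,c)\<leftarrow>B. c * fst z ^ i * snd z ^ j)
       = (\<Sum>(i,j,c)\<leftarrow>map (\<lambda>(i',j',c'). (i+i',j+j',c*c')) B. c * fst z ^ i * snd z ^ j)" for z
      by (induction B) (auto simp: algebra_simps power_add)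
    then show ?thesis unfolding P_def B by blast
  qed
  have P_mult: "P (\<lambda>z. f z * g z)" if f: "P f" and g: "P g" for f g
  proof -
    from f obtain A where A: "f = (\<lambda>z. \<Sum>(i,j,c)\<leftarrow>A. c * fst z ^ i * snd z ^ j)" unfolding P_def by blast
    show ?thesis unfolding A
    proof (induction A)
      case Nil
      show ?case using P_mono[of 0 0 0] by simp
    next
      case (Cons x A)
      obtain i j c where x: "x = (i,j,c)" by (cases x) auto
      show ?case using P_add[OF P_mono_mult[OF g, of c i j] Cons] by (simp add: x algebra_simps)
    qed
  qed
  have P_cont: "continuous_on S f" if "P f" for f S
  proof -
    from that obtain A where A: "f = (\<lambda>z. \<Sum>(i,j,c)\<leftarrow>A. c * fst z ^ i * snd z ^ j)" unfolding P_def by blast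
    show ?thesis unfolding A
    proof (induction A)
      case (Cons x A)
      then show ?case by (cases x) (auto intro!: continuous_intros)
    qed simp
  qed
  have int_bdd: "integrable L (\<lambda>z. f (\<phi> z))"
    if L: "finite_measure L" "sets L = sets borel" "AE z in L. 0 \<le> fst z \<and> 0 \<le> snd z"
      and f: "continuous_on UNIV f" for L and f :: "real \<times> real \<Rightarrow> real"
  proof -
    interpret finite_measure L by fact
    have "compact (f ` K)" using f unfolding K_def
      by (intro compact_continuous_image compact_Times) (auto intro: continuous_on_subset)
    then obtain B where B: "\<And>z. z \<in> K \<Longrightarrow> norm (f z) \<le> B"
      using compact_imp_bounded[of "f ` K"] unfolding bounded_iff by auto
    note [measurable_cong] = L(2)
    have [measurable]: "f \<in> borel_measurable borel" using f by (rule borel_measurable_continuous_onI)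
    have "AE z in L. norm (f (\<phi> z)) \<le> B"
      using L(3) by (rule eventually_mono) (blast intro: B inK)
    then show ?thesis by (rule integrable_const_bound) measurable
  qed
  have P_int: "(\<integral>z. f (\<phi> z) \<partial>M) = (\<integral>z. f (\<phi> z) \<partial>N)" if "P f" for f
  proof -
    from that obtain A where A: "f = (\<lambda>z. \<Sum>(i,j,c)\<leftarrow>A. c * fst z ^ i * snd z ^ j)" unfolding P_def by blast
    show ?thesis unfolding A
    proof (induction A)
      case (Cons x A)
      obtain i j c where x: "x = (i,j,c)" by (cases x) auto
      have mono: "c * fst (\<phi> z) ^ i * snd (\<phi> z) ^ j = c * exp (- (real i * fst z + real j * snd z))" for z
        by (simp add: \<phi>_def exp_of_nat_mult[symmetric] mult.assoc exp_add[symmetric])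
      have c1: "continuous_on UNIV (\<lambda>z. c * fst z ^ i * snd z ^ j :: real)" by (rule P_cont[OF P_mono])
      have c2: "continuous_on UNIV (\<lambda>z. \<Sum>(i,j,c)\<leftarrow>A. c * fst z ^ i * snd z ^ j :: real)" by (rule P_cont) (auto simp: P_def)
      have e1: "(\<integral>z. c * fst (\<phi> z) ^ i * snd (\<phi> z) ^ j \<partial>M) = (\<integral>z. c * fst (\<phi> z) ^ i * snd (\<phi> z) ^ j \<partial>N)"
        unfolding mono by (simp only: integral_mult_right_zero eq)
      show ?case unfolding x list.map sum_list.Cons prod.case
        by (subst (1 2) Bochner_Integration.integral_add)
           (rule int_bdd[OF M posM c1] int_bdd[OF M posM c2] int_bdd[OF N posN c1] int_bdd[OF N posN c2]
              arg_cong2[where f="(+)", OF e1 Cons])+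
    qed simp
  qed
  have "distr M borel \<phi> = distr N borel \<phi>"
  proof (rule finite_measure_eqI_continuous)
    show "finite_measure (distr M borel \<phi>)" "finite_measure (distr N borel \<phi>)"
      using M N by (auto intro!: finite_measure.finite_measure_distr)
    fix f :: "real \<times> real \<Rightarrow> real" assume f: "continuous_on UNIV f"
    then have [measurable]: "f \<in> borel_measurable borel" by (rule borel_measurable_continuous_onI)
    define d where "d = (\<integral>z. f (\<phi> z) \<partial>M) - (\<integral>z. f (\<phi> z) \<partial>N)"
    have bound: "\<bar>d\<bar> \<le> e * (measure M UNIV + measure N UNIV)" if "e > 0" for e
    proof -
      have "\<exists>g. P g \<and> (\<forall>x \<in> K. \<bar>f x - g x\<bar> < e)"
      proof (rule Stone_Weierstrass_HOL)
        show "compact K" unfolding K_def by (intro compact_Times) auto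
        show "P (\<lambda>x. c)" for c using P_mono[of c 0 0] by simp
        show "\<exists>f. P f \<and> f x \<noteq> f y" if "x \<in> K \<and> y \<in> K \<and> x \<noteq> y" for x y
        proof -
          have "P fst" "P snd" using P_mono[of 1 1 0] P_mono[of 1 0 1] by simp_all
          then show ?thesis using that prod_eqI[of x y] by blast
        qed
        show "continuous_on K f" using f continuous_on_subset by blast
      qed (use P_add P_mult P_cont that in auto)
      then obtain g where g: "P g" "\<And>x. x \<in> K \<Longrightarrow> \<bar>f x - g x\<bar> < e" by blast
      have close: "\<bar>(\<integral>z. f (\<phi> z) \<partial>L) - (\<integral>z. g (\<phi> z) \<partial>L)\<bar> \<le> e * measure L UNIV"
        if L: "finite_measure L" "sets L = sets borel" "AE z in L. 0 \<le> fst z \<and> 0 \<le> snd z" for L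
      proof -
        interpret finite_measure L by fact
        note [measurable_cong] = L(2)
        have sp: "space L = UNIV" using L(2) sets_eq_imp_space_eq by fastforce
        note i = int_bdd[OF L f] int_bdd[OF L P_cont[OF g(1)]]
        have "\<bar>(\<integral>z. f (\<phi> z) \<partial>L) - (\<integral>z. g (\<phi> z) \<partial>L)\<bar> = \<bar>\<integral>z. f (\<phi> z) - g (\<phi> z) \<partial>L\<bar>"
          using i by simp
        also have "\<dots> \<le> (\<integral>z. \<bar>f (\<phi> z) - g (\<phi> z)\<bar> \<partial>L)" by (rule integral_abs_bound)
        also have "\<dots> \<le> (\<integral>z. e \<partial>L)"
        proof (rule integral_mono_AE)
          show "AE z in L. \<bar>f (\<phi> z) - g (\<phi> z)\<bar> \<le> e"
            using L(3) by (rule eventually_mono) (blast intro: less_imp_le inK g(2))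
        qed (use i in auto)
        finally show ?thesis by (simp add: sp mult.commute)
      qed
      show ?thesis using close[OF M posM] close[OF N posN] P_int[OF g(1)]
        unfolding d_def by (simp add: algebra_simps)
    qed
    have "\<bar>d\<bar> \<le> 0 + e" if "e > 0" for e
    proof -
      let ?m = "measure M UNIV + measure N UNIV + 1"
      have m: "?m > 0" by (simp add: add_nonneg_pos)
      have "\<bar>d\<bar> \<le> e / ?m * (measure M UNIV + measure N UNIV)" using bound[of "e / ?m"] m that by simp
      also have "\<dots> \<le> e / ?m * ?m" using that m by (intro mult_left_mono) auto
      finally show ?thesis using m by simp
    qed
    then have "\<bar>d\<bar> \<le> 0" by (rule field_le_epsilon)
    then show "(\<integral>x. f x \<partial>distr M borel \<phi>) = (\<integral>x. f x \<partial>distr N borel \<phi>)"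
      by (simp add: d_def integral_distr)
  qed auto
  then have images: "distr (distr M borel \<phi>) borel \<psi> = distr (distr N borel \<phi>) borel \<psi>" by simp
  have undo: "distr (distr L borel \<phi>) borel \<psi> = L" if "sets L = sets borel" for L
  proof -
    note [measurable_cong] = that
    have "\<psi> \<circ> \<phi> = (\<lambda>x. x)" by (auto simp: \<phi>_def \<psi>_def)
    then show ?thesis by (simp add: distr_distr that distr_id2)
  qed
  show ?thesis using images unfolding undo[OF M(2)] undo[OF N(2)] .
qed

lemma closed_quadrant_sets: "{z \<in> space (borel :: (real \<times> real) measure). 0 \<le> fst z \<and> 0 \<le> snd z} \<in> sets borel"
  unfolding space_borel
  by (simp, intro borel_closed closed_Collect_conj closed_Collect_le continuous_intros)

lemma borel_measurable_exp_2d: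
  "(\<lambda>z. exp (- (u * fst z + v * snd z))) \<in> borel_measurable (borel :: (real \<times> real) measure)"
  unfolding borel_prod[symmetric] by measurable

lemma laplace_transform_unique:
  fixes M N :: "real measure"
  assumes M: "finite_measure M" "sets M = sets borel" and N: "finite_measure N" "sets N = sets borel"
  assumes posM: "AE x in M. 0 \<le> x" and posN: "AE x in N. 0 \<le> x"
  assumes eq: "\<And>i :: nat. (\<integral>x. exp (- (real i * x)) \<partial>M) = (\<integral>x. exp (- (real i * x)) \<partial>N)"
  shows "M = N"
proof -
  let ?e = "\<lambda>x::real. (x, 0::real)"
  note [measurable_cong] = M(2) N(2)
  have e[measurable]: "?e \<in> borel_measurable borel" unfolding borel_prod[symmetric] by measurable
  have f[measurable]: "fst \<in> borel_measurable (borel :: (real \<times> real) measure)" unfolding borel_prod[symmetric] by measurable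
  have eM: "?e \<in> borel_measurable M" and eN: "?e \<in> borel_measurable N" by measurable
  have "distr M borel ?e = distr N borel ?e"
  proof (rule laplace_transform_unique_2d)
    show "finite_measure (distr M borel ?e)" "finite_measure (distr N borel ?e)"
      using M N by (auto intro!: finite_measure.finite_measure_distr)
    show "AE z in distr M borel ?e. 0 \<le> fst z \<and> 0 \<le> snd z" "AE z in distr N borel ?e. 0 \<le> fst z \<and> 0 \<le> snd z"
      using posM posN
      by (simp_all only: AE_distr_iff[OF eM closed_quadrant_sets] AE_distr_iff[OF eN closed_quadrant_sets] fst_conv snd_conv order_refl simp_thms)
    show "(\<integral>z. exp (- (real i * fst z + real j * snd z)) \<partial>distr M borel ?e) =
          (\<integral>z. exp (- (real i * fst z + real j * snd z)) \<partial>distr N borel ?e)" for i j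
      unfolding integral_distr[OF eM borel_measurable_exp_2d] integral_distr[OF eN borel_measurable_exp_2d] by (use eq[of i] in simp)
  qed simp_all
  then have *: "distr (distr M borel ?e) borel fst = distr (distr N borel ?e) borel fst" by simp
  have undo: "distr (distr L borel ?e) borel fst = L" if "sets L = sets borel" for L
  proof -
    note [measurable_cong] = that
    have "fst \<circ> ?e = (\<lambda>x. x)" by auto
    then show ?thesis by (simp add: distr_distr that distr_id2)
  qed
  show ?thesis using * unfolding undo[OF M(2)] undo[OF N(2)] .
qed

section \<open>Independence\<close>

text \<open>Dominated convergence on both sides.  This serves twice: for variables that converge, and for continuous
  functions that approximate indicators.\<close>

lemma (in prob_space) expectation_prod_limit:
  fixes u :: "nat \<Rightarrow> 'i \<Rightarrow> 'a \<Rightarrow> real"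
  assumes fin: "finite J"
    and u: "\<And>p j. j \<in> J \<Longrightarrow> u p j \<in> borel_measurable M" "\<And>p j \<omega>. 0 \<le> u p j \<omega>" "\<And>p j \<omega>. u p j \<omega> \<le> 1"
    and v: "\<And>j. j \<in> J \<Longrightarrow> v j \<in> borel_measurable M"
    and lim: "\<And>j \<omega>. j \<in> J \<Longrightarrow> \<omega> \<in> space M \<Longrightarrow> (\<lambda>p. u p j \<omega>) \<longlonglongrightarrow> v j \<omega>"
    and eq: "\<And>p. expectation (\<lambda>\<omega>. \<Prod>j\<in>J. u p j \<omega>) = (\<Prod>j\<in>J. expectation (u p j))"
  shows "expectation (\<lambda>\<omega>. \<Prod>j\<in>J. v j \<omega>) = (\<Prod>j\<in>J. expectation (v j))"
proof (rule LIMSEQ_unique)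
  have prod1: "norm (\<Prod>j\<in>J. u p j \<omega>) \<le> 1" for p \<omega>
    using u by (simp add: abs_prod) (intro prod_le_1, auto)
  show "(\<lambda>p. expectation (\<lambda>\<omega>. \<Prod>j\<in>J. u p j \<omega>)) \<longlonglongrightarrow> expectation (\<lambda>\<omega>. \<Prod>j\<in>J. v j \<omega>)"
    by (rule integral_dominated_convergence[where w="\<lambda>_. 1"])
       (use u v lim prod1 in \<open>auto intro!: tendsto_prod borel_measurable_prod\<close>)
  show "(\<lambda>p. expectation (\<lambda>\<omega>. \<Prod>j\<in>J. u p j \<omega>)) \<longlonglongrightarrow> (\<Prod>j\<in>J. expectation (v j))"
    unfolding eq
  proof (rule tendsto_prod)
    fix j assume j: "j \<in> J"
    show "(\<lambda>p. expectation (u p j)) \<longlonglongrightarrow> expectation (v j)"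
      by (rule integral_dominated_convergence[where w="\<lambda>_. 1"]) (use u v lim j in auto)
  qed
qed

text \<open>For continuous bounded functions of the variables the product formula for expectations survives the
  limit by dominated convergence; approximating indicators of closed sets turns it into the product
  formula for a generator of the Borel sets.\<close>

lemma (in prob_space) indep_vars_tendsto:
  fixes X :: "'i \<Rightarrow> 'a \<Rightarrow> 'b::metric_space"
  assumes fin: "finite I" and ind: "\<And>m. indep_vars (\<lambda>_. borel) (Y m) I"
    and lim: "\<And>i \<omega>. i \<in> I \<Longrightarrow> \<omega> \<in> space M \<Longrightarrow> (\<lambda>m :: nat. Y m i \<omega>) \<longlonglongrightarrow> X i \<omega>"
  shows "indep_vars (\<lambda>_. borel) X I"
proof -
  have Ym: "Y m i \<in> borel_measurable M" if "i \<in> I" for i m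
    using ind[of m] that by (auto simp: indep_vars_def)
  have Xm: "X i \<in> borel_measurable M" if "i \<in> I" for i
    using lim[OF that] Ym[OF that] by (rule borel_measurable_LIMSEQ_metric[rotated])
  have cont: "expectation (\<lambda>\<omega>. \<Prod>j\<in>J. f j (X j \<omega>)) = (\<Prod>j\<in>J. expectation (\<lambda>\<omega>. f j (X j \<omega>)))"
    if J: "J \<subseteq> I" and f: "\<And>j. continuous_on UNIV (f j)" "\<And>j x. 0 \<le> f j x" "\<And>j x. f j x \<le> 1"
    for J and f :: "'i \<Rightarrow> 'b \<Rightarrow> real"
  proof -
    have fJ: "finite J" using J fin finite_subset by auto
    have fm: "f j \<in> borel_measurable borel" for j using f(1) by (rule borel_measurable_continuous_onI)
    have fX: "(\<lambda>\<omega>. f j (X j \<omega>)) \<in> borel_measurable M" if "j \<in> J" for j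
      using J that by (intro measurable_compose[OF Xm fm]) auto
    have fY: "(\<lambda>\<omega>. f j (Y m j \<omega>)) \<in> borel_measurable M" if "j \<in> J" for j m
      using J that by (intro measurable_compose[OF Ym fm]) auto
    have flim: "(\<lambda>m. f j (Y m j \<omega>)) \<longlonglongrightarrow> f j (X j \<omega>)" if "j \<in> J" "\<omega> \<in> space M" for j \<omega>
      using lim[of j \<omega>] that J f(1)[of j]
      by (auto intro!: isCont_tendsto_compose[of _ "f j"] simp: continuous_on_eq_continuous_at)
    have factor: "expectation (\<lambda>\<omega>. \<Prod>j\<in>J. f j (Y m j \<omega>)) = (\<Prod>j\<in>J. expectation (\<lambda>\<omega>. f j (Y m j \<omega>)))" for m
    proof (rule indep_vars_lebesgue_integral)
      show "indep_vars (\<lambda>_. borel) (\<lambda>j \<omega>. f j (Y m j \<omega>)) J"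
        using indep_vars_compose2[OF indep_vars_subset[OF ind J] fm] .
      show "integrable M (\<lambda>\<omega>. f j (Y m j \<omega>))" if "j \<in> J" for j
        using fY[OF that, of m] f by (intro integrable_const_bound[where B=1]) auto
    qed (rule fJ)
    show ?thesis
      by (rule expectation_prod_limit[where u="\<lambda>m j \<omega>. f j (Y m j \<omega>)" and v="\<lambda>j \<omega>. f j (X j \<omega>)"])
        (rule fJ fY f(2,3) fX flim factor | assumption)+
  qed
  define F where "F i = {X i -` C \<inter> space M | C. closed C}" for i
  have clos: "prob (\<Inter>j\<in>J. X j -` C j \<inter> space M) = (\<Prod>j\<in>J. prob (X j -` C j \<inter> space M))"
    if J: "J \<subseteq> I" "J \<noteq> {}" and C: "\<And>j. j \<in> J \<Longrightarrow> closed (C j)" for J C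
  proof -
    have fJ: "finite J" using J fin finite_subset by auto
    \<comment> \<open>a family of closed sets over all indices, so that approximations can be chosen for all of them\<close>
    define D where "D j = (if j \<in> J then C j else {})" for j
    have "closed (D j)" for j using C by (auto simp: D_def)
    then have "\<forall>j. \<exists>h :: nat \<Rightarrow> 'b \<Rightarrow> real. (\<forall>p. continuous_on UNIV (h p)) \<and> (\<forall>p x. 0 \<le> h p x) \<and> (\<forall>p x. h p x \<le> 1) \<and>
        (\<forall>x. (\<lambda>p. h p x) \<longlonglongrightarrow> indicator (D j) x)"
      by (metis closed_indicator_approx)
    then obtain h :: "'i \<Rightarrow> nat \<Rightarrow> 'b \<Rightarrow> real" where h: "\<And>j p. continuous_on UNIV (h j p)" "\<And>j p x. 0 \<le> h j p x"
      "\<And>j p x. h j p x \<le> 1" "\<And>j x. (\<lambda>p. h j p x) \<longlonglongrightarrow> indicator (D j) x" by metis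
    have hX: "(\<lambda>\<omega>. h j p (X j \<omega>)) \<in> borel_measurable M" if "j \<in> J" for j p
      using J that by (intro measurable_compose[OF Xm borel_measurable_continuous_onI] h) auto
    have iX: "(\<lambda>\<omega>. indicat_real (D j) (X j \<omega>) :: real) \<in> borel_measurable M" if "j \<in> J" for j
      using J that \<open>closed (D j)\<close> by (intro measurable_compose[OF Xm borel_measurable_indicator]) auto
    have "expectation (\<lambda>\<omega>. \<Prod>j\<in>J. indicat_real (D j) (X j \<omega>)) = (\<Prod>j\<in>J. expectation (\<lambda>\<omega>. indicat_real (D j) (X j \<omega>)))"
      by (rule expectation_prod_limit[where u="\<lambda>p j \<omega>. h j p (X j \<omega>)" and v="\<lambda>j \<omega>. indicat_real (D j) (X j \<omega>)"])
        (rule fJ hX h(2-4) iX cont[OF J(1)] h(1) | assumption)+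
    moreover have "expectation (\<lambda>\<omega>. indicat_real (D j) (X j \<omega>)) = prob (X j -` C j \<inter> space M)" if "j \<in> J" for j
    proof -
      have "expectation (\<lambda>\<omega>. indicat_real (D j) (X j \<omega>)) = expectation (indicator (X j -` C j \<inter> space M))"
        using that by (intro Bochner_Integration.integral_cong) (auto simp: D_def indicator_def)
      then show ?thesis by simp
    qed
    moreover have "expectation (\<lambda>\<omega>. \<Prod>j\<in>J. indicat_real (D j) (X j \<omega>)) = prob (\<Inter>j\<in>J. X j -` C j \<inter> space M)"
    proof -
      have "expectation (\<lambda>\<omega>. \<Prod>j\<in>J. indicat_real (D j) (X j \<omega>)) = expectation (indicator (\<Inter>j\<in>J. X j -` C j \<inter> space M))"
      proof (rule Bochner_Integration.integral_cong)
        fix \<omega> assume "\<omega> \<in> space M"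
        then show "(\<Prod>j\<in>J. indicat_real (D j) (X j \<omega>)) = (indicator (\<Inter>j\<in>J. X j -` C j \<inter> space M) \<omega> :: real)"
          using fJ by (auto simp: D_def indicator_def prod_zero_iff intro!: prod.neutral)
      qed simp
      moreover have "(\<Inter>j\<in>J. X j -` C j \<inter> space M) \<subseteq> space M" using J by auto
      ultimately show ?thesis by (simp add: Int_absorb2)
    qed
    ultimately show ?thesis by simp
  qed
  have "indep_sets F I"
  proof (rule indep_setsI)
    show "F i \<subseteq> events" if "i \<in> I" for i
      using Xm[OF that] by (auto simp: F_def intro!: measurable_sets borel_closed)
    fix A J assume J: "J \<noteq> {}" "J \<subseteq> I" "finite J" "\<forall>j\<in>J. A j \<in> F j"
    then have "\<forall>j\<in>J. \<exists>C. closed C \<and> A j = X j -` C \<inter> space M" by (auto simp: F_def)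
    then obtain C where C: "\<And>j. j \<in> J \<Longrightarrow> closed (C j) \<and> A j = X j -` C j \<inter> space M" by metis
    then show "prob (\<Inter>j\<in>J. A j) = (\<Prod>j\<in>J. prob (A j))"
      using clos[OF J(2,1), of C] by (simp cong: INF_cong prod.cong)
  qed
  moreover have "Int_stable (F i)" for i
  proof (rule Int_stableI)
    fix A B assume "A \<in> F i" "B \<in> F i"
    then obtain C D where "closed C" "closed D" "A = X i -` C \<inter> space M" "B = X i -` D \<inter> space M"
      by (auto simp: F_def)
    then show "A \<inter> B \<in> F i" unfolding F_def by (intro CollectI exI[of _ "C \<inter> D"]) auto
  qed
  ultimately have "indep_sets (\<lambda>i. sigma_sets (space M) (F i)) I" by (rule indep_sets_sigma)
  moreover have "{X i -` A \<inter> space M |A. A \<in> sets borel} = sigma_sets (space M) (F i)" for i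
    using sigma_sets_vimage_commute[of "X i" "space M" UNIV "Collect closed"]
    by (simp add: F_def borel_eq_closed)
  moreover have "sigma_sets (space M) (sigma_sets (space M) (F i)) = sigma_sets (space M) (F i)" for i
    by (rule sigma_sets_sigma_sets_eq) (auto simp: F_def)
  ultimately have "indep_sets (\<lambda>i. sigma_sets (space M) {X i -` A \<inter> space M |A. A \<in> sets borel}) I"
    by simp
  then show ?thesis using Xm by (simp add: indep_vars_def)
qed

lemma indep_rv_iff:
  assumes "prob_space \<Omega>"
  shows "indep_rv \<Omega> S X S' Y \<longleftrightarrow> X \<in> measurable \<Omega> S \<and> Y \<in> measurable \<Omega> S' \<and>
    (\<forall>A\<in>sets S. \<forall>B\<in>sets S'. measure \<Omega> (X -` A \<inter> Y -` B \<inter> space \<Omega>) =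
       measure \<Omega> (X -` A \<inter> space \<Omega>) * measure \<Omega> (Y -` B \<inter> space \<Omega>))"
proof -
  interpret prob_space \<Omega> by fact
  have *: "(X -` A \<inter> space \<Omega>) \<inter> (Y -` B \<inter> space \<Omega>) = X -` A \<inter> Y -` B \<inter> space \<Omega>" for A B by auto
  show ?thesis unfolding indep_rv_def indep_sets2_eq
    by (auto simp: * intro: measurable_sets) (metis * )
qed

lemma indep_rv_sym:
  assumes "prob_space \<Omega>" "indep_rv \<Omega> S X S' Y"
  shows "indep_rv \<Omega> S' Y S X"
  using assms(2) unfolding indep_rv_iff[OF assms(1)] by (auto simp: ac_simps)

lemma indep_rv_compose:
  assumes P: "prob_space \<Omega>" and ind: "indep_rv \<Omega> S X S' Y"
    and f: "f \<in> measurable S N" and g: "g \<in> measurable S' N'"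
    and X': "\<And>\<omega>. \<omega> \<in> space \<Omega> \<Longrightarrow> X' \<omega> = f (X \<omega>)" and Y': "\<And>\<omega>. \<omega> \<in> space \<Omega> \<Longrightarrow> Y' \<omega> = g (Y \<omega>)"
  shows "indep_rv \<Omega> N X' N' Y'"
proof -
  have X: "X \<in> measurable \<Omega> S" and Y: "Y \<in> measurable \<Omega> S'" using ind by (auto simp: indep_rv_def)
  have "X' \<in> measurable \<Omega> N" "Y' \<in> measurable \<Omega> N'"
    using measurable_compose[OF X f] measurable_compose[OF Y g] measurable_cong[of \<Omega> X' _ N] measurable_cong[of \<Omega> Y' _ N'] X' Y'
    by auto
  moreover have "measure \<Omega> (X' -` A \<inter> Y' -` B \<inter> space \<Omega>) =
      measure \<Omega> (X' -` A \<inter> space \<Omega>) * measure \<Omega> (Y' -` B \<inter> space \<Omega>)"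
    if AB: "A \<in> sets N" "B \<in> sets N'" for A B
  proof -
    let ?A = "f -` A \<inter> space S" and ?B = "g -` B \<inter> space S'"
    have "X' -` A \<inter> space \<Omega> = X -` ?A \<inter> space \<Omega>" "Y' -` B \<inter> space \<Omega> = Y -` ?B \<inter> space \<Omega>"
      "X' -` A \<inter> Y' -` B \<inter> space \<Omega> = X -` ?A \<inter> Y -` ?B \<inter> space \<Omega>"
      using measurable_space[OF X] X' measurable_space[OF Y] Y' by auto
    moreover have "?A \<in> sets S" "?B \<in> sets S'" using f g AB by (auto simp: measurable_sets)
    ultimately show ?thesis using ind unfolding indep_rv_iff[OF P] by metis
  qed
  ultimately show ?thesis unfolding indep_rv_iff[OF P] by blast
qed

lemma indep_rv_distr:
  assumes P: "prob_space \<Omega>" and ind: "indep_rv \<Omega> S X S' Y"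
  shows "distr \<Omega> (S \<Otimes>\<^sub>M S') (\<lambda>\<omega>. (X \<omega>, Y \<omega>)) = distr \<Omega> S X \<Otimes>\<^sub>M distr \<Omega> S' Y"
proof -
  interpret prob_space \<Omega> by fact
  have X[measurable]: "X \<in> measurable \<Omega> S" and Y[measurable]: "Y \<in> measurable \<Omega> S'" using ind by (auto simp: indep_rv_def)
  interpret X: prob_space "distr \<Omega> S X" by (rule prob_space_distr) fact
  interpret Y: prob_space "distr \<Omega> S' Y" by (rule prob_space_distr) fact
  show ?thesis
  proof (rule pair_measure_eqI[symmetric])
    fix A B assume [measurable]: "A \<in> sets (distr \<Omega> S X)" "B \<in> sets (distr \<Omega> S' Y)"
    then have AB: "A \<in> sets S" "B \<in> sets S'" by simp_all
    have "(\<lambda>\<omega>. (X \<omega>, Y \<omega>)) -` (A \<times> B) \<inter> space \<Omega> = X -` A \<inter> Y -` B \<inter> space \<Omega>" by auto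
    then show "emeasure (distr \<Omega> S X) A * emeasure (distr \<Omega> S' Y) B = emeasure (distr \<Omega> (S \<Otimes>\<^sub>M S') (\<lambda>\<omega>. (X \<omega>, Y \<omega>))) (A \<times> B)"
      using AB ind by (simp add: emeasure_distr emeasure_eq_measure ennreal_mult indep_rv_iff[OF P])
  qed (auto simp: X.sigma_finite_measure_axioms Y.sigma_finite_measure_axioms)
qed

lemma indep_rv_imp_indep_var:
  assumes P: "prob_space \<Omega>" and ind: "indep_rv \<Omega> S X S' Y"
  shows "prob_space.indep_var \<Omega> S X S' Y"
proof -
  interpret prob_space \<Omega> by fact
  have X: "X \<in> measurable \<Omega> S" and Y: "Y \<in> measurable \<Omega> S'"
    and I: "indep_set {X -` A \<inter> space \<Omega> |A. A \<in> sets S} {Y -` B \<inter> space \<Omega> |B. B \<in> sets S'}"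
    using ind by (auto simp: indep_rv_def)
  have stable: "Int_stable {X -` A \<inter> space \<Omega> |A. A \<in> sets S}" for X :: "'a \<Rightarrow> 'x" and S
  proof (rule Int_stableI)
    fix a b assume "a \<in> {X -` A \<inter> space \<Omega> |A. A \<in> sets S}" "b \<in> {X -` A \<inter> space \<Omega> |A. A \<in> sets S}"
    then obtain A B where "A \<in> sets S" "B \<in> sets S" "a = X -` A \<inter> space \<Omega>" "b = X -` B \<inter> space \<Omega>" by blast
    then show "a \<inter> b \<in> {X -` A \<inter> space \<Omega> |A. A \<in> sets S}" by (intro CollectI exI[of _ "A \<inter> B"]) auto
  qed
  show ?thesis unfolding indep_var_eq
    using X Y indep_set_sigma_sets[OF I stable stable] by auto
qed

lemma indep_var_imp_indep_rv:
  assumes P: "prob_space \<Omega>" and ind: "prob_space.indep_var \<Omega> S X S' Y"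
  shows "indep_rv \<Omega> S X S' Y"
proof -
  interpret prob_space \<Omega> by fact
  show ?thesis
    using ind unfolding indep_var_eq indep_rv_def indep_sets2_eq
    by (auto intro: sigma_sets.Basic)
qed

section \<open>Product measures and families of normal variables\<close>

lemma sigma_finite_PiM:
  "finite I \<Longrightarrow> sigma_finite_measure N \<Longrightarrow> sigma_finite_measure (PiM I (\<lambda>_. N))"
  by (intro product_sigma_finite.sigma_finite product_sigma_finite.intro)

lemma distr_PiM_componentwise:
  assumes fin: "finite I" and N: "\<And>i. sigma_finite_measure (N i)"
    and f: "\<And>i. f i \<in> measurable (N i) (L i)" and D: "\<And>i. sigma_finite_measure (distr (N i) (L i) (f i))"
  shows "distr (PiM I N) (PiM I L) (\<lambda>x. \<lambda>i\<in>I. f i (x i)) = PiM I (\<lambda>i. distr (N i) (L i) (f i))"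
proof -
  interpret N: product_sigma_finite N using N by (rule product_sigma_finite.intro)
  interpret D: product_sigma_finite "\<lambda>i. distr (N i) (L i) (f i)" using D by (rule product_sigma_finite.intro)
  note [measurable] = f
  have meas: "(\<lambda>x. \<lambda>i\<in>I. f i (x i)) \<in> measurable (PiM I N) (PiM I L)" by measurable
  show ?thesis
  proof (rule D.PiM_eqI[OF fin])
    show "sets (distr (PiM I N) (PiM I L) (\<lambda>x. \<lambda>i\<in>I. f i (x i))) = sets (PiM I (\<lambda>i. distr (N i) (L i) (f i)))"
      by (simp cong: sets_PiM_cong)
    fix A assume "\<And>i. i \<in> I \<Longrightarrow> A i \<in> sets (distr (N i) (L i) (f i))"
    then have A: "\<And>i. i \<in> I \<Longrightarrow> A i \<in> sets (L i)" by simp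
    have "(\<lambda>x. \<lambda>i\<in>I. f i (x i)) -` Pi\<^sub>E I A \<inter> space (PiM I N) = Pi\<^sub>E I (\<lambda>i. f i -` A i \<inter> space (N i))"
      by (auto simp: space_PiM PiE_iff)
    then have "emeasure (distr (PiM I N) (PiM I L) (\<lambda>x. \<lambda>i\<in>I. f i (x i))) (Pi\<^sub>E I A) =
        emeasure (PiM I N) (Pi\<^sub>E I (\<lambda>i. f i -` A i \<inter> space (N i)))"
      using A fin by (subst emeasure_distr[OF meas]) (auto intro!: sets_PiM_I_finite)
    also have "\<dots> = (\<Prod>i\<in>I. emeasure (N i) (f i -` A i \<inter> space (N i)))"
      using A fin f by (intro N.emeasure_PiM) (auto intro: measurable_sets)
    also have "\<dots> = (\<Prod>i\<in>I. emeasure (distr (N i) (L i) (f i)) (A i))"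
      using A f by (intro prod.cong refl) (simp add: emeasure_distr)
    finally show "emeasure (distr (PiM I N) (PiM I L) (\<lambda>x. \<lambda>i\<in>I. f i (x i))) (Pi\<^sub>E I A) =
      (\<Prod>i\<in>I. emeasure (distr (N i) (L i) (f i)) (A i))" .
  qed
qed

lemma PiM_density:
  assumes fin: "finite I" and N: "\<And>i. sigma_finite_measure (N i)"
    and f: "\<And>i. f i \<in> borel_measurable (N i)" and D: "\<And>i. sigma_finite_measure (density (N i) (f i))"
  shows "PiM I (\<lambda>i. density (N i) (f i)) = density (PiM I N) (\<lambda>x. \<Prod>i\<in>I. f i (x i))"
proof -
  interpret N: product_sigma_finite N using N by (rule product_sigma_finite.intro)
  interpret D: product_sigma_finite "\<lambda>i. density (N i) (f i)" using D by (rule product_sigma_finite.intro)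
  note [measurable] = f
  have meas: "(\<lambda>x. \<Prod>i\<in>I. f i (x i)) \<in> borel_measurable (PiM I N)" by measurable
  show ?thesis
  proof (rule D.PiM_eqI[OF fin, symmetric])
    show "sets (density (PiM I N) (\<lambda>x. \<Prod>i\<in>I. f i (x i))) = sets (PiM I (\<lambda>i. density (N i) (f i)))"
      by (simp cong: sets_PiM_cong)
    fix A assume "\<And>i. i \<in> I \<Longrightarrow> A i \<in> sets (density (N i) (f i))"
    then have A: "\<And>i. i \<in> I \<Longrightarrow> A i \<in> sets (N i)" by simp
    have "emeasure (density (PiM I N) (\<lambda>x. \<Prod>i\<in>I. f i (x i))) (Pi\<^sub>E I A) =
       (\<integral>\<^sup>+x. (\<Prod>i\<in>I. f i (x i)) * indicator (Pi\<^sub>E I A) x \<partial>PiM I N)"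
      using A fin by (intro emeasure_density meas) (auto intro!: sets_PiM_I_finite)
    also have "\<dots> = (\<integral>\<^sup>+x. (\<Prod>i\<in>I. f i (x i) * indicator (A i) (x i)) \<partial>PiM I N)"
    proof (rule nn_integral_cong)
      fix x assume "x \<in> space (PiM I N)"
      then have "(indicator (Pi\<^sub>E I A) x :: ennreal) = (\<Prod>i\<in>I. indicator (A i) (x i))"
        using fin by (auto simp: indicator_def space_PiM PiE_iff intro!: prod.neutral[symmetric])
      then show "(\<Prod>i\<in>I. f i (x i)) * indicator (Pi\<^sub>E I A) x = (\<Prod>i\<in>I. f i (x i) * indicator (A i) (x i))"
        by (simp add: prod.distrib)
    qed
    also have "\<dots> = (\<Prod>i\<in>I. \<integral>\<^sup>+y. f i y * indicator (A i) y \<partial>N i)"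
      using A fin by (intro N.product_nn_integral_prod) auto
    also have "\<dots> = (\<Prod>i\<in>I. emeasure (density (N i) (f i)) (A i))"
      using A by (intro prod.cong refl) (simp add: emeasure_density)
    finally show "emeasure (density (PiM I N) (\<lambda>x. \<Prod>i\<in>I. f i (x i))) (Pi\<^sub>E I A) =
      (\<Prod>i\<in>I. emeasure (density (N i) (f i)) (A i))" .
  qed
qed

text \<open>On boxes \<open>Pi\<^sub>E I E\<close> whose sides are arbitrary sets of pairs, Tonelli's theorem splits the integral
  of the product of the indicators twice into a product of integrals.\<close>

lemma distr_PiM_zip:
  assumes fin: "finite I" and A: "\<And>i. sigma_finite_measure (A i)" and B: "\<And>i. sigma_finite_measure (B i)"
  shows "distr (PiM I A \<Otimes>\<^sub>M PiM I B) (PiM I (\<lambda>i. A i \<Otimes>\<^sub>M B i)) (\<lambda>z. \<lambda>i\<in>I. (fst z i, snd z i))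
    = PiM I (\<lambda>i. A i \<Otimes>\<^sub>M B i)"
proof -
  interpret A: product_sigma_finite A using A by (rule product_sigma_finite.intro)
  interpret B: product_sigma_finite B using B by (rule product_sigma_finite.intro)
  interpret AB: product_sigma_finite "\<lambda>i. A i \<Otimes>\<^sub>M B i"
    by (rule product_sigma_finite.intro) (rule sigma_finite_pair_measure[OF A B])
  interpret FA: finite_product_sigma_finite A I by standard fact
  interpret FB: finite_product_sigma_finite B I by standard fact
  have meas: "(\<lambda>z. \<lambda>i\<in>I. (fst z i, snd z i)) \<in> measurable (PiM I A \<Otimes>\<^sub>M PiM I B) (PiM I (\<lambda>i. A i \<Otimes>\<^sub>M B i))"
    by measurable
  show ?thesis
  proof (rule AB.PiM_eqI[OF fin])
    fix E assume E: "\<And>i. i \<in> I \<Longrightarrow> E i \<in> sets (A i \<Otimes>\<^sub>M B i)"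
    then have PE: "Pi\<^sub>E I E \<in> sets (PiM I (\<lambda>i. A i \<Otimes>\<^sub>M B i))" using fin by (intro sets_PiM_I_finite) auto
    have ind: "(indicator (Pi\<^sub>E I E) (\<lambda>i\<in>I. (x i, y i)) :: ennreal) = (\<Prod>i\<in>I. indicator (E i) (x i, y i))" for x y
      using fin by (auto simp: indicator_def PiE_iff intro!: prod.neutral[symmetric])
    have "emeasure (distr (PiM I A \<Otimes>\<^sub>M PiM I B) (PiM I (\<lambda>i. A i \<Otimes>\<^sub>M B i)) (\<lambda>z. \<lambda>i\<in>I. (fst z i, snd z i))) (Pi\<^sub>E I E)
        = (\<integral>\<^sup>+z. indicator (Pi\<^sub>E I E) (\<lambda>i\<in>I. (fst z i, snd z i)) \<partial>(PiM I A \<Otimes>\<^sub>M PiM I B))"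
      using PE by (subst nn_integral_distr[OF meas, symmetric]) auto
    also have "\<dots> = (\<integral>\<^sup>+x. \<integral>\<^sup>+y. indicator (Pi\<^sub>E I E) (\<lambda>i\<in>I. (x i, y i)) \<partial>PiM I B \<partial>PiM I A)"
      using measurable_compose[OF meas borel_measurable_indicator[OF PE]]
      by (subst FB.nn_integral_fst[symmetric]) simp_all
    also have "\<dots> = (\<integral>\<^sup>+x. \<integral>\<^sup>+y. (\<Prod>i\<in>I. indicator (E i) (x i, y i)) \<partial>PiM I B \<partial>PiM I A)"
      by (simp only: ind)
    also have "\<dots> = (\<integral>\<^sup>+x. (\<Prod>i\<in>I. \<integral>\<^sup>+b. indicator (E i) (x i, b) \<partial>B i) \<partial>PiM I A)"
    proof (rule nn_integral_cong)
      fix x assume "x \<in> space (PiM I A)"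
      then have "x i \<in> space (A i)" if "i \<in> I" for i using that by (auto simp: space_PiM)
      then show "(\<integral>\<^sup>+y. (\<Prod>i\<in>I. indicator (E i) (x i, y i)) \<partial>PiM I B) = (\<Prod>i\<in>I. \<integral>\<^sup>+b. indicator (E i) (x i, b) \<partial>B i)"
        using E fin by (intro B.product_nn_integral_prod) auto
    qed
    also have "\<dots> = (\<Prod>i\<in>I. \<integral>\<^sup>+a. \<integral>\<^sup>+b. indicator (E i) (a, b) \<partial>B i \<partial>A i)"
      using E fin by (intro A.product_nn_integral_prod sigma_finite_measure.borel_measurable_nn_integral[OF B]) auto
    also have "\<dots> = (\<Prod>i\<in>I. emeasure (A i \<Otimes>\<^sub>M B i) (E i))"
      using E by (intro prod.cong refl) (simp add: sigma_finite_measure.emeasure_pair_measure[OF B])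
    finally show "emeasure (distr (PiM I A \<Otimes>\<^sub>M PiM I B) (PiM I (\<lambda>i. A i \<Otimes>\<^sub>M B i)) (\<lambda>z. \<lambda>i\<in>I. (fst z i, snd z i))) (Pi\<^sub>E I E)
      = (\<Prod>i\<in>I. emeasure (A i \<Otimes>\<^sub>M B i) (E i))" .
  qed simp
qed

lemma (in prob_space) indep_vars_distr_PiM:
  assumes fin: "finite I" and ind: "indep_vars N X I"
  shows "distr M (PiM I N) (\<lambda>\<omega>. \<lambda>i\<in>I. X i \<omega>) = PiM I (\<lambda>i. distr M (N i) (X i))"
proof (cases "I = {}")
  case True
  have "distr M (PiM {} N) (\<lambda>_ _. undefined) = PiM {} (\<lambda>i. distr M (N i) (X i))"
  proof (rule measure_eqI)
    fix A assume "A \<in> sets (distr M (PiM {} N) (\<lambda>_ _. undefined))"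
    then have "A \<subseteq> {\<lambda>_. undefined}" by (auto simp: PiM_empty)
    then consider "A = {}" | "A = {\<lambda>_. undefined}" by auto
    then show "emeasure (distr M (PiM {} N) (\<lambda>_ _. undefined)) A = emeasure (PiM {} (\<lambda>i. distr M (N i) (X i))) A"
      by cases (simp_all add: PiM_empty emeasure_distr emeasure_space_1)
  qed (simp add: PiM_empty)
  moreover have "(\<lambda>\<omega>. \<lambda>i\<in>{}. X i \<omega>) = (\<lambda>_ _. undefined)" by (auto simp: restrict_def)
  ultimately show ?thesis using True by simp
next
  case False
  then show ?thesis
    using ind by (subst indep_vars_iff_distr_eq_PiM'[symmetric]) (auto simp: indep_vars_def)
qed

lemma normal_affine_law:
  fixes m s :: "'i \<Rightarrow> real"
  assumes fin: "finite I" and s: "\<And>i. i \<in> I \<Longrightarrow> 0 < s i"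
  shows "distr (PiM I (\<lambda>_. density lborel std_normal_density)) (PiM I (\<lambda>_. lborel)) (\<lambda>e. \<lambda>i\<in>I. m i + s i * e i)
     = density (PiM I (\<lambda>_. lborel)) (\<lambda>x. \<Prod>i\<in>I. ennreal (normal_density (m i) (s i) (x i)))"
proof -
  let ?N = "density lborel (\<lambda>x. ennreal (std_normal_density x))"
  \<comment> \<open>the product locales ask for \<open>\<sigma>\<close>-finite factors at all indices, so the scale is made positive outside \<open>I\<close> as well\<close>
  define s' where "s' i = (if i \<in> I then s i else 1)" for i
  have s': "0 < s' i" for i using s by (auto simp: s'_def)
  interpret N: prob_space ?N by (rule prob_space_normal_density) simp
  have D: "distr ?N lborel (\<lambda>e. m i + s' i * e) = density lborel (\<lambda>x. ennreal (normal_density (m i) (s' i) x))" for i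
  proof -
    have "distributed ?N lborel (\<lambda>x. x) (\<lambda>x. ennreal (std_normal_density x))"
      by (auto simp: distributed_def intro!: distr_id2)
    from N.normal_density_affine[OF this, of "s' i" "m i"] show ?thesis
      using s'[of i] by (simp add: distributed_def)
  qed
  have pd: "prob_space (density lborel (\<lambda>x. ennreal (normal_density (m i) (s' i) x)))" for i
    using s' by (rule prob_space_normal_density)
  have sf: "sigma_finite_measure (density lborel (\<lambda>x. ennreal (normal_density (m i) (s' i) x)))" for i
    using pd by (rule prob_space_imp_sigma_finite)
  have "distr (PiM I (\<lambda>_. ?N)) (PiM I (\<lambda>_. lborel)) (\<lambda>e. \<lambda>i\<in>I. m i + s' i * e i)
      = PiM I (\<lambda>i. distr ?N lborel (\<lambda>e. m i + s' i * e))"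
    using fin by (rule distr_PiM_componentwise[where f="\<lambda>i e. m i + s' i * e"])
      (auto simp: D sf N.sigma_finite_measure_axioms)
  also have "\<dots> = density (PiM I (\<lambda>_. lborel)) (\<lambda>x. \<Prod>i\<in>I. ennreal (normal_density (m i) (s' i) (x i)))"
    unfolding D using fin by (rule PiM_density) (auto simp: sf lborel.sigma_finite_measure_axioms)
  finally show ?thesis by (simp add: s'_def cong: restrict_cong prod.cong if_cong)
qed

text \<open>Conditioning on \<open>Z\<close> amounts to freezing it: the joint law of \<open>\<epsilon>\<close> and \<open>Z\<close> is a
  product, and for a frozen value the affine images of the \<open>\<epsilon> i\<close> have the stated normal density.
  Positivity of the scales is needed since an affine image with scale \<open>0\<close> has no density.\<close>

lemma (in prob_space) nn_integral_normal_mixture: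
  fixes \<epsilon> :: "'i \<Rightarrow> 'a \<Rightarrow> real" and m s :: "'i \<Rightarrow> 'z \<Rightarrow> real"
  assumes fin: "finite I" and eps: "indep_vars (\<lambda>_. borel) \<epsilon> I"
    and std: "\<And>i. i \<in> I \<Longrightarrow> distributed M lborel (\<epsilon> i) std_normal_density"
    and ind: "indep_rv M (PiM I (\<lambda>_. borel)) (\<lambda>\<omega>. \<lambda>i\<in>I. \<epsilon> i \<omega>) S Z"
    and m: "\<And>i. i \<in> I \<Longrightarrow> m i \<in> borel_measurable S" and s: "\<And>i. i \<in> I \<Longrightarrow> s i \<in> borel_measurable S"
    and pos: "\<And>i \<omega>. i \<in> I \<Longrightarrow> \<omega> \<in> space M \<Longrightarrow> 0 < s i (Z \<omega>)"
    and F: "F \<in> borel_measurable (PiM I (\<lambda>_. lborel) \<Otimes>\<^sub>M S)"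
  shows "(\<integral>\<^sup>+\<omega>. F (\<lambda>i\<in>I. m i (Z \<omega>) + s i (Z \<omega>) * \<epsilon> i \<omega>, Z \<omega>) \<partial>M) =
    (\<integral>\<^sup>+\<omega>. \<integral>\<^sup>+x. (\<Prod>i\<in>I. ennreal (normal_density (m i (Z \<omega>)) (s i (Z \<omega>)) (x i))) * F (x, Z \<omega>) \<partial>PiM I (\<lambda>_. lborel) \<partial>M)"
proof -
  let ?N = "density lborel (\<lambda>x. ennreal (std_normal_density x))"
  let ?E = "\<lambda>\<omega>. \<lambda>i\<in>I. \<epsilon> i \<omega>"
  let ?L = "PiM I (\<lambda>_. lborel) :: ('i \<Rightarrow> real) measure"
  let ?B = "PiM I (\<lambda>_. borel) :: ('i \<Rightarrow> real) measure"
  let ?g = "\<lambda>e z. \<lambda>i\<in>I. m i z + s i z * e i"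
  have Z: "Z \<in> measurable M S" and E: "?E \<in> measurable M ?B" using ind by (auto simp: indep_rv_def)
  note [measurable] = Z E m s F
  have LB[measurable_cong]: "sets ?B = sets ?L" by (rule sets_PiM_cong) auto
  interpret Ep: prob_space "distr M ?B ?E" by (rule prob_space_distr) fact
  interpret Zp: prob_space "distr M S Z" by (rule prob_space_distr) fact
  interpret pair_sigma_finite "distr M ?B ?E" "distr M S Z" ..
  have law: "distr M ?B ?E = PiM I (\<lambda>_. ?N)"
  proof -
    have "distr M borel (\<epsilon> i) = ?N" if "i \<in> I" for i
      using std[OF that] by (simp add: distributed_def cong: distr_cong)
    then show ?thesis using indep_vars_distr_PiM[OF fin eps] by (simp cong: PiM_cong)
  qed
  have g: "(\<lambda>(e, z). ?g e z) \<in> measurable (?B \<Otimes>\<^sub>M S) ?L"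
    by (simp add: split_beta') measurable
  note [measurable] = g
  have "(\<integral>\<^sup>+\<omega>. F (\<lambda>i\<in>I. m i (Z \<omega>) + s i (Z \<omega>) * \<epsilon> i \<omega>, Z \<omega>) \<partial>M)
      = (\<integral>\<^sup>+\<omega>. F (?g (?E \<omega>) (Z \<omega>), Z \<omega>) \<partial>M)"
    by (simp cong: restrict_cong)
  also have "\<dots> = (\<integral>\<^sup>+(e, z). F (?g e z, z) \<partial>distr M (?B \<Otimes>\<^sub>M S) (\<lambda>\<omega>. (?E \<omega>, Z \<omega>)))"
    by (subst nn_integral_distr) (auto simp: split_beta')
  also have "\<dots> = (\<integral>\<^sup>+(e, z). F (?g e z, z) \<partial>(distr M ?B ?E \<Otimes>\<^sub>M distr M S Z))"
    by (simp only: indep_rv_distr[OF prob_space_axioms ind])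
  also have "\<dots> = (\<integral>\<^sup>+z. \<integral>\<^sup>+e. F (?g e z, z) \<partial>distr M ?B ?E \<partial>distr M S Z)"
    by (subst nn_integral_snd[symmetric]) (auto simp: split_beta')
  also have "\<dots> = (\<integral>\<^sup>+\<omega>. \<integral>\<^sup>+e. F (?g e (Z \<omega>), Z \<omega>) \<partial>distr M ?B ?E \<partial>M)"
    by (subst nn_integral_distr) (auto intro!: Ep.borel_measurable_nn_integral simp: split_beta')
  also have "\<dots> = (\<integral>\<^sup>+\<omega>. \<integral>\<^sup>+x. (\<Prod>i\<in>I. ennreal (normal_density (m i (Z \<omega>)) (s i (Z \<omega>)) (x i))) * F (x, Z \<omega>) \<partial>?L \<partial>M)"
  proof (rule nn_integral_cong)
    fix \<omega> assume \<omega>: "\<omega> \<in> space M"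
    then have zS: "Z \<omega> \<in> space S" using measurable_space[OF Z] by auto
    have [measurable]: "(\<lambda>x. F (x, Z \<omega>)) \<in> borel_measurable ?L"
      using zS by measurable
    have [measurable_cong]: "sets (PiM I (\<lambda>_. ?N)) = sets ?L" by (rule sets_PiM_cong) auto
    have "(\<integral>\<^sup>+e. F (?g e (Z \<omega>), Z \<omega>) \<partial>distr M ?B ?E)
      = (\<integral>\<^sup>+x. F (x, Z \<omega>) \<partial>distr (PiM I (\<lambda>_. ?N)) ?L (\<lambda>e. ?g e (Z \<omega>)))"
      unfolding law by (subst nn_integral_distr) auto
    also have "\<dots> = (\<integral>\<^sup>+x. F (x, Z \<omega>) \<partial>density ?L (\<lambda>x. \<Prod>i\<in>I. ennreal (normal_density (m i (Z \<omega>)) (s i (Z \<omega>)) (x i))))"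
      using pos \<omega> by (subst normal_affine_law[OF fin]) auto
    also have "\<dots> = (\<integral>\<^sup>+x. (\<Prod>i\<in>I. ennreal (normal_density (m i (Z \<omega>)) (s i (Z \<omega>)) (x i))) * F (x, Z \<omega>) \<partial>?L)"
      by (subst nn_integral_density) auto
    finally show "(\<integral>\<^sup>+e. F (?g e (Z \<omega>), Z \<omega>) \<partial>distr M ?B ?E) =
      (\<integral>\<^sup>+x. (\<Prod>i\<in>I. ennreal (normal_density (m i (Z \<omega>)) (s i (Z \<omega>)) (x i))) * F (x, Z \<omega>) \<partial>?L)" .
  qed
  finally show ?thesis .
qed

section \<open>Gamma laws\<close>

text \<open>This is Euler's integral after the substitution \<open>y \<mapsto> b * y\<close>.\<close>

lemma nn_integral_gamma_exp:
  fixes b c :: real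
  assumes c: "c > 0" and b: "b > 0"
  shows "(\<integral>\<^sup>+y. ennreal (indicator {0..} y * y powr (c - 1) * exp (- b * y)) \<partial>lborel) = ennreal (Gamma c / b powr c)"
proof -
  let ?I = "\<integral>\<^sup>+y. ennreal (indicator {0..} y * y powr (c - 1) * exp (- b * y)) \<partial>lborel"
  have "ennreal (Gamma c) = (\<integral>\<^sup>+ t. ennreal (indicator {0..} t * t powr (c - 1) / exp t) \<partial>lborel)"
    using c by (rule Gamma_conv_nn_integral_real)
  also have "\<dots> = ennreal \<bar>b\<bar> * (\<integral>\<^sup>+ t. ennreal (indicator {0..} (0 + b * t) * (0 + b * t) powr (c - 1) / exp (0 + b * t)) \<partial>lborel)"
    using b by (intro nn_integral_real_affine) auto
  also have "(\<lambda>t. ennreal (indicator {0..} (0 + b * t) * (0 + b * t) powr (c - 1) / exp (0 + b * t))) =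
      (\<lambda>t. ennreal (b powr (c - 1)) * ennreal (indicator {0..} t * t powr (c - 1) * exp (- b * t)))"
  proof
    fix t
    have "indicator {0..} (0 + b * t) * (0 + b * t) powr (c - 1) / exp (0 + b * t) = b powr (c - 1) * (indicator {0..} t * t powr (c - 1) * exp (- b * t))"
      using b by (auto simp: indicator_def zero_le_mult_iff powr_mult exp_minus field_simps)
    then show "ennreal (indicator {0..} (0 + b * t) * (0 + b * t) powr (c - 1) / exp (0 + b * t)) =
        ennreal (b powr (c - 1)) * ennreal (indicator {0..} t * t powr (c - 1) * exp (- b * t))"
      by (simp add: ennreal_mult')
  qed
  also have "ennreal \<bar>b\<bar> * (\<integral>\<^sup>+t. ennreal (b powr (c - 1)) * ennreal (indicator {0..} t * t powr (c - 1) * exp (- b * t)) \<partial>lborel)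
      = ennreal (b powr c) * ?I"
    using b by (subst nn_integral_cmult)
      (auto simp: mult.assoc[symmetric] ennreal_mult'[symmetric] powr_diff)
  finally have "ennreal (Gamma c) = ennreal (b powr c) * ?I" .
  then have "ennreal (1 / b powr c) * ennreal (Gamma c) = ennreal (1 / b powr c) * (ennreal (b powr c) * ?I)" by simp
  also have "\<dots> = ?I" using b by (simp add: mult.assoc[symmetric] ennreal_mult'[symmetric])
  finally show ?thesis using c by (simp add: ennreal_mult'[symmetric])
qed

lemma gamma_density_nonneg: "c > 0 \<Longrightarrow> 0 \<le> gamma_density c y"
  by (simp add: gamma_density_def)

lemma borel_measurable_gamma_density[measurable]: "gamma_density c \<in> borel_measurable borel"
  unfolding gamma_density_def by measurable

lemma gamma_law_laplace:
  assumes c: "c > 0" and u: "u \<ge> 0"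
  shows "(\<integral>\<^sup>+y. ennreal (exp (- u * y)) \<partial>gamma_law c) = ennreal ((1 + u) powr (- c))"
proof -
  have pos: "Gamma c > 0" using c by simp
  have "(\<integral>\<^sup>+y. ennreal (exp (- u * y)) \<partial>gamma_law c) = (\<integral>\<^sup>+y. ennreal (gamma_density c y) * ennreal (exp (- u * y)) \<partial>lborel)"
    using c unfolding gamma_law_def by (simp add: nn_integral_density)
  also have "\<dots> = (\<integral>\<^sup>+y. ennreal (1 / Gamma c) * ennreal (indicator {0..} y * y powr (c - 1) * exp (- (1 + u) * y)) \<partial>lborel)"
  proof (rule nn_integral_cong)
    fix y :: real
    have "gamma_density c y * exp (- u * y) = 1 / Gamma c * (indicator {0..} y * y powr (c - 1) * exp (- (1 + u) * y))"
    proof -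
      have "exp (- (1 + u) * y) = exp (- y) * exp (- u * y)" by (simp add: exp_add[symmetric] algebra_simps)
      then show ?thesis by (auto simp: gamma_density_def indicator_def)
    qed
    then show "ennreal (gamma_density c y) * ennreal (exp (- u * y)) = ennreal (1 / Gamma c) * ennreal (indicator {0..} y * y powr (c - 1) * exp (- (1 + u) * y))"
      using c pos by (simp add: ennreal_mult'[symmetric] gamma_density_nonneg)
  qed
  also have "\<dots> = ennreal (1 / Gamma c) * ennreal (Gamma c / (1 + u) powr c)"
    using nn_integral_gamma_exp[of c "1 + u"] c u by (subst nn_integral_cmult) auto
  also have "\<dots> = ennreal ((1 + u) powr (- c))"
    using pos by (simp add: ennreal_mult'[symmetric] powr_minus_divide)
  finally show ?thesis .
qed

lemma sets_gamma_law[simp, measurable_cong]: "sets (gamma_law c) = sets borel"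
  by (simp add: gamma_law_def)

lemma space_gamma_law[simp]: "space (gamma_law c) = UNIV"
  by (simp add: gamma_law_def)

lemma prob_space_gamma_law: "c > 0 \<Longrightarrow> prob_space (gamma_law c)"
  using gamma_law_laplace[of c 0] by (intro prob_spaceI) simp

lemma AE_gamma_law_nonneg: "c > 0 \<Longrightarrow> AE y in gamma_law c. 0 \<le> y"
  unfolding gamma_law_def by (simp add: AE_density) (auto simp: gamma_density_def)

lemma gamma_law_laplace_integral:
  assumes c: "c > 0" and u: "u \<ge> 0"
  shows "(\<integral>y. exp (- u * y) \<partial>gamma_law c) = (1 + u) powr (- c)"
  using gamma_law_laplace[OF assms] by (subst integral_eq_nn_integral) auto

section \<open>The total mass and the first moment of a Gamma random measure on an exponential grid\<close>

text \<open>The points \<open>exp (a * k / m - a)\<close> for \<open>k = 0, \<dots>, m\<close> cut \<open>(exp (- a), 1]\<close> into \<open>m\<close>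
  cells that correspond to equal pieces of a block of length \<open>a\<close>; this is the right end of cell \<open>k\<close>.\<close>

definition right_end :: "real \<Rightarrow> nat \<Rightarrow> nat \<Rightarrow> real" where
  "right_end a m k = exp (a * real (Suc k) / real m - a)"

text \<open>\<open>D k\<close> is the mass in cell \<open>k\<close>: \<open>T\<close> is the total of \<open>m\<close> independent Gamma masses of
  shape \<open>\<kappa> / m\<close>, and \<open>S\<close> is their first moment up to an error governed by the width of the
  cells.\<close>

definition gamma_cells ::
    "'a measure \<Rightarrow> real \<Rightarrow> real \<Rightarrow> ('a \<Rightarrow> real) \<Rightarrow> ('a \<Rightarrow> real) \<Rightarrow> nat \<Rightarrow> (nat \<Rightarrow> 'a \<Rightarrow> real) \<Rightarrow> bool" where
  "gamma_cells \<Omega> \<kappa> a S T m D \<longleftrightarrow> prob_space.indep_vars \<Omega> (\<lambda>_. borel) D {..<m} \<and>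
     (\<forall>k<m. (AE \<omega> in \<Omega>. 0 \<le> D k \<omega>) \<and>
        (\<forall>u\<ge>0. (\<integral>\<omega>. exp (- u * D k \<omega>) \<partial>\<Omega>) = (1 + u) powr (- \<kappa> / real m))) \<and>
     (AE \<omega> in \<Omega>. T \<omega> = (\<Sum>k<m. D k \<omega>) \<and>
        \<bar>S \<omega> - (\<Sum>k<m. right_end a m k * D k \<omega>)\<bar> \<le> (1 - exp (- a / real m)) * T \<omega>)"

text \<open>Letting \<open>m\<close> grow pins down the joint law of \<open>S\<close> and \<open>T\<close>.  Block integrals of the Gamma
  subordinator and first moments of Gamma random measures both have this form.\<close>

definition gamma_mean_pair :: "'a measure \<Rightarrow> real \<Rightarrow> real \<Rightarrow> ('a \<Rightarrow> real) \<Rightarrow> ('a \<Rightarrow> real) \<Rightarrow> bool" where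
  "gamma_mean_pair \<Omega> \<kappa> a S T \<longleftrightarrow> S \<in> borel_measurable \<Omega> \<and> T \<in> borel_measurable \<Omega> \<and>
     (\<forall>m>0. \<exists>D. gamma_cells \<Omega> \<kappa> a S T m D)"

text \<open>The weighted sums over the cells converge to \<open>S\<close> almost surely, and the Laplace transform of each
  of them together with \<open>T\<close> is a product by independence.\<close>

lemma gamma_mean_pair_limit:
  assumes P: "prob_space \<Omega>" and pair: "gamma_mean_pair \<Omega> \<kappa> a S T"
  shows "AE \<omega> in \<Omega>. 0 \<le> S \<omega> \<and> 0 \<le> T \<omega>"
    and "0 \<le> u \<Longrightarrow> 0 \<le> v \<Longrightarrow> (\<lambda>m. \<Prod>k<Suc m. (1 + (u * right_end a (Suc m) k + v)) powr (- \<kappa> / real (Suc m)))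
      \<longlonglongrightarrow> (\<integral>\<omega>. exp (- (u * S \<omega> + v * T \<omega>)) \<partial>\<Omega>)"
proof -
  interpret prob_space \<Omega> by fact
  have S[measurable]: "S \<in> borel_measurable \<Omega>" and T[measurable]: "T \<in> borel_measurable \<Omega>"
    using pair by (auto simp: gamma_mean_pair_def)
  have "\<exists>D. gamma_cells \<Omega> \<kappa> a S T (Suc m) D" for m
    using pair by (simp add: gamma_mean_pair_def)
  then obtain D where D: "\<And>m. gamma_cells \<Omega> \<kappa> a S T (Suc m) (D m)" by metis
  have ind: "\<And>m. indep_vars (\<lambda>_. borel) (D m) {..<Suc m}"
    and pos: "\<And>m k. k < Suc m \<Longrightarrow> AE \<omega> in \<Omega>. 0 \<le> D m k \<omega>"
    and lap: "\<And>m k u. k < Suc m \<Longrightarrow> 0 \<le> u \<Longrightarrow> expectation (\<lambda>\<omega>. exp (- u * D m k \<omega>)) = (1 + u) powr (- \<kappa> / real (Suc m))"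
    and ae: "\<And>m. AE \<omega> in \<Omega>. T \<omega> = (\<Sum>k<Suc m. D m k \<omega>) \<and>
          \<bar>S \<omega> - (\<Sum>k<Suc m. right_end a (Suc m) k * D m k \<omega>)\<bar> \<le> (1 - exp (- a / real (Suc m))) * T \<omega>"
    using D unfolding gamma_cells_def by blast+
  have Dm: "D m k \<in> borel_measurable \<Omega>" if "k < Suc m" for m k
    using ind[of m] that by (auto simp: indep_vars_def)
  define R where "R m \<omega> = (\<Sum>k<Suc m. right_end a (Suc m) k * D m k \<omega>)" for m \<omega>
  have Rm[measurable]: "R m \<in> borel_measurable \<Omega>" for m
    unfolding R_def by (intro borel_measurable_sum borel_measurable_times Dm) auto
  have all: "AE \<omega> in \<Omega>. \<forall>m. T \<omega> = (\<Sum>k<Suc m. D m k \<omega>) \<and> (\<forall>k<Suc m. 0 \<le> D m k \<omega>) \<and>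
       \<bar>S \<omega> - R m \<omega>\<bar> \<le> (1 - exp (- a / real (Suc m))) * T \<omega>"
  proof -
    have "AE \<omega> in \<Omega>. \<forall>k\<in>{..<Suc m}. 0 \<le> D m k \<omega>" for m
      using pos by (intro AE_finite_allI) auto
    then have "AE \<omega> in \<Omega>. T \<omega> = (\<Sum>k<Suc m. D m k \<omega>) \<and> (\<forall>k<Suc m. 0 \<le> D m k \<omega>) \<and>
       \<bar>S \<omega> - R m \<omega>\<bar> \<le> (1 - exp (- a / real (Suc m))) * T \<omega>" for m
      using ae[of m] unfolding R_def by eventually_elim auto
    then show ?thesis unfolding AE_all_countable ..
  qed
  have conv: "R m \<omega> \<ge> 0" "T \<omega> \<ge> 0" "(\<lambda>m. R m \<omega>) \<longlonglongrightarrow> S \<omega>"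
    if w: "\<forall>m. T \<omega> = (\<Sum>k<Suc m. D m k \<omega>) \<and> (\<forall>k<Suc m. 0 \<le> D m k \<omega>) \<and>
       \<bar>S \<omega> - R m \<omega>\<bar> \<le> (1 - exp (- a / real (Suc m))) * T \<omega>" for m \<omega>
  proof -
    show "R m \<omega> \<ge> 0" unfolding R_def using w by (intro sum_nonneg mult_nonneg_nonneg) (auto simp: right_end_def)
    have "T \<omega> = (\<Sum>k<Suc 0. D 0 k \<omega>)" "\<forall>k<Suc 0. 0 \<le> D 0 k \<omega>" using w by blast+
    then show "T \<omega> \<ge> 0" by simp
    have l: "(\<lambda>m. (1 - exp (- a / real (Suc m))) * T \<omega>) \<longlonglongrightarrow> (1 - exp 0) * T \<omega>"
      by (intro tendsto_intros) (rule LIMSEQ_Suc[OF lim_const_over_n])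
    have "(\<lambda>m. R m \<omega> - S \<omega>) \<longlonglongrightarrow> 0"
      by (rule Lim_null_comparison[OF always_eventually l[simplified]]) (use w in \<open>auto simp: abs_minus_commute\<close>)
    then show "(\<lambda>m. R m \<omega>) \<longlonglongrightarrow> S \<omega>" by (simp add: LIM_zero_iff)
  qed
  show "AE \<omega> in \<Omega>. 0 \<le> S \<omega> \<and> 0 \<le> T \<omega>"
    using all
  proof eventually_elim
    case (elim \<omega>)
    note c = conv[OF elim]
    show ?case using LIMSEQ_le_const[OF c(3), of 0] c(1,2) by auto
  qed
  assume uv: "0 \<le> u" "0 \<le> v"
  have lim: "(\<lambda>m. expectation (\<lambda>\<omega>. exp (- (u * R m \<omega> + v * T \<omega>)))) \<longlonglongrightarrow> expectation (\<lambda>\<omega>. exp (- (u * S \<omega> + v * T \<omega>)))"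
  proof (rule integral_dominated_convergence[where w="\<lambda>_. 1"])
    show "AE \<omega> in \<Omega>. (\<lambda>m. exp (- (u * R m \<omega> + v * T \<omega>))) \<longlonglongrightarrow> exp (- (u * S \<omega> + v * T \<omega>))"
      using all by eventually_elim (intro tendsto_intros conv(3))
    show "AE \<omega> in \<Omega>. norm (exp (- (u * R m \<omega> + v * T \<omega>))) \<le> 1" for m
      using all
    proof eventually_elim
      case (elim \<omega>)
      have "0 \<le> u * R m \<omega> + v * T \<omega>"
        using conv(1,2)[OF elim] uv by (intro add_nonneg_nonneg mult_nonneg_nonneg)
      then show ?case by simp
    qed
  qed auto
  have "expectation (\<lambda>\<omega>. exp (- (u * R m \<omega> + v * T \<omega>))) =
      (\<Prod>k<Suc m. (1 + (u * right_end a (Suc m) k + v)) powr (- \<kappa> / real (Suc m)))" for m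
  proof -
    let ?c = "\<lambda>k. u * right_end a (Suc m) k + v"
    have c: "0 \<le> ?c k" for k using uv by (simp add: right_end_def)
    have "expectation (\<lambda>\<omega>. exp (- (u * R m \<omega> + v * T \<omega>))) = expectation (\<lambda>\<omega>. \<Prod>k<Suc m. exp (- ?c k * D m k \<omega>))"
    proof (rule integral_cong_AE)
      show "(\<lambda>\<omega>. \<Prod>k<Suc m. exp (- ?c k * D m k \<omega>)) \<in> borel_measurable \<Omega>"
        using Dm by (intro borel_measurable_prod borel_measurable_exp borel_measurable_times borel_measurable_const) auto
      show "AE \<omega> in \<Omega>. exp (- (u * R m \<omega> + v * T \<omega>)) = (\<Prod>k<Suc m. exp (- ?c k * D m k \<omega>))"
        using all
      proof eventually_elim
        case (elim \<omega>)
        then have T: "T \<omega> = (\<Sum>k<Suc m. D m k \<omega>)" by blast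
        have "- (u * R m \<omega> + v * T \<omega>) = (\<Sum>k<Suc m. - ?c k * D m k \<omega>)"
          unfolding R_def T by (simp only: sum_distrib_left sum.distrib[symmetric] sum_negf[symmetric])
            (auto intro!: sum.cong simp: algebra_simps)
        then show ?case by (simp only: exp_sum[OF finite_lessThan])
      qed
    qed auto
    also have "\<dots> = (\<Prod>k<Suc m. expectation (\<lambda>\<omega>. exp (- ?c k * D m k \<omega>)))"
    proof (rule indep_vars_lebesgue_integral)
      show "indep_vars (\<lambda>_. borel) (\<lambda>k \<omega>. exp (- ?c k * D m k \<omega>)) {..<Suc m}"
        by (rule indep_vars_compose2[OF ind]) auto
      show "integrable \<Omega> (\<lambda>\<omega>. exp (- ?c k * D m k \<omega>))" if "k \<in> {..<Suc m}" for k
      proof (rule integrable_const_bound[where B=1])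
        show "AE \<omega> in \<Omega>. norm (exp (- ?c k * D m k \<omega>)) \<le> 1"
          using pos[OF that[unfolded lessThan_iff]]
        proof eventually_elim
          case (elim \<omega>)
          then have "0 \<le> ?c k * D m k \<omega>" using c by (rule mult_nonneg_nonneg[rotated])
          then show ?case by (simp only: real_norm_def abs_exp_cancel exp_le_one_iff mult_minus_left neg_le_0_iff_le)
        qed
        show "(\<lambda>\<omega>. exp (- ?c k * D m k \<omega>)) \<in> borel_measurable \<Omega>"
        proof -
          have [measurable]: "D m k \<in> borel_measurable \<Omega>" using Dm that by simp
          show ?thesis by measurable
        qed
      qed
    qed simp
    also have "\<dots> = (\<Prod>k<Suc m. (1 + ?c k) powr (- \<kappa> / real (Suc m)))"
      using c by (intro prod.cong refl lap) auto
    finally show ?thesis .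
  qed
  with lim show "(\<lambda>m. \<Prod>k<Suc m. (1 + (u * right_end a (Suc m) k + v)) powr (- \<kappa> / real (Suc m)))
      \<longlonglongrightarrow> (\<integral>\<omega>. exp (- (u * S \<omega> + v * T \<omega>)) \<partial>\<Omega>)" by simp
qed

lemma gamma_mean_pair_joint_law:
  assumes P: "prob_space \<Omega>" and pair: "gamma_mean_pair \<Omega> \<kappa> a S T"
  shows "finite_measure (distr \<Omega> borel (\<lambda>\<omega>. (S \<omega>, T \<omega>)))"
    and "AE z in distr \<Omega> borel (\<lambda>\<omega>. (S \<omega>, T \<omega>)). 0 \<le> fst z \<and> 0 \<le> snd z"
    and "(\<integral>z. exp (- (real i * fst z + real j * snd z)) \<partial>distr \<Omega> borel (\<lambda>\<omega>. (S \<omega>, T \<omega>))) =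
      (\<integral>\<omega>. exp (- (real i * S \<omega> + real j * T \<omega>)) \<partial>\<Omega>)"
proof -
  interpret prob_space \<Omega> by fact
  note Q = closed_quadrant_sets
  note E = borel_measurable_exp_2d
  have m: "(\<lambda>\<omega>. (S \<omega>, T \<omega>)) \<in> borel_measurable \<Omega>"
    using pair unfolding borel_prod[symmetric] by (auto simp: gamma_mean_pair_def)
  show "finite_measure (distr \<Omega> borel (\<lambda>\<omega>. (S \<omega>, T \<omega>)))" using m by (rule finite_measure_distr)
  show "AE z in distr \<Omega> borel (\<lambda>\<omega>. (S \<omega>, T \<omega>)). 0 \<le> fst z \<and> 0 \<le> snd z"
    using gamma_mean_pair_limit(1)[OF P pair] by (subst AE_distr_iff[OF m Q]) simp
  show "(\<integral>z. exp (- (real i * fst z + real j * snd z)) \<partial>distr \<Omega> borel (\<lambda>\<omega>. (S \<omega>, T \<omega>))) =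
      (\<integral>\<omega>. exp (- (real i * S \<omega> + real j * T \<omega>)) \<partial>\<Omega>)"
    by (subst integral_distr[OF m E]) simp
qed

text \<open>The limiting products depend on \<open>\<kappa>\<close> and \<open>a\<close> only.\<close>

lemma gamma_mean_pair_distr_eq:
  assumes "prob_space \<Omega>" "gamma_mean_pair \<Omega> \<kappa> a S T" and "prob_space \<Omega>'" "gamma_mean_pair \<Omega>' \<kappa> a S' T'"
  shows "distr \<Omega> borel (\<lambda>\<omega>. (S \<omega>, T \<omega>)) = distr \<Omega>' borel (\<lambda>\<omega>. (S' \<omega>, T' \<omega>))"
proof (rule laplace_transform_unique_2d)
  fix i j :: nat
  have "(\<integral>\<omega>. exp (- (real i * S \<omega> + real j * T \<omega>)) \<partial>\<Omega>) = (\<integral>\<omega>. exp (- (real i * S' \<omega> + real j * T' \<omega>)) \<partial>\<Omega>')"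
    using gamma_mean_pair_limit(2)[OF assms(1,2) of_nat_0_le_iff of_nat_0_le_iff, of i j]
      gamma_mean_pair_limit(2)[OF assms(3,4) of_nat_0_le_iff of_nat_0_le_iff, of i j]
    by (rule LIMSEQ_unique)
  then show "(\<integral>z. exp (- (real i * fst z + real j * snd z)) \<partial>distr \<Omega> borel (\<lambda>\<omega>. (S \<omega>, T \<omega>))) =
      (\<integral>z. exp (- (real i * fst z + real j * snd z)) \<partial>distr \<Omega>' borel (\<lambda>\<omega>. (S' \<omega>, T' \<omega>)))"
    by (simp only: gamma_mean_pair_joint_law[OF assms(1,2)] gamma_mean_pair_joint_law[OF assms(3,4)])
qed (simp_all only: sets_distr gamma_mean_pair_joint_law[OF assms(1,2)] gamma_mean_pair_joint_law[OF assms(3,4)])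

text \<open>The factor \<open>1 + s\<close> can be taken out of each factor of the approximating product, and the \<open>m\<close>
  exponents \<open>- \<kappa> / m\<close> add up to \<open>- \<kappa>\<close> regardless of \<open>m\<close>.\<close>

lemma gamma_mean_pair_scaling:
  assumes P: "prob_space \<Omega>" and pair: "gamma_mean_pair \<Omega> \<kappa> a S T"
    and uv: "0 \<le> u" "0 \<le> v" "0 \<le> s"
  shows "(\<integral>\<omega>. exp (- (u * S \<omega> + (v + s) * T \<omega>)) \<partial>\<Omega>) =
    (1 + s) powr (- \<kappa>) * (\<integral>\<omega>. exp (- (u / (1 + s) * S \<omega> + v / (1 + s) * T \<omega>)) \<partial>\<Omega>)"
proof -
  let ?q = "1 + s"
  have "(\<Prod>k<Suc m. (1 + (u * right_end a (Suc m) k + (v + s))) powr (- \<kappa> / real (Suc m))) =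
      ?q powr (- \<kappa>) * (\<Prod>k<Suc m. (1 + (u / ?q * right_end a (Suc m) k + v / ?q)) powr (- \<kappa> / real (Suc m)))" for m
  proof -
    have "(1 + (u * right_end a (Suc m) k + (v + s))) powr (- \<kappa> / real (Suc m)) =
       ?q powr (- \<kappa> / real (Suc m)) * (1 + (u / ?q * right_end a (Suc m) k + v / ?q)) powr (- \<kappa> / real (Suc m))" for k
    proof -
      have "1 + (u * right_end a (Suc m) k + (v + s)) = ?q * (1 + (u / ?q * right_end a (Suc m) k + v / ?q))"
      proof -
        have "?q \<noteq> 0" using uv by simp
        then show ?thesis by (simp only: distrib_left times_divide_eq_left times_divide_eq_right nonzero_mult_div_cancel_left)
            simp
      qed
      moreover have "0 \<le> 1 + (u / ?q * right_end a (Suc m) k + v / ?q)"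
        using uv by (intro add_nonneg_nonneg mult_nonneg_nonneg divide_nonneg_nonneg) (auto simp: right_end_def)
      ultimately show ?thesis using uv by (simp add: powr_mult)
    qed
    moreover have "(?q powr (- \<kappa> / real (Suc m))) ^ Suc m = ?q powr (- \<kappa>)"
      using uv by (subst powr_realpow[symmetric]) (auto simp: powr_powr simp del: of_nat_Suc)
    ultimately show ?thesis by (simp only: prod.distrib prod_constant card_lessThan)
  qed
  moreover have "(\<lambda>m. \<Prod>k<Suc m. (1 + (u * right_end a (Suc m) k + (v + s))) powr (- \<kappa> / real (Suc m)))
      \<longlonglongrightarrow> (\<integral>\<omega>. exp (- (u * S \<omega> + (v + s) * T \<omega>)) \<partial>\<Omega>)"
    using uv by (intro gamma_mean_pair_limit(2)[OF P pair]) auto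
  moreover have "(\<lambda>m. ?q powr (- \<kappa>) * (\<Prod>k<Suc m. (1 + (u / ?q * right_end a (Suc m) k + v / ?q)) powr (- \<kappa> / real (Suc m))))
      \<longlonglongrightarrow> ?q powr (- \<kappa>) * (\<integral>\<omega>. exp (- (u / ?q * S \<omega> + v / ?q * T \<omega>)) \<partial>\<Omega>)"
    using uv by (intro tendsto_mult_left gamma_mean_pair_limit(2)[OF P pair]) auto
  ultimately show ?thesis by (simp add: LIMSEQ_unique)
qed

lemma gamma_mean_pair_tilt:
  assumes P: "prob_space \<Omega>" and pair: "gamma_mean_pair \<Omega> \<kappa> a S T" and s: "0 \<le> s"
  shows "distr (density \<Omega> (\<lambda>\<omega>. ennreal (exp (- s * T \<omega>)))) borel (\<lambda>\<omega>. (S \<omega>, T \<omega>)) =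
    distr (density \<Omega> (\<lambda>\<omega>. ennreal ((1 + s) powr (- \<kappa>)))) borel (\<lambda>\<omega>. (S \<omega> / (1 + s), T \<omega> / (1 + s)))"
    (is "distr ?D1 _ ?X = distr ?D2 _ ?Y")
proof -
  interpret prob_space \<Omega> by fact
  have [measurable]: "S \<in> borel_measurable \<Omega>" "T \<in> borel_measurable \<Omega>"
    using pair by (auto simp: gamma_mean_pair_def)
  have X: "?X \<in> borel_measurable \<Omega>" and Y: "?Y \<in> borel_measurable \<Omega>"
    unfolding borel_prod[symmetric] by measurable
  note Q = closed_quadrant_sets
  note E = borel_measurable_exp_2d
  have nonneg: "AE \<omega> in \<Omega>. 0 \<le> S \<omega> \<and> 0 \<le> T \<omega>" by (rule gamma_mean_pair_limit(1)[OF P pair])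
  have int1: "integrable \<Omega> (\<lambda>\<omega>. exp (- s * T \<omega>))"
  proof (rule integrable_const_bound[where B=1])
    show "AE \<omega> in \<Omega>. norm (exp (- s * T \<omega>)) \<le> 1" using nonneg by eventually_elim (use s in auto)
  qed measurable
  have fin: "finite_measure ?D1" "finite_measure ?D2"
    using int1 by (auto intro!: finite_measureI simp: emeasure_density nn_integral_eq_integral ennreal_mult_eq_top_iff)
  show ?thesis
  proof (rule laplace_transform_unique_2d)
    show "finite_measure (distr ?D1 borel ?X)" "finite_measure (distr ?D2 borel ?Y)"
      using fin X Y by (auto intro!: finite_measure.finite_measure_distr)
    show "AE z in distr ?D1 borel ?X. 0 \<le> fst z \<and> 0 \<le> snd z"
      using nonneg X by (subst AE_distr_iff[OF _ Q]) (auto simp: AE_density)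
    show "AE z in distr ?D2 borel ?Y. 0 \<le> fst z \<and> 0 \<le> snd z"
      using nonneg Y s by (subst AE_distr_iff[OF _ Q]) (auto simp: AE_density)
    fix i j :: nat
    have "(\<integral>z. exp (- (real i * fst z + real j * snd z)) \<partial>distr ?D1 borel ?X) =
      (\<integral>\<omega>. exp (- s * T \<omega>) * exp (- (real i * S \<omega> + real j * T \<omega>)) \<partial>\<Omega>)"
      using X by (subst integral_distr[OF _ E]) (auto simp: integral_density)
    also have "\<dots> = (\<integral>\<omega>. exp (- (real i * S \<omega> + (real j + s) * T \<omega>)) \<partial>\<Omega>)"
      by (simp add: exp_add[symmetric] algebra_simps)
    also have "\<dots> = (1 + s) powr (- \<kappa>) * (\<integral>\<omega>. exp (- (real i / (1 + s) * S \<omega> + real j / (1 + s) * T \<omega>)) \<partial>\<Omega>)"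
      using s by (intro gamma_mean_pair_scaling[OF P pair]) auto
    also have "\<dots> = (\<integral>z. exp (- (real i * fst z + real j * snd z)) \<partial>distr ?D2 borel ?Y)"
      using Y by (subst integral_distr[OF _ E]) (auto simp: integral_density)
    finally show "(\<integral>z. exp (- (real i * fst z + real j * snd z)) \<partial>distr ?D1 borel ?X) =
      (\<integral>z. exp (- (real i * fst z + real j * snd z)) \<partial>distr ?D2 borel ?Y)" .
  qed simp_all
qed

text \<open>The tilted law of \<open>(S, T)\<close> is a multiple of the law of the rescaled pair, and \<open>S / T\<close> is invariant
  under rescaling, also where \<open>T = 0\<close> with the value \<open>0\<close> of the quotient.\<close>

lemma gamma_mean_pair_ratio_laplace:
  assumes P: "prob_space \<Omega>" and pair: "gamma_mean_pair \<Omega> \<kappa> a S T" and s: "0 \<le> s" and B: "B \<in> sets borel"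
  shows "(\<integral>\<omega>. indicator B (S \<omega> / T \<omega>) * exp (- s * T \<omega>) \<partial>\<Omega>) =
    (1 + s) powr (- \<kappa>) * measure \<Omega> ((\<lambda>\<omega>. S \<omega> / T \<omega>) -` B \<inter> space \<Omega>)"
proof -
  interpret prob_space \<Omega> by fact
  have [measurable]: "S \<in> borel_measurable \<Omega>" "T \<in> borel_measurable \<Omega>" "B \<in> sets borel"
    using pair B by (auto simp: gamma_mean_pair_def)
  have X: "(\<lambda>\<omega>. (S \<omega>, T \<omega>)) \<in> borel_measurable \<Omega>" and Y: "(\<lambda>\<omega>. (S \<omega> / (1 + s), T \<omega> / (1 + s))) \<in> borel_measurable \<Omega>"
    unfolding borel_prod[symmetric] by measurable
  let ?h = "\<lambda>z. indicator B (fst z / snd z) :: real"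
  have h: "?h \<in> borel_measurable (borel :: (real \<times> real) measure)"
    unfolding borel_prod[symmetric] by measurable
  have "(\<integral>\<omega>. indicator B (S \<omega> / T \<omega>) * exp (- s * T \<omega>) \<partial>\<Omega>) =
    (\<integral>z. ?h z \<partial>distr (density \<Omega> (\<lambda>\<omega>. ennreal (exp (- s * T \<omega>)))) borel (\<lambda>\<omega>. (S \<omega>, T \<omega>)))"
    using X by (subst integral_distr[OF _ h]) (auto simp: integral_density mult.commute)
  also have "\<dots> = (\<integral>z. ?h z \<partial>distr (density \<Omega> (\<lambda>\<omega>. ennreal ((1 + s) powr (- \<kappa>)))) borel (\<lambda>\<omega>. (S \<omega> / (1 + s), T \<omega> / (1 + s))))"
    by (simp only: gamma_mean_pair_tilt[OF P pair s])
  also have "\<dots> = (\<integral>\<omega>. (1 + s) powr (- \<kappa>) * indicator B (S \<omega> / T \<omega>) \<partial>\<Omega>)"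
    using Y s by (subst integral_distr[OF _ h]) (auto simp: integral_density)
  also have "\<dots> = (1 + s) powr (- \<kappa>) * (\<integral>\<omega>. indicator ((\<lambda>\<omega>. S \<omega> / T \<omega>) -` B \<inter> space \<Omega>) \<omega> \<partial>\<Omega>)"
    by (subst integral_mult_right_zero[symmetric], intro Bochner_Integration.integral_cong) (auto simp: indicator_def)
  finally show ?thesis by simp
qed

lemma gamma_mean_pair_laplace_total:
  assumes P: "prob_space \<Omega>" and pair: "gamma_mean_pair \<Omega> \<kappa> a S T" and s: "0 \<le> s"
  shows "(\<integral>\<omega>. exp (- s * T \<omega>) \<partial>\<Omega>) = (1 + s) powr (- \<kappa>)"
  using gamma_mean_pair_ratio_laplace[OF assms, of UNIV] prob_space.prob_space[OF P] by simp

lemma gamma_mean_pair_total_law: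
  assumes P: "prob_space \<Omega>" and pair: "gamma_mean_pair \<Omega> \<kappa> a S T" and k: "\<kappa> > 0"
  shows "distr \<Omega> borel T = gamma_law \<kappa>"
proof (rule laplace_transform_unique)
  interpret prob_space \<Omega> by fact
  have T[measurable]: "T \<in> borel_measurable \<Omega>" using pair by (auto simp: gamma_mean_pair_def)
  show "finite_measure (distr \<Omega> borel T)" by (intro finite_measure_distr) measurable
  show "finite_measure (gamma_law \<kappa>)" using prob_space_gamma_law[OF k] by (simp add: prob_space_def)
  show "AE x in distr \<Omega> borel T. 0 \<le> x"
    using gamma_mean_pair_limit(1)[OF P pair] by (subst AE_distr_iff) auto
  show "AE x in gamma_law \<kappa>. 0 \<le> x" using k by (rule AE_gamma_law_nonneg)
  fix i :: nat
  have "(\<integral>x. exp (- (real i * x)) \<partial>distr \<Omega> borel T) = (1 + real i) powr (- \<kappa>)"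
    using gamma_mean_pair_laplace_total[OF P pair, of "real i"] by (subst integral_distr) auto
  also have "\<dots> = (\<integral>x. exp (- (real i * x)) \<partial>gamma_law \<kappa>)"
    using gamma_law_laplace_integral[OF k, of "real i"] by simp
  finally show "(\<integral>x. exp (- (real i * x)) \<partial>distr \<Omega> borel T) = (\<integral>x. exp (- (real i * x)) \<partial>gamma_law \<kappa>)" .
qed simp_all

text \<open>For an event \<open>R\<close> about \<open>S / T\<close>, the law of \<open>T\<close> restricted to \<open>R\<close> and the law
  of \<open>T\<close> multiplied by the probability of \<open>R\<close> have the same Laplace transform.\<close>

lemma gamma_mean_pair_indep:
  assumes P: "prob_space \<Omega>" and pair: "gamma_mean_pair \<Omega> \<kappa> a S T"
  shows "indep_rv \<Omega> borel T borel (\<lambda>\<omega>. S \<omega> / T \<omega>)"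
  unfolding indep_rv_iff[OF P]
proof (intro conjI ballI)
  interpret prob_space \<Omega> by fact
  have [measurable]: "S \<in> borel_measurable \<Omega>" and T[measurable]: "T \<in> borel_measurable \<Omega>"
    using pair by (auto simp: gamma_mean_pair_def)
  show "T \<in> borel_measurable \<Omega>" by measurable
  show "(\<lambda>\<omega>. S \<omega> / T \<omega>) \<in> borel_measurable \<Omega>" by measurable
  fix A B :: "real set" assume A[measurable]: "A \<in> sets borel" and B[measurable]: "B \<in> sets borel"
  let ?R = "(\<lambda>\<omega>. S \<omega> / T \<omega>) -` B \<inter> space \<Omega>"
  have R[measurable]: "?R \<in> events" by measurable
  let ?N1 = "density \<Omega> (\<lambda>\<omega>. ennreal (indicator ?R \<omega>))" and ?N2 = "density \<Omega> (\<lambda>\<omega>. ennreal (prob ?R))"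
  have fin: "finite_measure ?N1" "finite_measure ?N2"
    by (auto intro!: finite_measureI simp: emeasure_density ennreal_indicator ennreal_mult_eq_top_iff)
  have nonneg: "AE \<omega> in \<Omega>. 0 \<le> T \<omega>" using gamma_mean_pair_limit(1)[OF P pair] by auto
  have "distr ?N1 borel T = distr ?N2 borel T"
  proof (rule laplace_transform_unique)
    show "finite_measure (distr ?N1 borel T)" "finite_measure (distr ?N2 borel T)"
      using fin by (auto intro!: finite_measure.finite_measure_distr)
    show "AE x in distr ?N1 borel T. 0 \<le> x" "AE x in distr ?N2 borel T. 0 \<le> x"
      using nonneg by (subst AE_distr_iff; auto simp: AE_density)+
    fix i :: nat
    have "(\<integral>x. exp (- (real i * x)) \<partial>distr ?N1 borel T) = (\<integral>\<omega>. indicator ?R \<omega> * exp (- (real i * T \<omega>)) \<partial>\<Omega>)"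
      by (subst integral_distr) (auto simp: integral_density)
    also have "\<dots> = (\<integral>\<omega>. indicator B (S \<omega> / T \<omega>) * exp (- real i * T \<omega>) \<partial>\<Omega>)"
      by (intro Bochner_Integration.integral_cong) (auto simp: indicator_def)
    also have "\<dots> = prob ?R * (\<integral>\<omega>. exp (- real i * T \<omega>) \<partial>\<Omega>)"
      unfolding gamma_mean_pair_ratio_laplace[OF P pair of_nat_0_le_iff B] gamma_mean_pair_laplace_total[OF P pair of_nat_0_le_iff]
      by simp
    also have "\<dots> = (\<integral>x. exp (- (real i * x)) \<partial>distr ?N2 borel T)"
      by (subst integral_distr) (auto simp: integral_density)
    finally show "(\<integral>x. exp (- (real i * x)) \<partial>distr ?N1 borel T) = (\<integral>x. exp (- (real i * x)) \<partial>distr ?N2 borel T)" .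
  qed simp_all
  then have "emeasure (distr ?N1 borel T) A = emeasure (distr ?N2 borel T) A" by simp
  then have "emeasure \<Omega> (T -` A \<inter> (\<lambda>\<omega>. S \<omega> / T \<omega>) -` B \<inter> space \<Omega>) = ennreal (prob ?R) * emeasure \<Omega> (T -` A \<inter> space \<Omega>)"
  proof -
    have TA: "T -` A \<inter> space \<Omega> \<in> events" by measurable
    have "emeasure (distr ?N1 borel T) A = emeasure ?N1 (T -` A \<inter> space \<Omega>)" by (subst emeasure_distr) auto
    also have "\<dots> = (\<integral>\<^sup>+\<omega>. ennreal (indicator ?R \<omega>) * indicator (T -` A \<inter> space \<Omega>) \<omega> \<partial>\<Omega>)"
      using TA by (intro emeasure_density) auto
    also have "\<dots> = (\<integral>\<^sup>+\<omega>. indicator (T -` A \<inter> (\<lambda>\<omega>. S \<omega> / T \<omega>) -` B \<inter> space \<Omega>) \<omega> \<partial>\<Omega>)"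
      by (rule nn_integral_cong) (auto simp: indicator_def)
    also have "\<dots> = emeasure \<Omega> (T -` A \<inter> (\<lambda>\<omega>. S \<omega> / T \<omega>) -` B \<inter> space \<Omega>)"
    proof (rule nn_integral_indicator)
      have "T -` A \<inter> (\<lambda>\<omega>. S \<omega> / T \<omega>) -` B \<inter> space \<Omega> = (T -` A \<inter> space \<Omega>) \<inter> ?R" by auto
      then show "T -` A \<inter> (\<lambda>\<omega>. S \<omega> / T \<omega>) -` B \<inter> space \<Omega> \<in> events" using TA R by simp
    qed
    finally have 1: "emeasure (distr ?N1 borel T) A = \<dots>" .
    have "emeasure (distr ?N2 borel T) A = emeasure ?N2 (T -` A \<inter> space \<Omega>)" by (subst emeasure_distr) auto
    also have "\<dots> = ennreal (prob ?R) * emeasure \<Omega> (T -` A \<inter> space \<Omega>)"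
      using TA by (subst emeasure_density) (auto simp: nn_integral_cmult_indicator)
    finally show ?thesis using 1 \<open>emeasure (distr ?N1 borel T) A = emeasure (distr ?N2 borel T) A\<close> by simp
  qed
  then show "prob (T -` A \<inter> (\<lambda>\<omega>. S \<omega> / T \<omega>) -` B \<inter> space \<Omega>) = prob (T -` A \<inter> space \<Omega>) * prob ?R"
    by (simp add: emeasure_eq_measure ennreal_mult'[symmetric] mult.commute)
qed

section \<open>Stieltjes integrals along an increasing path\<close>

locale increasing_path =
  fixes g :: "real \<Rightarrow> real"
  assumes mono: "mono_on {0..} g" and right_cont: "\<And>t. 0 \<le> t \<Longrightarrow> continuous (at_right t) g"
begin

abbreviation "\<mu> \<equiv> interval_measure (\<lambda>y. g (max 0 y))"
abbreviation "J s t \<equiv> stieltjes_integral g s t exp"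

lemma ext_mono: "x \<le> y \<Longrightarrow> g (max 0 x) \<le> g (max 0 y)"
  using mono by (auto simp: mono_on_def)

lemma ext_right_cont: "continuous (at_right x) (\<lambda>y. g (max 0 y))"
proof (cases "0 \<le> x")
  case True
  have "eventually (\<lambda>y. g y = g (max 0 y)) (at_right x)"
    unfolding eventually_at_right_field using True by (intro exI[of _ "x + 1"]) auto
  then have "((\<lambda>y. g (max 0 y)) \<longlongrightarrow> g x) (at_right x)"
    using right_cont[OF True] by (auto simp: continuous_within intro: Lim_transform_eventually)
  then show ?thesis using True by (simp add: continuous_within)
next
  case False
  then have "eventually (\<lambda>y. g 0 = g (max 0 y)) (at_right x)"
    unfolding eventually_at_right_field by (intro exI[of _ 0]) auto
  then have "((\<lambda>y. g (max 0 y)) \<longlongrightarrow> g 0) (at_right x)"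
    by (rule Lim_transform_eventually[rotated]) simp
  then show ?thesis using False by (simp add: continuous_within)
qed

lemma sigma_finite_path: "sigma_finite_measure \<mu>"
  by (rule sigma_finite_interval_measure[OF ext_mono ext_right_cont])

lemma emeasure_path: "0 \<le> s \<Longrightarrow> s \<le> t \<Longrightarrow> emeasure \<mu> {s<..t} = ennreal (g t - g s)"
  using emeasure_interval_measure_Ioc[OF _ ext_mono ext_right_cont, of s t] by (simp add: max_def)

lemma integrable_const_path:
  assumes "0 \<le> s" "s \<le> t"
  shows "set_integrable \<mu> {s<..t} (\<lambda>_. c :: real)" and "(LINT x:{s<..t}|\<mu>. c) = c * (g t - g s)"
proof -
  have nn: "0 \<le> g t - g s" using mono assms by (auto simp: mono_on_def)
  show "set_integrable \<mu> {s<..t} (\<lambda>_. c :: real)"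
    using emeasure_path[OF assms] by (simp add: set_integrable_def)
  show "(LINT x:{s<..t}|\<mu>. c) = c * (g t - g s)"
    using emeasure_path[OF assms] nn by (simp add: set_lebesgue_integral_def measure_def)
qed

lemma integrable_exp_path:
  assumes "0 \<le> s" "s \<le> t"
  shows "set_integrable \<mu> {s<..t} exp"
  unfolding set_integrable_def
proof (rule Bochner_Integration.integrable_bound)
  show "integrable \<mu> (\<lambda>x. indicator {s<..t} x *\<^sub>R exp t)"
    using integrable_const_path(1)[OF assms, of "exp t"] by (simp only: set_integrable_def)
  show "AE x in \<mu>. norm (indicator {s<..t} x *\<^sub>R exp x) \<le> norm (indicator {s<..t} x *\<^sub>R exp t)"
    by (auto simp: indicator_def)
qed simp

lemma J_add:
  assumes "0 \<le> s" "s \<le> t" "t \<le> u"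
  shows "J s u = J s t + J t u"
proof -
  have "{s<..u} = {s<..t} \<union> {t<..u}" using assms by auto
  then show ?thesis
    unfolding stieltjes_integral_def
    using assms by (simp only:) (intro set_integral_Un integrable_exp_path, auto)
qed

lemma J_bounds:
  assumes "0 \<le> s" "s \<le> t"
  shows "exp s * (g t - g s) \<le> J s t" and "J s t \<le> exp t * (g t - g s)"
proof -
  have "(LINT x:{s<..t}|\<mu>. exp s) \<le> J s t"
    unfolding stieltjes_integral_def
    by (rule set_integral_mono[OF integrable_const_path(1)[OF assms] integrable_exp_path[OF assms]]) auto
  then show "exp s * (g t - g s) \<le> J s t" by (simp add: integrable_const_path(2)[OF assms])
  have "J s t \<le> (LINT x:{s<..t}|\<mu>. exp t)"
    unfolding stieltjes_integral_def
    by (rule set_integral_mono[OF integrable_exp_path[OF assms] integrable_const_path(1)[OF assms]]) auto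
  then show "J s t \<le> exp t * (g t - g s)" by (simp add: integrable_const_path(2)[OF assms])
qed

lemma J_blocks:
  assumes "0 \<le> s" "incseq p" "p 0 = s"
  shows "J s (p m) = (\<Sum>k<m. J (p k) (p (Suc k)))"
proof (induction m)
  case 0
  then show ?case using assms by (simp add: stieltjes_integral_def set_lebesgue_integral_def)
next
  case (Suc m)
  have "J s (p (Suc m)) = J s (p m) + J (p m) (p (Suc m))"
    using assms incseqD[OF assms(2), of 0 m] incseqD[OF assms(2), of m "Suc m"] by (intro J_add) auto
  then show ?case by (simp add: Suc)
qed

text \<open>On a piece of length \<open>a / m\<close> the exponential varies by the factor \<open>exp (a / m)\<close>, and the weights
  at the right ends are at most \<open>1\<close>.\<close>

lemma riemann_sum_bound:
  fixes m :: nat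
  assumes s: "0 \<le> s" and a: "0 \<le> a" and m: "m > 0"
  defines "p \<equiv> \<lambda>k. s + a * real k / real m"
  shows "g (s + a) - g s = (\<Sum>k<m. g (p (Suc k)) - g (p k))"
    and "\<bar>exp (- (s + a)) * J s (s + a) - (\<Sum>k<m. exp (a * real (Suc k) / real m - a) * (g (p (Suc k)) - g (p k)))\<bar>
      \<le> (1 - exp (- a / real m)) * (g (s + a) - g s)"
proof -
  have p0: "p 0 = s" and pm: "p m = s + a" using m by (auto simp: p_def)
  have inc: "incseq p"
    unfolding p_def using a by (intro incseq_SucI add_left_mono divide_right_mono mult_left_mono) auto
  have ppos: "0 \<le> p k" for k using incseqD[OF inc, of 0 k] s p0 by simp
  have step: "p k \<le> p (Suc k)" for k using incseqD[OF inc, of k "Suc k"] by simp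
  have gs: "0 \<le> g (p (Suc k)) - g (p k)" for k
    using mono ppos step[of k] by (auto simp: mono_on_def)
  show T: "g (s + a) - g s = (\<Sum>k<m. g (p (Suc k)) - g (p k))"
    using sum_lessThan_telescope[of "\<lambda>k. g (p k)" m] by (simp add: p0 pm)
  let ?w = "\<lambda>k. exp (a * real (Suc k) / real m - a)" and ?D = "\<lambda>k. g (p (Suc k)) - g (p k)"
  let ?e = "1 - exp (- a / real m)"
  have pS: "p (Suc k) - (s + a) = a * real (Suc k) / real m - a" for k by (simp add: p_def)
  have pk: "p k - (s + a) = (a * real (Suc k) / real m - a) + - a / real m" for k
    using m by (simp add: p_def field_simps)
  have each: "0 \<le> ?w k * ?D k - exp (- (s + a)) * J (p k) (p (Suc k))"
    "?w k * ?D k - exp (- (s + a)) * J (p k) (p (Suc k)) \<le> ?e * ?D k" if "k < m" for k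
  proof -
    have u: "exp (- (s + a)) * J (p k) (p (Suc k)) \<le> ?w k * ?D k"
    proof -
      have "exp (- (s + a)) * J (p k) (p (Suc k)) \<le> exp (- (s + a)) * (exp (p (Suc k)) * ?D k)"
        using J_bounds(2)[OF ppos step, of k] by (intro mult_left_mono) auto
      also have "\<dots> = exp (p (Suc k) - (s + a)) * ?D k" by (simp add: exp_diff exp_minus exp_add field_simps)
      finally show ?thesis unfolding pS .
    qed
    then show "0 \<le> ?w k * ?D k - exp (- (s + a)) * J (p k) (p (Suc k))" by simp
    have l: "?w k * exp (- a / real m) * ?D k \<le> exp (- (s + a)) * J (p k) (p (Suc k))"
    proof -
      have "?w k * exp (- a / real m) * ?D k = exp (p k - (s + a)) * ?D k"
        unfolding pk by (simp only: exp_add)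
      also have "\<dots> = exp (- (s + a)) * (exp (p k) * ?D k)" by (simp add: exp_diff exp_minus exp_add field_simps)
      also have "\<dots> \<le> exp (- (s + a)) * J (p k) (p (Suc k))"
        using J_bounds(1)[OF ppos step, of k] by (intro mult_left_mono) auto
      finally show ?thesis .
    qed
    have "a * real (Suc k) / real m \<le> a * real m / real m"
      using that a by (intro divide_right_mono mult_left_mono) auto
    then have w1: "?w k \<le> 1" using m by simp
    have e0: "0 \<le> ?e" using a m by simp
    have "?w k * ?D k - exp (- (s + a)) * J (p k) (p (Suc k)) \<le> ?w k * (?e * ?D k)"
      using l by (simp add: algebra_simps)
    also have "\<dots> \<le> 1 * (?e * ?D k)"
      using w1 e0 gs[of k] by (intro mult_right_mono mult_nonneg_nonneg)
    finally show "?w k * ?D k - exp (- (s + a)) * J (p k) (p (Suc k)) \<le> ?e * ?D k" by simp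
  qed
  have Jsum: "exp (- (s + a)) * J s (s + a) = (\<Sum>k<m. exp (- (s + a)) * J (p k) (p (Suc k)))"
    using J_blocks[OF s inc p0, of m] by (simp add: pm sum_distrib_left)
  have "\<bar>exp (- (s + a)) * J s (s + a) - (\<Sum>k<m. ?w k * ?D k)\<bar> =
      (\<Sum>k<m. ?w k * ?D k - exp (- (s + a)) * J (p k) (p (Suc k)))"
  proof -
    have "0 \<le> (\<Sum>k<m. ?w k * ?D k - exp (- (s + a)) * J (p k) (p (Suc k)))"
      using each(1) by (intro sum_nonneg) auto
    then show ?thesis unfolding Jsum sum_subtractf by linarith
  qed
  also have "\<dots> \<le> (\<Sum>k<m. ?e * ?D k)" using each(2) by (intro sum_mono) auto
  also have "\<dots> = ?e * (g (s + a) - g s)" unfolding T by (simp add: sum_distrib_left)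
  finally show "\<bar>exp (- (s + a)) * J s (s + a) - (\<Sum>k<m. ?w k * ?D k)\<bar> \<le> ?e * (g (s + a) - g s)" .
qed

text \<open>Exchange the integrals over \<open>{(s, r). 0 < r \<and> r \<le> lam * s \<and> s \<le> t}\<close>: for fixed \<open>r\<close>,
  integrating \<open>lam * exp (- lam * s)\<close> over \<open>s\<close> from \<open>r / lam\<close> to \<open>t\<close> gives
  \<open>exp (- r) - exp (- lam * t)\<close>.\<close>

lemma discounted_integral_fubini:
  assumes lam: "0 < lam" and t: "0 \<le> t"
  shows "integrable lborel (\<lambda>s. indicator {0..t} s * (lam * exp (- lam * s) * J 0 (lam * s)))"
    and "(\<integral>s. indicator {0..t} s * (lam * exp (- lam * s) * J 0 (lam * s)) \<partial>lborel) =
      g (lam * t) - g 0 - exp (- lam * t) * J 0 (lam * t)"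
proof -
  interpret Q: sigma_finite_measure \<mu> by (rule sigma_finite_path)
  interpret pair_sigma_finite lborel \<mu> ..
  define f where "f s r = indicator {0..t} s * indicator {0<..lam * s} r * (lam * exp (- lam * s) * exp r)" for s r :: real
  have lt: "0 \<le> lam * t" using lam t by simp
  have fm: "case_prod f \<in> borel_measurable (lborel \<Otimes>\<^sub>M \<mu>)"
  proof -
    have "case_prod f = (\<lambda>z. (if 0 \<le> fst z \<and> fst z \<le> t \<and> 0 < snd z \<and> snd z \<le> lam * fst z then lam * exp (- lam * fst z) * exp (snd z) else 0))"
      by (auto simp: f_def indicator_def)
    also have "\<dots> \<in> borel_measurable (borel \<Otimes>\<^sub>M borel)" by measurable
    finally show ?thesis by (simp cong: measurable_cong_sets sets_pair_measure_cong)
  qed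
  have fi: "integrable (lborel \<Otimes>\<^sub>M \<mu>) (case_prod f)"
  proof (rule Bochner_Integration.integrable_bound[OF _ fm])
    have "emeasure (lborel \<Otimes>\<^sub>M \<mu>) ({0..t} \<times> {0<..lam * t}) < \<infinity>"
    proof -
      have "emeasure (lborel \<Otimes>\<^sub>M \<mu>) ({0..t} \<times> {0<..lam * t}) = emeasure lborel {0..t} * emeasure \<mu> {0<..lam * t}"
        by (rule Q.emeasure_pair_measure_Times) auto
      then show ?thesis using emeasure_path[OF order_refl lt] t by (simp add: ennreal_mult_less_top)
    qed
    then show "integrable (lborel \<Otimes>\<^sub>M \<mu>) (\<lambda>z. indicator ({0..t} \<times> {0<..lam * t}) z * (lam * exp (lam * t)))"
      by (intro integrable_mult_left integrable_real_indicator) auto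
    show "AE z in lborel \<Otimes>\<^sub>M \<mu>. norm (case_prod f z) \<le> norm (indicator ({0..t} \<times> {0<..lam * t}) z * (lam * exp (lam * t)))"
    proof (rule AE_I2)
      fix z :: "real \<times> real"
      obtain s r where z: "z = (s, r)" by (cases z)
      show "norm (case_prod f z) \<le> norm (indicator ({0..t} \<times> {0<..lam * t}) z * (lam * exp (lam * t)))"
      proof (cases "0 \<le> s \<and> s \<le> t \<and> 0 < r \<and> r \<le> lam * s")
        case True
        then have ls: "lam * s \<le> lam * t" "0 \<le> lam * s" using lam by auto
        then have "r \<le> lam * t" using True by linarith
        moreover have "exp (- lam * s) * exp r \<le> exp (lam * t)"
          using ls True by (simp add: exp_add[symmetric])
        ultimately show ?thesis using True lam
          by (simp add: z f_def mult.assoc)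
      next
        case False
        then show ?thesis by (auto simp: z f_def indicator_def)
      qed
    qed
  qed
  have fst: "(\<integral>r. f s r \<partial>\<mu>) = indicator {0..t} s * (lam * exp (- lam * s) * J 0 (lam * s))" for s
  proof -
    have "f s r = (indicator {0..t} s * (lam * exp (- lam * s))) * (indicator {0<..lam * s} r *\<^sub>R exp r)" for r
      by (simp add: f_def)
    then have "(\<integral>r. f s r \<partial>\<mu>) = (indicator {0..t} s * (lam * exp (- lam * s))) * J 0 (lam * s)"
      by (simp only: integral_mult_right_zero stieltjes_integral_def set_lebesgue_integral_def)
    then show ?thesis by (simp only: mult.assoc)
  qed
  show "integrable lborel (\<lambda>s. indicator {0..t} s * (lam * exp (- lam * s) * J 0 (lam * s)))"
    using integrable_fst'[OF fi] by (simp add: fst)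
  have snd: "(\<integral>s. f s r \<partial>lborel) = indicator {0<..lam * t} r *\<^sub>R (1 - exp (- lam * t) * exp r)" for r
  proof (cases "0 < r \<and> r \<le> lam * t")
    case True
    then have rt: "r / lam \<le> t" using lam by (simp add: field_simps)
    have "f s r = exp r * (lam * exp (- lam * s) * indicator {r / lam..t} s)" for s
    proof -
      have "0 \<le> s" if "r \<le> lam * s"
      proof -
        have "0 < lam * s" using that True by linarith
        then show ?thesis using lam by (simp add: zero_less_mult_iff)
      qed
      moreover have "r \<le> lam * s \<longleftrightarrow> r / lam \<le> s" using lam by (simp add: pos_divide_le_eq mult.commute)
      ultimately show ?thesis using True by (auto simp: f_def indicator_def)
    qed
    then have "(\<integral>s. f s r \<partial>lborel) = exp r * (\<integral>s. lam * exp (- lam * s) * indicator {r / lam..t} s \<partial>lborel)"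
      by simp
    also have "(\<integral>s. lam * exp (- lam * s) * indicator {r / lam..t} s \<partial>lborel) = - exp (- lam * t) - - exp (- lam * (r / lam))"
      by (rule integral_FTC_Icc_real[OF rt]) (auto intro!: derivative_eq_intros)
    finally show ?thesis using True lam by (simp add: algebra_simps exp_add[symmetric] exp_minus)
  next
    case False
    then have "f s r = 0" for s
    proof -
      have "\<not> (0 < r \<and> r \<le> lam * s)" if "s \<le> t"
        using mult_left_mono[OF that less_imp_le[OF lam]] False by linarith
      then show ?thesis by (auto simp: f_def indicator_def)
    qed
    then show ?thesis using False by simp
  qed
  have "(\<integral>s. indicator {0..t} s * (lam * exp (- lam * s) * J 0 (lam * s)) \<partial>lborel) = (\<integral>s. (\<integral>r. f s r \<partial>\<mu>) \<partial>lborel)"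
    by (simp add: fst)
  also have "\<dots> = (\<integral>r. (\<integral>s. f s r \<partial>lborel) \<partial>\<mu>)" by (rule Fubini_integral[OF fi, symmetric])
  also have "\<dots> = (LINT r:{0<..lam * t}|\<mu>. 1 - exp (- lam * t) * exp r)"
    by (simp add: snd set_lebesgue_integral_def)
  also have "\<dots> = (LINT r:{0<..lam * t}|\<mu>. 1) - (LINT r:{0<..lam * t}|\<mu>. exp (- lam * t) * exp r)"
    by (intro set_integral_diff integrable_const_path set_integrable_mult_right integrable_exp_path lt order_refl)
  also have "\<dots> = g (lam * t) - g 0 - exp (- lam * t) * J 0 (lam * t)"
    using integrable_const_path(2)[OF order_refl lt, of 1] by (simp add: stieltjes_integral_def)
  finally show "(\<integral>s. indicator {0..t} s * (lam * exp (- lam * s) * J 0 (lam * s)) \<partial>lborel) =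
      g (lam * t) - g 0 - exp (- lam * t) * J 0 (lam * t)" .
qed

end

lemma OU_eq:
  assumes "lam \<noteq> 0"
  shows "OU lam G v0 t \<omega> = exp (- lam * t) * (v0 \<omega> + stieltjes_integral (\<lambda>y. G y \<omega>) 0 (lam * t) exp)"
  using assms by (simp add: OU_def scaled_integral_def algebra_simps)

lemma integrated_OU_eq:
  assumes lam: "0 < lam" and t: "0 \<le> t" and path: "increasing_path (\<lambda>y. G y \<omega>)"
  shows "lam * integrated_OU lam G v0 t \<omega> = (1 - exp (- lam * t)) * v0 \<omega> + (G (lam * t) \<omega> - G 0 \<omega>
    - exp (- lam * t) * stieltjes_integral (\<lambda>y. G y \<omega>) 0 (lam * t) exp)"
proof -
  interpret increasing_path "\<lambda>y. G y \<omega>" by fact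
  have v: "has_bochner_integral lborel (\<lambda>s. v0 \<omega> * (lam * exp (- lam * s) * indicator {0..t} s)) (v0 \<omega> * (- exp (- lam * t) - - exp (- lam * 0)))"
    by (intro has_bochner_integral_mult_right has_bochner_integral_FTC_Icc_real t) (auto intro!: derivative_eq_intros)
  have "lam * integrated_OU lam G v0 t \<omega> = (\<integral>s. lam * (indicator {0..t} s * OU lam G v0 s \<omega>) \<partial>lborel)"
    by (simp add: integrated_OU_def set_lebesgue_integral_def)
  also have "\<dots> = (\<integral>s. v0 \<omega> * (lam * exp (- lam * s) * indicator {0..t} s) + indicator {0..t} s * (lam * exp (- lam * s) * J 0 (lam * s)) \<partial>lborel)"
    using lam by (intro Bochner_Integration.integral_cong refl) (simp add: OU_eq algebra_simps)
  also have "\<dots> = v0 \<omega> * (- exp (- lam * t) - - exp (- lam * 0)) + (G (lam * t) \<omega> - G 0 \<omega> - exp (- lam * t) * J 0 (lam * t))"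
    using v discounted_integral_fubini[OF lam t]
    by (subst Bochner_Integration.integral_add) (auto simp: has_bochner_integral_iff)
  finally show ?thesis by (simp add: algebra_simps)
qed

section \<open>The Gamma subordinator in blocks\<close>

text \<open>The integral over the block \<open>(s, s + a]\<close> of the factor by which mass arriving at time \<open>r\<close> has decayed
  at the end of the block.\<close>

definition discounted_increment :: "(real \<Rightarrow> real) \<Rightarrow> real \<Rightarrow> real \<Rightarrow> real" where
  "discounted_increment g s a = exp (- (s + a)) * stieltjes_integral g s (s + a) exp"

definition riemann_sum :: "real \<Rightarrow> real \<Rightarrow> nat \<Rightarrow> (real \<Rightarrow> real) \<Rightarrow> real" where
  "riemann_sum s a m g = (\<Sum>k<m. right_end a m k * (g (s + a * real (Suc k) / real m) - g (s + a * real k / real m)))"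

lemma (in increasing_path) riemann_sum_tendsto:
  assumes "0 \<le> s" "0 \<le> a"
  shows "(\<lambda>m. riemann_sum s a (Suc m) g) \<longlonglongrightarrow> discounted_increment g s a"
proof -
  let ?T = "g (s + a) - g s"
  have l: "(\<lambda>m. (1 - exp (- a / real (Suc m))) * ?T) \<longlonglongrightarrow> (1 - exp 0) * ?T"
    by (intro tendsto_intros) (rule LIMSEQ_Suc[OF lim_const_over_n])
  have b: "\<bar>discounted_increment g s a - riemann_sum s a (Suc m) g\<bar> \<le> (1 - exp (- a / real (Suc m))) * ?T" for m
    using riemann_sum_bound(2)[OF assms zero_less_Suc, of m]
    unfolding discounted_increment_def riemann_sum_def right_end_def .
  have "(\<lambda>m. riemann_sum s a (Suc m) g - discounted_increment g s a) \<longlonglongrightarrow> 0"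
    by (rule Lim_null_comparison[OF always_eventually l[simplified]])
      (use b in \<open>auto simp: abs_minus_commute\<close>)
  then show ?thesis by (simp add: LIM_zero_iff)
qed

lemma subordinator_path: "subordinator \<Omega> G \<Longrightarrow> \<omega> \<in> space \<Omega> \<Longrightarrow> increasing_path (\<lambda>y. G y \<omega>)"
  by (simp add: subordinator_def increasing_path_def)

lemma subordinator_measurable: "subordinator \<Omega> G \<Longrightarrow> 0 \<le> t \<Longrightarrow> G t \<in> borel_measurable \<Omega>"
  by (simp add: subordinator_def)

lemma subordinator_indep:
  "subordinator \<Omega> G \<Longrightarrow> 0 \<le> t 0 \<Longrightarrow> incseq t \<Longrightarrow>
     prob_space.indep_vars \<Omega> (\<lambda>_. borel) (\<lambda>j \<omega>. G (t (Suc j)) \<omega> - G (t j) \<omega>) {..<k}"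
  by (simp add: subordinator_def)

lemma measurable_discounted_increment:
  assumes sub: "subordinator \<Omega> G" and sa: "0 \<le> s" "0 \<le> a"
  shows "(\<lambda>\<omega>. discounted_increment (\<lambda>y. G y \<omega>) s a) \<in> borel_measurable \<Omega>"
proof (rule borel_measurable_LIMSEQ_real)
  show "(\<lambda>m. riemann_sum s a (Suc m) (\<lambda>y. G y \<omega>)) \<longlonglongrightarrow> discounted_increment (\<lambda>y. G y \<omega>) s a" if "\<omega> \<in> space \<Omega>" for \<omega>
    using increasing_path.riemann_sum_tendsto[OF subordinator_path[OF sub that] sa] .
  show "(\<lambda>\<omega>. riemann_sum s a (Suc m) (\<lambda>y. G y \<omega>)) \<in> borel_measurable \<Omega>" for m
    unfolding riemann_sum_def using sa
    by (intro borel_measurable_sum borel_measurable_times borel_measurable_const borel_measurable_diff subordinator_measurable[OF sub]) auto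
qed

text \<open>The map \<open>r \<mapsto> exp (r - (s + a))\<close> takes the \<open>m\<close> equal pieces of the block to the cells, so the
  increments over the pieces are the masses in the cells.\<close>

lemma gamma_subordinator_block_pair:
  assumes P: "prob_space \<Omega>" and gs: "gamma_subordinator \<Omega> \<theta> G" and s: "0 \<le> s" and a: "0 < a"
  shows "gamma_mean_pair \<Omega> (\<theta> * a) a (\<lambda>\<omega>. discounted_increment (\<lambda>y. G y \<omega>) s a) (\<lambda>\<omega>. G (s + a) \<omega> - G s \<omega>)"
  unfolding gamma_mean_pair_def
proof (intro conjI allI impI)
  interpret prob_space \<Omega> by fact
  have sub: "subordinator \<Omega> G" using gs by (simp add: gamma_subordinator_def)
  note Gm = subordinator_measurable[OF sub]
  show "(\<lambda>\<omega>. discounted_increment (\<lambda>y. G y \<omega>) s a) \<in> borel_measurable \<Omega>"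
    using measurable_discounted_increment[OF sub s] a by simp
  show "(\<lambda>\<omega>. G (s + a) \<omega> - G s \<omega>) \<in> borel_measurable \<Omega>"
    using s a by (intro borel_measurable_diff Gm) auto
  fix m :: nat assume m: "0 < m"
  define p where "p k = s + a * real k / real m" for k
  have inc: "incseq p"
    unfolding p_def using a by (intro incseq_SucI add_left_mono divide_right_mono mult_left_mono) auto
  have p0: "0 \<le> p 0" using s by (simp add: p_def)
  have ppos: "0 \<le> p k" for k using p0 incseqD[OF inc, of 0 k] by simp
  have pS: "p (Suc k) = p k + a / real m" for k using m by (simp add: p_def field_simps)
  let ?D = "\<lambda>k \<omega>. G (p (Suc k)) \<omega> - G (p k) \<omega>"
  have D_nonneg: "0 \<le> ?D k \<omega>" if "\<omega> \<in> space \<Omega>" for k \<omega>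
    using increasing_path.mono[OF subordinator_path[OF sub that]] ppos incseqD[OF inc, of k "Suc k"]
    by (auto simp: mono_on_def)
  have D_lap: "expectation (\<lambda>\<omega>. exp (- u * ?D k \<omega>)) = (1 + u) powr (- (\<theta> * a) / real m)" if u: "0 \<le> u" for k u
  proof -
    have am: "0 \<le> a / real m" using a by simp
    have Dm: "?D k \<in> borel_measurable \<Omega>" by (intro borel_measurable_diff Gm ppos)
    have f: "(\<lambda>y. exp (- u * y)) \<in> borel_measurable borel" by measurable
    have "distr \<Omega> borel (?D k) = distr \<Omega> borel (G (a / real m))"
      using sub ppos[of k] am unfolding pS subordinator_def by blast
    then have "(\<integral>y. exp (- u * y) \<partial>distr \<Omega> borel (?D k)) = (\<integral>y. exp (- u * y) \<partial>distr \<Omega> borel (G (a / real m)))" by simp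
    then have "expectation (\<lambda>\<omega>. exp (- u * ?D k \<omega>)) = expectation (\<lambda>\<omega>. exp (- u * G (a / real m) \<omega>))"
      unfolding integral_distr[OF Dm f] integral_distr[OF Gm[OF am] f] .
    also have "\<dots> = (1 + u) powr (- \<theta> * (a / real m))"
      using gs am u by (simp add: gamma_subordinator_def)
    finally show ?thesis by simp
  qed
  have bound: "G (s + a) \<omega> - G s \<omega> = (\<Sum>k<m. ?D k \<omega>) \<and>
      \<bar>discounted_increment (\<lambda>y. G y \<omega>) s a - (\<Sum>k<m. right_end a m k * ?D k \<omega>)\<bar> \<le> (1 - exp (- a / real m)) * (G (s + a) \<omega> - G s \<omega>)"
    if "\<omega> \<in> space \<Omega>" for \<omega>
    using increasing_path.riemann_sum_bound[OF subordinator_path[OF sub that] s less_imp_le[OF a] m]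
    unfolding p_def discounted_increment_def right_end_def by blast
  show "\<exists>D. gamma_cells \<Omega> (\<theta> * a) a (\<lambda>\<omega>. discounted_increment (\<lambda>y. G y \<omega>) s a)
      (\<lambda>\<omega>. G (s + a) \<omega> - G s \<omega>) m D"
    unfolding gamma_cells_def
    by (intro exI[of _ ?D] conjI allI impI AE_I2 subordinator_indep[OF sub p0 inc] D_nonneg D_lap bound)
qed

text \<open>The Riemann sums with \<open>m\<close> pieces per block are functions of disjoint groups of the increments over a
  grid of mesh \<open>a / m\<close>.\<close>

lemma subordinator_blocks_indep:
  fixes n :: nat
  assumes P: "prob_space \<Omega>" and sub: "subordinator \<Omega> G" and a: "0 \<le> a"
  shows "prob_space.indep_vars \<Omega> (\<lambda>_. borel)
    (\<lambda>i \<omega>. (discounted_increment (\<lambda>y. G y \<omega>) (real (i - 1) * a) a, G (real (i - 1) * a + a) \<omega> - G (real (i - 1) * a) \<omega>)) {1..n}"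
proof -
  interpret prob_space \<Omega> by fact
  define Y where "Y m i \<omega> = (riemann_sum (real (i - 1) * a) a (Suc m) (\<lambda>y. G y \<omega>), G (real (i - 1) * a + a) \<omega> - G (real (i - 1) * a) \<omega>)" for m i \<omega>
  show ?thesis
  proof (rule indep_vars_tendsto)
    show "(\<lambda>m. Y m i \<omega>) \<longlonglongrightarrow> (discounted_increment (\<lambda>y. G y \<omega>) (real (i - 1) * a) a, G (real (i - 1) * a + a) \<omega> - G (real (i - 1) * a) \<omega>)"
      if "\<omega> \<in> space \<Omega>" for i \<omega>
      unfolding Y_def using a
      by (intro tendsto_Pair tendsto_const increasing_path.riemann_sum_tendsto[OF subordinator_path[OF sub that]]) auto
    fix m :: nat
    let ?m = "Suc m"
    \<comment> \<open>piece \<open>k\<close> of block \<open>i\<close> is the increment with index \<open>(i - 1) * ?m + k\<close> of this grid\<close>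
    define t where "t j = a * real j / real ?m" for j
    have inc: "incseq t"
      unfolding t_def using a by (intro incseq_SucI divide_right_mono mult_left_mono) auto
    define X where "X j \<omega> = G (t (Suc j)) \<omega> - G (t j) \<omega>" for j \<omega>
    define K where "K i = {(i - 1) * ?m..<i * ?m}" for i :: nat
    have indX: "indep_vars (\<lambda>_. borel) X {..<n * ?m}"
      unfolding X_def by (intro subordinator_indep[OF sub _ inc]) (simp add: t_def)
    have K: "K i \<subseteq> {..<n * ?m}" if "i \<in> {1..n}" for i
      using that mult_right_mono[of i n ?m] by (auto simp: K_def intro: order_less_le_trans)
    have disj: "disjoint_family_on K {1..n}"
    proof -
      have "K i \<inter> K j = {}" if "i < j" for i j
      proof -
        have "i * ?m \<le> (j - 1) * ?m" using that by (intro mult_right_mono) auto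
        then show ?thesis unfolding K_def by auto
      qed
      then show ?thesis unfolding disjoint_family_on_def by (metis Int_commute linorder_neqE_nat)
    qed
    have in_K: "(i - 1) * ?m + k \<in> K i" if "i \<in> {1..n}" "k < ?m" for i k
    proof -
      have "(i - 1) * ?m + ?m = i * ?m" using that by (cases i) auto
      then show ?thesis using that unfolding K_def by auto
    qed
    have blocks: "indep_vars (\<lambda>i. PiM (K i) (\<lambda>_. borel)) (\<lambda>i \<omega>. restrict (\<lambda>j. X j \<omega>) (K i)) {1..n}"
      by (rule indep_vars_restrict[OF indX K disj])
    define f where "f i x = ((\<Sum>k<?m. right_end a ?m k * x ((i - 1) * ?m + k)), (\<Sum>k<?m. x ((i - 1) * ?m + k)))"
      for i and x :: "nat \<Rightarrow> real"
    have fm: "f i \<in> borel_measurable (PiM (K i) (\<lambda>_. borel))" if i: "i \<in> {1..n}" for i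
    proof -
      have c: "(\<lambda>x. x ((i - 1) * ?m + k)) \<in> borel_measurable (PiM (K i) (\<lambda>_. borel :: real measure))" if "k < ?m" for k
        using in_K[OF i that] by (rule measurable_component_singleton)
      show ?thesis unfolding f_def borel_prod[symmetric]
        by (intro measurable_Pair borel_measurable_sum borel_measurable_times borel_measurable_const c) auto
    qed
    have eq: "f i (restrict (\<lambda>j. X j \<omega>) (K i)) = Y m i \<omega>" if i: "i \<in> {1..n}" for i \<omega>
    proof -
      have tj: "t ((i - 1) * ?m + k) = real (i - 1) * a + a * real k / real ?m"
        "t (Suc ((i - 1) * ?m + k)) = real (i - 1) * a + a * real (Suc k) / real ?m" for k
      proof -
        have "a * real ((i - 1) * ?m + y) / real ?m = real (i - 1) * a + a * real y / real ?m" for y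
          unfolding of_nat_add of_nat_mult by (simp add: field_simps del: of_nat_Suc)
        then show "t ((i - 1) * ?m + k) = real (i - 1) * a + a * real k / real ?m"
          "t (Suc ((i - 1) * ?m + k)) = real (i - 1) * a + a * real (Suc k) / real ?m"
          unfolding t_def add_Suc_right[symmetric] by blast+
      qed
      have x: "restrict (\<lambda>j. X j \<omega>) (K i) ((i - 1) * ?m + k) =
          G (real (i - 1) * a + a * real (Suc k) / real ?m) \<omega> - G (real (i - 1) * a + a * real k / real ?m) \<omega>" if "k < ?m" for k
        using in_K[OF i that] unfolding X_def tj by (simp only: restrict_apply' if_True tj)
      have "(\<Sum>k<?m. G (real (i - 1) * a + a * real (Suc k) / real ?m) \<omega> - G (real (i - 1) * a + a * real k / real ?m) \<omega>) =
         G (real (i - 1) * a + a) \<omega> - G (real (i - 1) * a) \<omega>"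
        using sum_lessThan_telescope[of "\<lambda>k. G (real (i - 1) * a + a * real k / real ?m) \<omega>" ?m] by (simp del: of_nat_Suc)
      moreover have "(\<Sum>k<?m. restrict (\<lambda>j. X j \<omega>) (K i) ((i - 1) * ?m + k)) =
        (\<Sum>k<?m. G (real (i - 1) * a + a * real (Suc k) / real ?m) \<omega> - G (real (i - 1) * a + a * real k / real ?m) \<omega>)"
        by (intro sum.cong refl x) simp
      moreover have "(\<Sum>k<?m. right_end a ?m k * restrict (\<lambda>j. X j \<omega>) (K i) ((i - 1) * ?m + k)) = riemann_sum (real (i - 1) * a) a ?m (\<lambda>y. G y \<omega>)"
        unfolding riemann_sum_def by (intro sum.cong refl arg_cong2[where f="(*)"] x) simp
      ultimately show ?thesis unfolding f_def Y_def by simp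
    qed
    have "indep_vars (\<lambda>_. borel) (\<lambda>i \<omega>. f i (restrict (\<lambda>j. X j \<omega>) (K i))) {1..n}"
      by (rule indep_vars_compose2[OF blocks fm])
    then show "indep_vars (\<lambda>_. borel) (Y m) {1..n}"
      by (rule indep_vars_cong[THEN iffD1, rotated -1]) (auto simp: eq)
  qed simp
qed

text \<open>On increasing paths this is the discounted increment.  Its form as a limit of Riemann sums makes it a
  measurable functional on the product space of all functions on \<open>[0, \<infinity>)\<close>, so that independence
  from the whole path passes to the block variables.\<close>

definition path_discounted :: "real \<Rightarrow> real \<Rightarrow> (real \<Rightarrow> real) \<Rightarrow> real" where
  "path_discounted s a w = lim (\<lambda>m. riemann_sum s a (Suc m) w)"

lemma measurable_path_discounted:
  assumes "0 \<le> s" "0 \<le> a"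
  shows "path_discounted s a \<in> borel_measurable (PiM {0..} (\<lambda>_. borel))"
  unfolding path_discounted_def
proof (rule borel_measurable_lim_metric)
  fix m
  have c: "(\<lambda>w. w t) \<in> borel_measurable (PiM {0..} (\<lambda>_. borel :: real measure))" if "0 \<le> t" for t :: real
    using that by (intro measurable_component_singleton) simp
  show "riemann_sum s a (Suc m) \<in> borel_measurable (PiM {0..} (\<lambda>_. borel))"
    unfolding riemann_sum_def using assms
    by (intro borel_measurable_sum borel_measurable_times borel_measurable_const borel_measurable_diff c) auto
qed

lemma path_discounted_eq:
  assumes path: "increasing_path g" and sa: "0 \<le> s" "0 \<le> a"
  shows "path_discounted s a (\<lambda>t\<in>{0..}. g t) = discounted_increment g s a"
proof -
  have "riemann_sum s a (Suc m) (\<lambda>t\<in>{0..}. g t) = riemann_sum s a (Suc m) g" for m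
    unfolding riemann_sum_def using sa by (intro sum.cong refl) (simp add: divide_nonneg_nonneg)
  then show ?thesis
    unfolding path_discounted_def using increasing_path.riemann_sum_tendsto[OF path sa] by (simp add: limI)
qed

section \<open>Gamma random measures and means of Dirichlet processes\<close>

definition cell :: "real \<Rightarrow> nat \<Rightarrow> nat \<Rightarrow> real set" where
  "cell a m k = {exp (a * real k / real m - a) <.. exp (a * real (Suc k) / real m - a)}"

text \<open>Each summand is the difference of the indicators of two half-lines, so the sum telescopes.\<close>

lemma sum_indicator_cells:
  assumes "0 \<le> a" "0 < m"
  shows "(\<Sum>k<m. indicator (cell a m k) x :: real) = indicator {exp (- a)<..1} x"
proof -
  define c where "c k = exp (a * real k / real m - a)" for k
  have cs: "c k \<le> c (Suc k)" for k
    unfolding c_def using assms by (auto intro!: divide_right_mono mult_left_mono)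
  have "(\<Sum>k<m. indicator (cell a m k) x :: real) = (\<Sum>k<m. indicator {..c (Suc k)} x - indicator {..c k} x)"
  proof (rule sum.cong[OF refl])
    fix k
    show "indicator (cell a m k) x = (indicator {..c (Suc k)} x - indicator {..c k} x :: real)"
      using cs[of k] unfolding cell_def c_def[symmetric] by (auto simp: indicator_def)
  qed
  also have "\<dots> = indicator {..c m} x - indicator {..c 0} x"
    using sum_lessThan_telescope[of "\<lambda>k. indicator {..c k} x :: real" m] .
  also have "\<dots> = indicator {..1} x - indicator {..exp (- a)} x" using assms by (simp add: c_def)
  also have "(indicator {..1} x - indicator {..exp (- a)} x :: real) = indicator {exp (- a)<..1} x"
    using assms by (auto simp: indicator_def) (meson exp_le_one_iff neg_le_0_iff_le order_trans)
  finally show ?thesis .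
qed

lemma disjoint_cells:
  assumes "0 \<le> a"
  shows "disjoint_family_on (cell a m) UNIV"
proof -
  have "cell a m i \<inter> cell a m j = {}" if "i < j" for i j
  proof -
    have "exp (a * real (Suc i) / real m - a) \<le> exp (a * real j / real m - a)"
      using that assms by (auto intro!: divide_right_mono mult_left_mono simp del: of_nat_Suc)
    then show ?thesis by (auto simp: cell_def)
  qed
  then show ?thesis unfolding disjoint_family_on_def by (metis Int_commute linorder_neqE_nat)
qed

text \<open>A primitive of the density \<open>1 / (a * u)\<close> is \<open>ln u / a\<close>, and the cells are equally long on the
  logarithmic scale.\<close>

lemma F_dist_cell:
  assumes a: "0 < a" and m: "0 < m" and k: "k < m"
  shows "measure (F_dist a) (cell a m k) = 1 / real m"
proof -
  let ?b = "exp (a * real k / real m - a)" and ?c = "exp (a * real (Suc k) / real m - a)"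
  have bc: "?b \<le> ?c" using a by (auto intro!: divide_right_mono mult_left_mono)
  have b: "exp (- a) \<le> ?b" using a by (auto intro!: divide_nonneg_nonneg)
  have "a * real (Suc k) / real m \<le> a * real m / real m"
    using a k by (intro divide_right_mono mult_left_mono) auto
  then have c: "?c \<le> 1" using m by simp
  have dens: "(\<lambda>u. ennreal (indicator {exp (- a)..1} u / (a * u))) \<in> borel_measurable lborel" by measurable
  have "emeasure (F_dist a) (cell a m k) = (\<integral>\<^sup>+u. ennreal (indicator {exp (- a)..1} u / (a * u)) * indicator (cell a m k) u \<partial>lborel)"
    unfolding F_dist_def by (rule emeasure_density[OF dens]) (simp add: cell_def)
  also have "\<dots> = (\<integral>\<^sup>+u. ennreal (1 / (a * u)) * indicator {?b..?c} u \<partial>lborel)"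
  proof (rule nn_integral_cong_AE)
    show "AE u in lborel. ennreal (indicator {exp (- a)..1} u / (a * u)) * indicator (cell a m k) u = ennreal (1 / (a * u)) * indicator {?b..?c} u"
      using AE_lborel_singleton[of ?b]
    proof eventually_elim
      case (elim u)
      show ?case
      proof (cases "?b < u \<and> u \<le> ?c")
        case True
        then have "exp (- a) \<le> u" "u \<le> 1" using b c by linarith+
        then show ?thesis using True by (simp add: cell_def)
      next
        case False
        then show ?thesis using elim by (auto simp: cell_def indicator_def)
      qed
    qed
  qed
  also have "\<dots> = ennreal (ln ?c / a - ln ?b / a)"
  proof (rule nn_integral_FTC_Icc[OF _ _ _ bc])
    fix u assume "u \<in> {?b..?c}"
    then have "?b \<le> u" by simp
    then have u: "0 < u" using exp_gt_zero[of "a * real k / real m - a"] by linarith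
    then show "((\<lambda>u. ln u / a) has_real_derivative 1 / (a * u)) (at u)"
      using a by (auto intro!: derivative_eq_intros simp: field_simps)
    show "0 \<le> 1 / (a * u)" using u a by simp
  qed measurable
  also have "ln ?c / a - ln ?b / a = 1 / real m" using a m by (simp add: field_simps)
  finally show ?thesis by (simp add: measure_def)
qed

lemma F_dist_null:
  assumes a: "0 < a"
  shows "measure (F_dist a) (- {exp (- a)<..1}) = 0"
proof -
  have dens: "(\<lambda>u. ennreal (indicator {exp (- a)..1} u / (a * u))) \<in> borel_measurable lborel" by measurable
  have "emeasure (F_dist a) (- {exp (- a)<..1}) = (\<integral>\<^sup>+u. ennreal (indicator {exp (- a)..1} u / (a * u)) * indicator (- {exp (- a)<..1}) u \<partial>lborel)"
    unfolding F_dist_def by (rule emeasure_density[OF dens]) simp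
  also have "\<dots> = (\<integral>\<^sup>+u. 0 \<partial>(lborel :: real measure))"
    using AE_lborel_singleton[of "exp (- a)"]
    by (intro nn_integral_cong_AE, eventually_elim) (auto simp: indicator_def)
  finally show ?thesis by (simp add: measure_def)
qed

text \<open>The normalised measures are subprobability measures at every point of the sample space, also where
  \<open>\<Gamma>\<close> vanishes, so that they form a measurable map into the space of such measures, on which
  integration of a fixed function is measurable.\<close>

lemma random_mean_measurable:
  assumes grm: "gamma_random_measure \<Omega> \<nu> \<Gamma>"
    and P: "\<And>\<omega>. \<omega> \<in> space \<Omega> \<Longrightarrow> P \<omega> = scale_measure (1 / emeasure (\<Gamma> \<omega>) UNIV) (\<Gamma> \<omega>)"
  shows "random_mean P \<in> borel_measurable \<Omega>"
proof -
  have sets: "sets (\<Gamma> \<omega>) = sets borel" and fin: "finite_measure (\<Gamma> \<omega>)" if "\<omega> \<in> space \<Omega>" for \<omega>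
    using grm that by (auto simp: gamma_random_measure_def)
  have sp: "space (\<Gamma> \<omega>) = UNIV" if "\<omega> \<in> space \<Omega>" for \<omega>
    using sets_eq_imp_space_eq[OF sets[OF that]] by simp
  have meas: "(\<lambda>\<omega>. emeasure (\<Gamma> \<omega>) A) \<in> borel_measurable \<Omega>" if "A \<in> sets borel" for A
  proof -
    have "(\<lambda>\<omega>. ennreal (measure (\<Gamma> \<omega>) A)) \<in> borel_measurable \<Omega>"
      using grm that by (auto simp: gamma_random_measure_def)
    then show ?thesis
      using fin by (subst measurable_cong[of _ _ "\<lambda>\<omega>. ennreal (measure (\<Gamma> \<omega>) A)"]) (auto simp: finite_measure.emeasure_eq_measure)
  qed
  have "P \<in> measurable \<Omega> (subprob_algebra borel)"
  proof (rule measurable_subprob_algebra)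
    fix \<omega> assume w: "\<omega> \<in> space \<Omega>"
    show "sets (P \<omega>) = sets borel" using sets[OF w] by (simp add: P[OF w])
    show "subprob_space (P \<omega>)"
    proof (rule subprob_spaceI)
      have "emeasure (\<Gamma> \<omega>) UNIV \<noteq> \<infinity>" using finite_measure.emeasure_finite[OF fin[OF w], of UNIV] by simp
      then have "1 / emeasure (\<Gamma> \<omega>) UNIV * emeasure (\<Gamma> \<omega>) UNIV \<le> 1"
        by (cases "emeasure (\<Gamma> \<omega>) UNIV = 0") (auto simp: ennreal_divide_times less_top divide_eq_1_ennreal)
      then show "emeasure (P \<omega>) (space (P \<omega>)) \<le> 1"
        by (simp add: P[OF w] space_scale_measure sp[OF w])
      show "space (P \<omega>) \<noteq> {}" by (simp add: P[OF w] space_scale_measure sp[OF w])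
    qed
  next
    fix A :: "real set" assume A: "A \<in> sets borel"
    have "(\<lambda>\<omega>. 1 / emeasure (\<Gamma> \<omega>) UNIV * emeasure (\<Gamma> \<omega>) A) \<in> borel_measurable \<Omega>"
      using meas[OF A] meas[of UNIV] by measurable
    then show "(\<lambda>\<omega>. emeasure (P \<omega>) A) \<in> borel_measurable \<Omega>"
      by (subst measurable_cong[of _ _ "\<lambda>\<omega>. 1 / emeasure (\<Gamma> \<omega>) UNIV * emeasure (\<Gamma> \<omega>) A"]) (auto simp: P)
  qed
  then have "(\<lambda>\<omega>. integral\<^sup>L (P \<omega>) (\<lambda>x. x)) \<in> borel_measurable \<Omega>"
    by (rule measurable_compose) (rule integral_measurable_subprob_algebra, simp)
  then show ?thesis unfolding random_mean_def[abs_def] .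
qed

text \<open>The identity differs on the support from the step function with the right ends as values by at
  most the width of the cells, which is bounded by \<open>1 - exp (- a / m)\<close>.\<close>

lemma random_mean_bound:
  fixes Q :: "real measure"
  assumes Q: "finite_measure Q" "sets Q = sets borel" and supp: "AE x in Q. x \<in> {exp (- a)<..1}"
    and a: "0 \<le> a" and m: "0 < m"
  shows "measure Q UNIV = (\<Sum>k<m. measure Q (cell a m k))"
    and "\<bar>(\<integral>x. x \<partial>Q) - (\<Sum>k<m. right_end a m k * measure Q (cell a m k))\<bar> \<le> (1 - exp (- a / real m)) * measure Q UNIV"
proof -
  interpret finite_measure Q by fact
  note [measurable_cong] = Q(2)
  have sp: "space Q = UNIV" using sets_eq_imp_space_eq[OF Q(2)] by simp
  have cell[measurable]: "cell a m k \<in> sets Q" for k by (simp add: cell_def Q(2))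
  have ci: "integrable Q (indicator (cell a m k) :: real \<Rightarrow> real)" for k
    by (rule integrable_real_indicator[OF cell]) (simp add: emeasure_eq_measure)
  let ?h = "\<lambda>x. \<Sum>k<m. right_end a m k * indicator (cell a m k) x"
  have hi: "integrable Q ?h" by (intro Bochner_Integration.integrable_sum integrable_mult_right ci)
  have h: "(\<integral>x. ?h x \<partial>Q) = (\<Sum>k<m. right_end a m k * measure Q (cell a m k))"
    by (subst Bochner_Integration.integral_sum) (auto simp: sp ci)
  have one: "AE x in Q. (\<Sum>k<m. indicator (cell a m k) x :: real) = 1"
    using supp by eventually_elim (simp add: sum_indicator_cells[OF a m])
  have "(\<integral>x. 1 \<partial>Q) = (\<integral>x. (\<Sum>k<m. indicator (cell a m k) x :: real) \<partial>Q)"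
    using one by (intro integral_cong_AE) (auto elim: eventually_mono)
  also have "\<dots> = (\<Sum>k<m. measure Q (cell a m k))"
    by (subst Bochner_Integration.integral_sum) (auto simp: sp ci)
  finally show "measure Q UNIV = (\<Sum>k<m. measure Q (cell a m k))" by (simp add: sp)
  have xi: "integrable Q (\<lambda>x. x)"
  proof (rule integrable_const_bound[where B=1])
    show "AE x in Q. norm x \<le> 1"
      using supp by eventually_elim (use exp_gt_zero[of "- a"] in \<open>auto simp del: exp_gt_zero intro: order_trans less_imp_le\<close>)
  qed measurable
  let ?e = "1 - exp (- a / real m)"
  have e0: "0 \<le> ?e" using a m by simp
  have close: "\<bar>x - right_end a m k\<bar> \<le> ?e" if "x \<in> cell a m k" "k < m" for x k
  proof -
    have "a * real (Suc k) / real m \<le> a * real m / real m"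
      using a that by (intro divide_right_mono mult_left_mono) auto
    then have w1: "right_end a m k \<le> 1" using m by (simp add: right_end_def)
    have xu: "x \<le> right_end a m k" using that by (simp add: cell_def right_end_def)
    have "a * real k / real m - a = (a * real (Suc k) / real m - a) + - a / real m"
      using m by (simp add: field_simps)
    then have "exp (a * real k / real m - a) = right_end a m k * exp (- a / real m)"
      unfolding right_end_def by (simp only: exp_add)
    then have xl: "right_end a m k * exp (- a / real m) < x" using that by (simp add: cell_def)
    have "right_end a m k - x \<le> right_end a m k * ?e" using xl by (simp add: algebra_simps)
    also have "\<dots> \<le> 1 * ?e" using w1 e0 by (rule mult_right_mono)
    finally show ?thesis using xu by simp
  qed
  have "\<bar>(\<integral>x. x \<partial>Q) - (\<integral>x. ?h x \<partial>Q)\<bar> = \<bar>\<integral>x. x - ?h x \<partial>Q\<bar>"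
    using xi hi by (simp only: Bochner_Integration.integral_diff)
  also have "\<dots> \<le> (\<integral>x. \<bar>x - ?h x\<bar> \<partial>Q)" by (rule integral_abs_bound)
  also have "\<dots> \<le> (\<integral>x. ?e \<partial>Q)"
  proof (rule integral_mono_AE)
    show "integrable Q (\<lambda>x. \<bar>x - ?h x\<bar>)" using xi hi by (intro integrable_abs Bochner_Integration.integrable_diff)
    show "AE x in Q. \<bar>x - ?h x\<bar> \<le> ?e"
      using one
    proof eventually_elim
      case (elim x)
      have "x - ?h x = (\<Sum>k<m. (x - right_end a m k) * indicator (cell a m k) x)"
        using elim by (simp add: left_diff_distrib sum_subtractf sum_distrib_left[symmetric])
      also have "\<bar>\<dots>\<bar> \<le> (\<Sum>k<m. \<bar>(x - right_end a m k) * indicator (cell a m k) x\<bar>)" by (rule sum_abs)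
      also have "\<dots> \<le> (\<Sum>k<m. ?e * indicator (cell a m k) x)"
        using close by (intro sum_mono) (auto simp: indicator_def)
      also have "\<dots> = ?e" using elim by (simp add: sum_distrib_left[symmetric])
      finally show ?case .
    qed
  qed simp
  finally show "\<bar>(\<integral>x. x \<partial>Q) - (\<Sum>k<m. right_end a m k * measure Q (cell a m k))\<bar> \<le> ?e * measure Q UNIV"
    unfolding h by (simp add: sp mult.commute)
qed

lemma random_mean_scale:
  assumes Q: "finite_measure Q" "sets Q = sets borel"
  shows "measure Q UNIV * (\<integral>x. x \<partial>scale_measure (1 / emeasure Q UNIV) Q) = (\<integral>x. x \<partial>Q)"
    and "measure Q UNIV = 0 \<Longrightarrow> (\<integral>x. x \<partial>scale_measure (1 / emeasure Q UNIV) Q) = 0"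
proof -
  interpret finite_measure Q by fact
  note [measurable_cong] = Q(2)
  have sp: "space Q = UNIV" using sets_eq_imp_space_eq[OF Q(2)] by simp
  let ?S = "scale_measure (1 / emeasure Q UNIV) Q"
  have null: "(\<integral>x. f x \<partial>N) = 0" if "emeasure N UNIV = 0" "sets N = sets borel" for N :: "real measure" and f :: "real \<Rightarrow> real"
  proof -
    have "AE x in N. f x = 0"
      using that sets_eq_imp_space_eq[OF that(2)] by (intro AE_I[of _ _ UNIV]) auto
    then show ?thesis by (rule integral_eq_zero_AE)
  qed
  show z: "(\<integral>x. x \<partial>?S) = 0" if "measure Q UNIV = 0"
    using that Q(2) by (intro null) (auto simp: emeasure_eq_measure)
  show "measure Q UNIV * (\<integral>x. x \<partial>?S) = (\<integral>x. x \<partial>Q)"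
  proof (cases "measure Q UNIV = 0")
    case True
    then show ?thesis using null[of Q "\<lambda>x. x"] Q(2) by (simp add: emeasure_eq_measure)
  next
    case False
    then have t: "0 < measure Q UNIV" using measure_nonneg[of Q UNIV] by linarith
    have "1 / emeasure Q UNIV = ennreal (1 / measure Q UNIV)"
      using t by (simp add: emeasure_eq_measure divide_ennreal ennreal_1[symmetric] del: ennreal_1)
    then have "?S = density Q (\<lambda>_. ennreal (1 / measure Q UNIV))"
      by (intro measure_eqI) (auto simp: emeasure_density_const)
    then have "(\<integral>x. x \<partial>?S) = 1 / measure Q UNIV * (\<integral>x. x \<partial>Q)"
      using t by (simp add: integral_density)
    then show ?thesis using t by simp
  qed
qed

text \<open>The complement of \<open>(exp (- a), 1]\<close> is a null set of the shape measure, so its mass is almost surely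
  \<open>0\<close>; this is where the degenerate Gamma law enters.\<close>

lemma gamma_random_measure_pair:
  assumes P': "prob_space \<Omega>" and grm: "gamma_random_measure \<Omega> (scale_measure (ennreal \<kappa>) (F_dist a)) \<Gamma>"
    and P: "\<And>\<omega>. \<omega> \<in> space \<Omega> \<Longrightarrow> P \<omega> = scale_measure (1 / emeasure (\<Gamma> \<omega>) UNIV) (\<Gamma> \<omega>)"
    and k: "0 < \<kappa>" and a: "0 < a"
  shows "gamma_mean_pair \<Omega> \<kappa> a (\<lambda>\<omega>. measure (\<Gamma> \<omega>) UNIV * random_mean P \<omega>) (\<lambda>\<omega>. measure (\<Gamma> \<omega>) UNIV)"
  unfolding gamma_mean_pair_def
proof (intro conjI allI impI)
  interpret prob_space \<Omega> by fact
  let ?\<nu> = "scale_measure (ennreal \<kappa>) (F_dist a)"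
  have sets: "sets (\<Gamma> \<omega>) = sets borel" and fin: "finite_measure (\<Gamma> \<omega>)" if "\<omega> \<in> space \<Omega>" for \<omega>
    using grm that by (auto simp: gamma_random_measure_def)
  have meas: "(\<lambda>\<omega>. measure (\<Gamma> \<omega>) A) \<in> borel_measurable \<Omega>"
    and law: "distr \<Omega> borel (\<lambda>\<omega>. measure (\<Gamma> \<omega>) A) = gamma_law (measure ?\<nu> A)" if "A \<in> sets borel" for A
    using grm that by (auto simp: gamma_random_measure_def)
  show "(\<lambda>\<omega>. measure (\<Gamma> \<omega>) UNIV) \<in> borel_measurable \<Omega>" by (rule meas) simp
  then show "(\<lambda>\<omega>. measure (\<Gamma> \<omega>) UNIV * random_mean P \<omega>) \<in> borel_measurable \<Omega>"
    using random_mean_measurable[OF grm P] by measurable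
  have supp: "AE \<omega> in \<Omega>. AE x in \<Gamma> \<omega>. x \<in> {exp (- a)<..1}"
  proof -
    let ?C = "- {exp (- a)<..1}"
    have "measure ?\<nu> ?C = 0" using F_dist_null[OF a] k by (simp add: measure_scale_measure)
    then have "distr \<Omega> borel (\<lambda>\<omega>. measure (\<Gamma> \<omega>) ?C) = return borel 0"
      using law[of ?C] by (simp add: gamma_law_def)
    moreover have "AE y in return borel (0::real). y = 0" by (subst AE_return) auto
    ultimately have "AE y in distr \<Omega> borel (\<lambda>\<omega>. measure (\<Gamma> \<omega>) ?C). y = 0" by (simp only:)
    then have "AE \<omega> in \<Omega>. measure (\<Gamma> \<omega>) ?C = 0"
      using meas[of ?C] by (subst (asm) AE_distr_iff) auto
    then show ?thesis
    proof (rule AE_mp[OF _ AE_I2[OF impI]])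
      fix \<omega> assume w: "\<omega> \<in> space \<Omega>" and z: "measure (\<Gamma> \<omega>) ?C = 0"
      then have "emeasure (\<Gamma> \<omega>) ?C = 0" using finite_measure.emeasure_eq_measure[OF fin[OF w]] by simp
      then show "AE x in \<Gamma> \<omega>. x \<in> {exp (- a)<..1}"
        using sets[OF w] by (intro AE_I[of _ _ ?C]) auto
    qed
  qed
  fix m :: nat assume m: "0 < m"
  let ?D = "\<lambda>k \<omega>. measure (\<Gamma> \<omega>) (cell a m k)"
  have cell: "cell a m j \<in> sets borel" for j by (simp add: cell_def)
  have ind: "indep_vars (\<lambda>_. borel) ?D {..<m}"
    using grm cell disjoint_family_on_mono[OF subset_UNIV disjoint_cells[of a m]] a
    unfolding gamma_random_measure_def by (auto simp: image_subset_iff)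
  have lap: "expectation (\<lambda>\<omega>. exp (- u * ?D j \<omega>)) = (1 + u) powr (- \<kappa> / real m)" if "j < m" "0 \<le> u" for j u
  proof -
    have nu: "measure ?\<nu> (cell a m j) = \<kappa> / real m"
      using F_dist_cell[OF a m that(1)] k by (simp add: measure_scale_measure)
    have "expectation (\<lambda>\<omega>. exp (- u * ?D j \<omega>)) = (\<integral>y. exp (- u * y) \<partial>distr \<Omega> borel (?D j))"
      using meas[OF cell] by (subst integral_distr) auto
    also have "\<dots> = (1 + u) powr (- (\<kappa> / real m))"
      unfolding law[OF cell] nu using k m that by (intro gamma_law_laplace_integral) auto
    finally show ?thesis by simp
  qed
  have bound: "AE \<omega> in \<Omega>. measure (\<Gamma> \<omega>) UNIV = (\<Sum>k<m. ?D k \<omega>) \<and>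
      \<bar>measure (\<Gamma> \<omega>) UNIV * random_mean P \<omega> - (\<Sum>k<m. right_end a m k * ?D k \<omega>)\<bar> \<le> (1 - exp (- a / real m)) * measure (\<Gamma> \<omega>) UNIV"
    using supp
  proof (rule AE_mp[OF _ AE_I2[OF impI]])
    fix \<omega> assume w: "\<omega> \<in> space \<Omega>" and s: "AE x in \<Gamma> \<omega>. x \<in> {exp (- a)<..1}"
    have "measure (\<Gamma> \<omega>) UNIV * random_mean P \<omega> = (\<integral>x. x \<partial>\<Gamma> \<omega>)"
      using random_mean_scale(1)[OF fin[OF w] sets[OF w]] by (simp add: random_mean_def P[OF w])
    then show "measure (\<Gamma> \<omega>) UNIV = (\<Sum>k<m. ?D k \<omega>) \<and>
      \<bar>measure (\<Gamma> \<omega>) UNIV * random_mean P \<omega> - (\<Sum>k<m. right_end a m k * ?D k \<omega>)\<bar> \<le> (1 - exp (- a / real m)) * measure (\<Gamma> \<omega>) UNIV"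
      using random_mean_bound[OF fin[OF w] sets[OF w] s less_imp_le[OF a] m] by simp
  qed
  show "\<exists>D. gamma_cells \<Omega> \<kappa> a (\<lambda>\<omega>. measure (\<Gamma> \<omega>) UNIV * random_mean P \<omega>)
      (\<lambda>\<omega>. measure (\<Gamma> \<omega>) UNIV) m D"
    unfolding gamma_cells_def
    by (intro exI[of _ ?D] conjI allI impI ind lap bound AE_I2 measure_nonneg)
qed

lemma random_mean_ratio:
  assumes grm: "gamma_random_measure \<Omega> \<nu> \<Gamma>" and w: "\<omega> \<in> space \<Omega>"
    and P: "P \<omega> = scale_measure (1 / emeasure (\<Gamma> \<omega>) UNIV) (\<Gamma> \<omega>)"
  shows "random_mean P \<omega> = measure (\<Gamma> \<omega>) UNIV * random_mean P \<omega> / measure (\<Gamma> \<omega>) UNIV"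
proof (cases "measure (\<Gamma> \<omega>) UNIV = 0")
  case True
  then show ?thesis
    using random_mean_scale(2)[of "\<Gamma> \<omega>"] grm w by (simp add: random_mean_def P gamma_random_measure_def)
qed simp

section \<open>The OU process on a grid of times\<close>

lemma (in increasing_path) discounted_increment_bounds:
  assumes "0 \<le> s" "0 \<le> a"
  shows "0 \<le> discounted_increment g s a" "discounted_increment g s a \<le> g (s + a) - g s"
proof -
  have sa: "s \<le> s + a" using assms by simp
  have T: "0 \<le> g (s + a) - g s" using mono assms by (auto simp: mono_on_def)
  have "0 \<le> exp s * (g (s + a) - g s)" using T by simp
  also have "\<dots> \<le> J s (s + a)" by (rule J_bounds[OF assms(1) sa])
  finally show "0 \<le> discounted_increment g s a" by (simp add: discounted_increment_def)
  have "discounted_increment g s a \<le> exp (- (s + a)) * (exp (s + a) * (g (s + a) - g s))"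
    unfolding discounted_increment_def by (intro mult_left_mono J_bounds[OF assms(1) sa]) simp
  also have "\<dots> = g (s + a) - g s" by (simp add: mult.assoc[symmetric] exp_add[symmetric])
  finally show "discounted_increment g s a \<le> g (s + a) - g s" .
qed

text \<open>The integral over block \<open>j\<close> is discounted only to the end of this block, hence the factors
  \<open>exp (lam * j * \<Delta>)\<close>.\<close>

lemma OU_block_representation:
  assumes path: "increasing_path (\<lambda>y. G y \<omega>)" and lam: "0 < lam" and D: "0 < \<Delta>" and a: "a = lam * \<Delta>"
  shows "OU lam G v0 (real m * \<Delta>) \<omega> = exp (- lam * real m * \<Delta>) *
    (v0 \<omega> + (\<Sum>j\<in>{1..m}. exp (lam * real j * \<Delta>) * discounted_increment (\<lambda>y. G y \<omega>) (real (j - 1) * a) a))"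
proof -
  interpret increasing_path "\<lambda>y. G y \<omega>" by fact
  have a0: "0 < a" using lam D a by simp
  let ?p = "\<lambda>k. real k * a"
  have inc: "incseq ?p" using a0 by (intro incseq_SucI mult_right_mono) auto
  have t: "lam * (real m * \<Delta>) = ?p m" "- lam * (real m * \<Delta>) = - lam * real m * \<Delta>" by (simp_all add: a)
  have lam0: "lam \<noteq> 0" using lam by simp
  have "OU lam G v0 (real m * \<Delta>) \<omega> = exp (- lam * real m * \<Delta>) * (v0 \<omega> + J 0 (?p m))"
    unfolding OU_eq[OF lam0] t ..
  also have "J 0 (?p m) = (\<Sum>k<m. J (?p k) (?p (Suc k)))"
    using inc by (intro J_blocks) auto
  also have "\<dots> = (\<Sum>j\<in>{1..m}. exp (lam * real j * \<Delta>) * discounted_increment (\<lambda>y. G y \<omega>) (real (j - 1) * a) a)"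
  proof -
    have "exp (lam * real (Suc k) * \<Delta>) * discounted_increment (\<lambda>y. G y \<omega>) (real k * a) a = J (?p k) (?p (Suc k))" for k
    proof -
      have e: "real k * a + a = real (Suc k) * a" "lam * real (Suc k) * \<Delta> = real (Suc k) * a" by (simp_all add: a algebra_simps)
      show ?thesis unfolding discounted_increment_def e by (simp add: mult.assoc[symmetric] exp_add[symmetric] del: of_nat_Suc)
    qed
    then show ?thesis by (simp add: sum.atLeast1_atMost_eq)
  qed
  finally show ?thesis .
qed

text \<open>In the difference of the two values of the integrated process, the integral over the time before the block
  combines with \<open>v0\<close> to the value of the OU process at its beginning, and the block itself contributes its
  increment minus its discounted increment.\<close>

lemma integrated_OU_incr_representation:
  assumes path: "increasing_path (\<lambda>y. G y \<omega>)" and lam: "0 < lam" and D: "0 < \<Delta>" and a: "a = lam * \<Delta>" and i: "1 \<le> i"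
  shows "lam * integrated_OU_incr lam \<Delta> G v0 i \<omega> = (1 - exp (- lam * \<Delta>)) * OU lam G v0 (real (i - 1) * \<Delta>) \<omega>
    + ((G (real (i - 1) * a + a) \<omega> - G (real (i - 1) * a) \<omega>) - discounted_increment (\<lambda>y. G y \<omega>) (real (i - 1) * a) a)"
proof -
  interpret increasing_path "\<lambda>y. G y \<omega>" by fact
  have a0: "0 < a" and lam0: "lam \<noteq> 0" using lam D a by simp_all
  let ?s = "real (i - 1) * a" and ?t = "real (i - 1) * \<Delta>"
  have s0: "0 \<le> ?s" using a0 by simp
  have t1: "lam * ?t = ?s" by (simp add: a)
  have t2: "real i * \<Delta> = ?t + \<Delta>" using i by (simp add: of_nat_diff algebra_simps)
  have t3: "lam * (?t + \<Delta>) = ?s + a" by (simp add: a algebra_simps)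
  have n1: "- lam * ?t = - ?s" and n2: "- lam * (?t + \<Delta>) = - (?s + a)" using t1 t3 by simp_all
  have n3: "- lam * \<Delta> = - a" by (simp add: a)
  have J: "J 0 (?s + a) = J 0 ?s + J ?s (?s + a)" using s0 a0 by (intro J_add) auto
  have e: "exp (- (?s + a)) = exp (- ?s) * exp (- a)" by (simp add: exp_add[symmetric])
  have "lam * integrated_OU_incr lam \<Delta> G v0 i \<omega> = lam * integrated_OU lam G v0 (?t + \<Delta>) \<omega> - lam * integrated_OU lam G v0 ?t \<omega>"
    unfolding integrated_OU_incr_def t2 by (simp add: right_diff_distrib)
  also have "\<dots> = ((1 - exp (- (?s + a))) * v0 \<omega> + (G (?s + a) \<omega> - G 0 \<omega> - exp (- (?s + a)) * J 0 (?s + a)))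
      - ((1 - exp (- ?s)) * v0 \<omega> + (G ?s \<omega> - G 0 \<omega> - exp (- ?s) * J 0 ?s))"
    using integrated_OU_eq[where G=G and \<omega>=\<omega>, OF lam _ path, of "?t + \<Delta>" v0] integrated_OU_eq[where G=G and \<omega>=\<omega>, OF lam _ path, of ?t v0] D
    unfolding n1 n2 t1 t3 by simp
  also have "\<dots> = (1 - exp (- a)) * (exp (- ?s) * (v0 \<omega> + J 0 ?s)) + ((G (?s + a) \<omega> - G ?s \<omega>) - exp (- (?s + a)) * J ?s (?s + a))"
    unfolding J e by (simp add: algebra_simps)
  also have "exp (- ?s) * (v0 \<omega> + J 0 ?s) = OU lam G v0 ?t \<omega>"
    unfolding OU_eq[OF lam0] n1 t1 ..
  finally show ?thesis unfolding discounted_increment_def n3 .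
qed

section \<open>Observations with random variances\<close>

text \<open>Vectors of pairs are pairs of vectors: an integral over the former is an iterated integral, here with the
  first components innermost.\<close>

lemma nn_integral_PiM_zip:
  assumes fin: "finite I" and A: "sigma_finite_measure A" and B: "sigma_finite_measure B" and C: "sigma_finite_measure C"
    and f: "f \<in> borel_measurable (PiM I (\<lambda>_. A \<Otimes>\<^sub>M B) \<Otimes>\<^sub>M C)"
  shows "(\<integral>\<^sup>+u. f u \<partial>(PiM I (\<lambda>_. A \<Otimes>\<^sub>M B) \<Otimes>\<^sub>M C)) =
    (\<integral>\<^sup>+u. \<integral>\<^sup>+x. f (\<lambda>i\<in>I. (x i, fst u i), snd u) \<partial>PiM I (\<lambda>_. A) \<partial>(PiM I (\<lambda>_. B) \<Otimes>\<^sub>M C))"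
proof -
  let ?A = "PiM I (\<lambda>_. A)" and ?B = "PiM I (\<lambda>_. B)" and ?AB = "PiM I (\<lambda>_. A \<Otimes>\<^sub>M B)"
  let ?z = "\<lambda>z. \<lambda>i\<in>I. (fst z i, snd z i)"
  note sfA = sigma_finite_PiM[OF fin A] and sfB = sigma_finite_PiM[OF fin B]
    and sfAB = sigma_finite_PiM[OF fin sigma_finite_pair_measure[OF A B]]
  interpret SA: sigma_finite_measure ?A by (rule sfA)
  interpret AB_C: pair_sigma_finite ?AB C using sfAB C by (rule pair_sigma_finite.intro)
  interpret A_B: pair_sigma_finite ?A ?B using sfA sfB by (rule pair_sigma_finite.intro)
  interpret B_C: pair_sigma_finite ?B C using sfB C by (rule pair_sigma_finite.intro)
  note [measurable] = f
  have zm[measurable]: "?z \<in> measurable (?A \<Otimes>\<^sub>M ?B) ?AB" by measurable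
  have "(\<integral>\<^sup>+u. f u \<partial>(?AB \<Otimes>\<^sub>M C)) = (\<integral>\<^sup>+w. \<integral>\<^sup>+z. f (z, w) \<partial>?AB \<partial>C)"
    by (rule AB_C.nn_integral_snd[symmetric]) (rule f)
  also have "\<dots> = (\<integral>\<^sup>+w. \<integral>\<^sup>+z. f (?z z, w) \<partial>(?A \<Otimes>\<^sub>M ?B) \<partial>C)"
  proof (rule nn_integral_cong)
    fix w assume "w \<in> space C"
    then have [measurable]: "(\<lambda>z. f (z, w)) \<in> borel_measurable ?AB" by measurable
    have "(\<integral>\<^sup>+z. f (z, w) \<partial>?AB) = (\<integral>\<^sup>+z. f (z, w) \<partial>distr (?A \<Otimes>\<^sub>M ?B) ?AB ?z)"
      using distr_PiM_zip[OF fin, of "\<lambda>_. A" "\<lambda>_. B"] A B by simp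
    also have "\<dots> = (\<integral>\<^sup>+z. f (?z z, w) \<partial>(?A \<Otimes>\<^sub>M ?B))"
      by (rule nn_integral_distr) measurable
    finally show "(\<integral>\<^sup>+z. f (z, w) \<partial>?AB) = (\<integral>\<^sup>+z. f (?z z, w) \<partial>(?A \<Otimes>\<^sub>M ?B))" .
  qed
  also have "\<dots> = (\<integral>\<^sup>+w. \<integral>\<^sup>+y. \<integral>\<^sup>+x. f (\<lambda>i\<in>I. (x i, y i), w) \<partial>?A \<partial>?B \<partial>C)"
  proof (rule nn_integral_cong)
    fix w assume "w \<in> space C"
    then have [measurable]: "(\<lambda>z. f (z, w)) \<in> borel_measurable ?AB" by measurable
    have "(\<lambda>z. f (?z z, w)) \<in> borel_measurable (?A \<Otimes>\<^sub>M ?B)" by measurable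
    then show "(\<integral>\<^sup>+z. f (?z z, w) \<partial>(?A \<Otimes>\<^sub>M ?B)) = (\<integral>\<^sup>+y. \<integral>\<^sup>+x. f (\<lambda>i\<in>I. (x i, y i), w) \<partial>?A \<partial>?B)"
      by (subst A_B.nn_integral_snd[symmetric]) simp_all
  qed
  also have "\<dots> = (\<integral>\<^sup>+u. \<integral>\<^sup>+x. f (\<lambda>i\<in>I. (x i, fst u i), snd u) \<partial>?A \<partial>(?B \<Otimes>\<^sub>M C))"
  proof -
    have "(\<lambda>u. \<integral>\<^sup>+x. f (\<lambda>i\<in>I. (x i, fst u i), snd u) \<partial>?A) \<in> borel_measurable (?B \<Otimes>\<^sub>M C)"
      by (rule SA.borel_measurable_nn_integral) measurable
    then show ?thesis
      by (subst B_C.nn_integral_snd[symmetric]) simp_all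
  qed
  finally show ?thesis .
qed

lemma measurable_normal_pdf:
  assumes "f \<in> borel_measurable N" "g \<in> borel_measurable N" "h \<in> borel_measurable N"
  shows "(\<lambda>\<omega>. normal_pdf (f \<omega>) (g \<omega>) (h \<omega>)) \<in> borel_measurable N"
  using assms unfolding normal_pdf_def normal_density_def by measurable

lemma measurable_observation:
  assumes "\<And>i. i \<in> {1..n} \<Longrightarrow> \<epsilon> i \<in> borel_measurable N" "\<And>i. i \<in> {1..n} \<Longrightarrow> \<tau> i \<in> borel_measurable N"
  shows "(\<lambda>\<omega>. \<lambda>i\<in>{1..n}. observation \<mu> \<beta> \<Delta> \<tau> \<epsilon> i \<omega>) \<in> measurable N (PiM {1..n} (\<lambda>_. lborel))"
proof (rule measurable_restrict)
  fix i assume i: "i \<in> {1..n}"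
  note [measurable] = assms[OF i]
  show "observation \<mu> \<beta> \<Delta> \<tau> \<epsilon> i \<in> measurable N lborel"
    unfolding observation_def[abs_def] by simp
qed

lemma measurable_tau_expr:
  assumes "\<And>j. j \<in> {1..n} \<Longrightarrow> t j \<in> borel_measurable N" "\<And>j. j \<in> {1..n} \<Longrightarrow> v j \<in> borel_measurable N"
    "w \<in> borel_measurable N" and i: "i \<in> {1..n}"
  shows "(\<lambda>\<omega>. tau_expr lam \<Delta> i (\<lambda>j. t j \<omega>) (\<lambda>j. v j \<omega>) (w \<omega>)) \<in> borel_measurable N"
  unfolding tau_expr_def using i
  by (intro borel_measurable_times borel_measurable_add borel_measurable_sum borel_measurable_diff borel_measurable_const assms) auto

lemma tau_expr_cong:
  assumes "\<And>j. j \<in> {1..n} \<Longrightarrow> t j = t' j" "\<And>j. j \<in> {1..n} \<Longrightarrow> v j = v' j" "i \<in> {1..n}"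
  shows "tau_expr lam \<Delta> i t v w = tau_expr lam \<Delta> i t' v' w"
proof -
  have "(\<Sum>j\<in>{1..i - 1}. exp (lam * real j * \<Delta>) * t j * v j) = (\<Sum>j\<in>{1..i - 1}. exp (lam * real j * \<Delta>) * t' j * v' j)"
    using assms by (intro sum.cong) auto
  then show ?thesis using assms unfolding tau_expr_def by simp
qed

lemma joint_density_eq:
  "joint_density \<theta> lam \<Delta> \<mu> \<beta> n fM fv x t v w =
    (\<Prod>i\<in>{1..n}. ennreal (normal_pdf (x i) (\<mu> * \<Delta> + \<beta> * tau_expr lam \<Delta> i t v w) (tau_expr lam \<Delta> i t v w))) *
    ((\<Prod>i\<in>{1..n}. ennreal (gamma_density (\<theta> * (lam * \<Delta>)) (t i)) * fM (v i)) * fv w)"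
  unfolding joint_density_def by (simp add: prod.distrib mult.assoc)

lemma (in prob_space) observation_mixture:
  fixes t :: "nat \<Rightarrow> 'z \<Rightarrow> real"
  assumes eps: "iid_std_normal M n \<epsilon>"
    and ind: "indep_rv M (PiM {1..n} (\<lambda>_. borel)) (\<lambda>\<omega>. \<lambda>i\<in>{1..n}. \<epsilon> i \<omega>) S Z"
    and t: "\<And>i. i \<in> {1..n} \<Longrightarrow> t i \<in> borel_measurable S"
    and tau: "\<And>i \<omega>. i \<in> {1..n} \<Longrightarrow> \<omega> \<in> space M \<Longrightarrow> \<tau> i \<omega> = t i (Z \<omega>)"
    and pos: "\<And>i \<omega>. i \<in> {1..n} \<Longrightarrow> \<omega> \<in> space M \<Longrightarrow> 0 < \<tau> i \<omega>"
    and F: "F \<in> borel_measurable (PiM {1..n} (\<lambda>_. lborel) \<Otimes>\<^sub>M S)"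
  shows "(\<integral>\<^sup>+\<omega>. F (\<lambda>i\<in>{1..n}. observation \<mu> \<beta> \<Delta> \<tau> \<epsilon> i \<omega>, Z \<omega>) \<partial>M) =
    (\<integral>\<^sup>+\<omega>. \<integral>\<^sup>+x. (\<Prod>i\<in>{1..n}. ennreal (normal_pdf (x i) (\<mu> * \<Delta> + \<beta> * \<tau> i \<omega>) (\<tau> i \<omega>))) * F (x, Z \<omega>)
      \<partial>PiM {1..n} (\<lambda>_. lborel) \<partial>M)"
proof -
  let ?m = "\<lambda>i z. \<mu> * \<Delta> + \<beta> * t i z" and ?s = "\<lambda>i z. sqrt (t i z)"
  have "(\<integral>\<^sup>+\<omega>. F (\<lambda>i\<in>{1..n}. observation \<mu> \<beta> \<Delta> \<tau> \<epsilon> i \<omega>, Z \<omega>) \<partial>M) =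
    (\<integral>\<^sup>+\<omega>. F (\<lambda>i\<in>{1..n}. ?m i (Z \<omega>) + ?s i (Z \<omega>) * \<epsilon> i \<omega>, Z \<omega>) \<partial>M)"
    using tau by (intro nn_integral_cong) (simp add: observation_def cong: restrict_cong)
  also have "\<dots> = (\<integral>\<^sup>+\<omega>. \<integral>\<^sup>+x. (\<Prod>i\<in>{1..n}. ennreal (normal_density (?m i (Z \<omega>)) (?s i (Z \<omega>)) (x i))) * F (x, Z \<omega>)
      \<partial>PiM {1..n} (\<lambda>_. lborel) \<partial>M)"
  proof (rule nn_integral_normal_mixture[OF _ _ _ ind _ _ _ F])
    show "indep_vars (\<lambda>_. borel) \<epsilon> {1..n}" using eps by (simp add: iid_std_normal_def)
    show "distributed M lborel (\<epsilon> i) (\<lambda>x. ennreal (std_normal_density x))" if "i \<in> {1..n}" for i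
      using eps that by (simp add: iid_std_normal_def)
    show "0 < ?s i (Z \<omega>)" if "i \<in> {1..n}" "\<omega> \<in> space M" for i \<omega>
      using pos[OF that] tau[OF that] by simp
  qed (use t in \<open>auto intro!: borel_measurable_add borel_measurable_times borel_measurable_sqrt\<close>)
  also have "\<dots> = (\<integral>\<^sup>+\<omega>. \<integral>\<^sup>+x. (\<Prod>i\<in>{1..n}. ennreal (normal_pdf (x i) (\<mu> * \<Delta> + \<beta> * \<tau> i \<omega>) (\<tau> i \<omega>))) * F (x, Z \<omega>)
      \<partial>PiM {1..n} (\<lambda>_. lborel) \<partial>M)"
    using tau by (intro nn_integral_cong arg_cong2[where f="(*)"] prod.cong refl) (simp add: normal_pdf_def)
  finally show ?thesis .
qed

lemma (in prob_space) observation_distributed: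
  assumes eps: "iid_std_normal M n \<epsilon>"
    and ind: "indep_rv M (PiM {1..n} (\<lambda>_. borel)) (\<lambda>\<omega>. \<lambda>i\<in>{1..n}. \<epsilon> i \<omega>)
      (PiM {1..n} (\<lambda>_. borel)) (\<lambda>\<omega>. \<lambda>i\<in>{1..n}. \<tau> i \<omega>)"
    and pos: "\<And>i \<omega>. i \<in> {1..n} \<Longrightarrow> \<omega> \<in> space M \<Longrightarrow> 0 < \<tau> i \<omega>"
  shows "distributed M (PiM {1..n} (\<lambda>_. lborel)) (\<lambda>\<omega>. \<lambda>i\<in>{1..n}. observation \<mu> \<beta> \<Delta> \<tau> \<epsilon> i \<omega>)
    (likelihood M \<mu> \<beta> \<Delta> \<tau> n)"
proof -
  let ?I = "{1..n}" and ?X = "\<lambda>\<omega>. \<lambda>i\<in>{1..n}. observation \<mu> \<beta> \<Delta> \<tau> \<epsilon> i \<omega>"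
  let ?L = "PiM ?I (\<lambda>_. lborel) :: (nat \<Rightarrow> real) measure" and ?B = "PiM ?I (\<lambda>_. borel) :: (nat \<Rightarrow> real) measure"
  let ?Z = "\<lambda>\<omega>. \<lambda>i\<in>?I. \<tau> i \<omega>"
  let ?p = "\<lambda>\<omega> x. \<Prod>i\<in>?I. ennreal (normal_pdf (x i) (\<mu> * \<Delta> + \<beta> * \<tau> i \<omega>) (\<tau> i \<omega>))"
  have sfL: "sigma_finite_measure ?L" by (intro sigma_finite_PiM lborel.sigma_finite_measure_axioms) simp
  interpret L: sigma_finite_measure ?L by fact
  interpret LM: pair_sigma_finite M ?L using sigma_finite_measure_axioms sfL by (rule pair_sigma_finite.intro)
  have eps_m: "\<epsilon> i \<in> borel_measurable M" if "i \<in> ?I" for i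
    using eps that by (auto simp: iid_std_normal_def indep_vars_def)
  have tau_m: "\<tau> i \<in> borel_measurable M" if "i \<in> ?I" for i
  proof -
    have "(\<lambda>\<omega>. ?Z \<omega> i) \<in> borel_measurable M"
      using ind measurable_compose[OF _ measurable_component_singleton[OF that]] unfolding indep_rv_def by blast
    then show ?thesis using that by simp
  qed
  have X: "?X \<in> measurable M ?L" using eps_m tau_m by (rule measurable_observation)
  have p: "(\<lambda>(\<omega>, x). ?p \<omega> x) \<in> borel_measurable (M \<Otimes>\<^sub>M ?L)"
    unfolding split_beta'
  proof (intro borel_measurable_prod_ennreal measurable_compose[OF _ measurable_ennreal] measurable_normal_pdf)
    fix i assume i: "i \<in> ?I"
    have [measurable]: "\<tau> i \<in> borel_measurable M" using tau_m i by auto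
    have "(\<lambda>x. x i) \<in> borel_measurable ?L"
      using measurable_component_singleton[OF i, of "\<lambda>_. lborel"] by simp
    then show "(\<lambda>z. snd z i) \<in> borel_measurable (M \<Otimes>\<^sub>M ?L)" by measurable
    show "(\<lambda>z. \<mu> * \<Delta> + \<beta> * \<tau> i (fst z)) \<in> borel_measurable (M \<Otimes>\<^sub>M ?L)" "(\<lambda>z. \<tau> i (fst z)) \<in> borel_measurable (M \<Otimes>\<^sub>M ?L)"
      by measurable
  qed
  have lik: "likelihood M \<mu> \<beta> \<Delta> \<tau> n = (\<lambda>x. \<integral>\<^sup>+\<omega>. ?p \<omega> x \<partial>M)"
    by (simp add: likelihood_def fun_eq_iff)
  have p': "(\<lambda>(x, \<omega>). ?p \<omega> x) \<in> borel_measurable (?L \<Otimes>\<^sub>M M)"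
    using measurable_compose[OF measurable_pair_swap' p] by (simp add: split_beta')
  have lik_m: "likelihood M \<mu> \<beta> \<Delta> \<tau> n \<in> borel_measurable ?L"
    unfolding lik using p' by (rule borel_measurable_nn_integral)
  have "distr M ?L ?X = density ?L (likelihood M \<mu> \<beta> \<Delta> \<tau> n)"
  proof (rule measure_eqI)
    fix A assume "A \<in> sets (distr M ?L ?X)"
    then have A[measurable]: "A \<in> sets ?L" by simp
    have F: "(\<lambda>z. indicator A (fst z) :: ennreal) \<in> borel_measurable (?L \<Otimes>\<^sub>M ?B)" by measurable
    have "emeasure (distr M ?L ?X) A = (\<integral>\<^sup>+\<omega>. indicator A (?X \<omega>) \<partial>M)"
      using A by (subst nn_integral_distr[OF X, symmetric]) auto
    also have "\<dots> = (\<integral>\<^sup>+\<omega>. \<integral>\<^sup>+x. ?p \<omega> x * indicator A x \<partial>?L \<partial>M)"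
      by (subst observation_mixture[OF eps ind _ _ pos F, of "\<lambda>i z. z i", simplified fst_conv]) auto
    also have "\<dots> = (\<integral>\<^sup>+x. \<integral>\<^sup>+\<omega>. ?p \<omega> x * indicator A x \<partial>M \<partial>?L)"
    proof (rule LM.Fubini'[symmetric])
      show "(\<lambda>(\<omega>, x). ?p \<omega> x * indicator A x) \<in> borel_measurable (M \<Otimes>\<^sub>M ?L)"
        using p unfolding split_beta'
        by (intro borel_measurable_times_ennreal measurable_compose[OF measurable_snd borel_measurable_indicator[OF A]])
    qed
    also have "\<dots> = (\<integral>\<^sup>+x. likelihood M \<mu> \<beta> \<Delta> \<tau> n x * indicator A x \<partial>?L)"
      unfolding lik
    proof (intro nn_integral_cong nn_integral_multc)
      fix x assume "x \<in> space ?L"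
      then show "(\<lambda>\<omega>. ?p \<omega> x) \<in> borel_measurable M"
        using measurable_compose[OF measurable_Pair1' p'] by simp
    qed
    also have "\<dots> = emeasure (density ?L (likelihood M \<mu> \<beta> \<Delta> \<tau> n)) A"
      by (rule emeasure_density[OF lik_m A, symmetric])
    finally show "emeasure (distr M ?L ?X) A = emeasure (density ?L (likelihood M \<mu> \<beta> \<Delta> \<tau> n)) A" .
  qed simp
  then show ?thesis using lik_m X by (simp add: distributed_def)
qed

section \<open>The joint density of observations and latent variables\<close>

text \<open>The discretised model without reference to the process behind it: independent pairs \<open>(T i, V i)\<close>, an
  independent initial value \<open>W\<close>, and positive variances given by \<open>tau_expr\<close>.  The hypothesis that
  \<open>fM\<close> is a probability density is listed separately, since for \<open>n = 0\<close> it does not follow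
  from the laws of the \<open>V i\<close>.\<close>

locale block_model = prob_space +
  fixes T V :: "nat \<Rightarrow> 'a \<Rightarrow> real" and W :: "'a \<Rightarrow> real" and \<tau> :: "nat \<Rightarrow> 'a \<Rightarrow> real"
    and \<theta> lam \<Delta> :: real and n :: nat and fM fv :: "real \<Rightarrow> ennreal"
  assumes shape_pos: "0 < \<theta> * (lam * \<Delta>)"
    and blocks: "indep_vars (\<lambda>_. borel \<Otimes>\<^sub>M borel) (\<lambda>i \<omega>. (T i \<omega>, V i \<omega>)) {1..n}"
    and pair: "\<And>i. i \<in> {1..n} \<Longrightarrow> indep_rv M borel (T i) borel (V i)"
    and T_law: "\<And>i. i \<in> {1..n} \<Longrightarrow> distr M borel (T i) = gamma_law (\<theta> * (lam * \<Delta>))"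
    and V_law: "\<And>i. i \<in> {1..n} \<Longrightarrow> distr M borel (V i) = density lborel fM"
    and fM: "fM \<in> borel_measurable lborel" "prob_space (density lborel fM)"
    and indep_W: "indep_rv M (PiM {1..n} (\<lambda>_. borel \<Otimes>\<^sub>M borel)) (\<lambda>\<omega>. \<lambda>i\<in>{1..n}. (T i \<omega>, V i \<omega>)) borel W"
    and W_law: "distributed M lborel W fv"
    and tau: "\<And>i \<omega>. i \<in> {1..n} \<Longrightarrow> \<omega> \<in> space M \<Longrightarrow>
      \<tau> i \<omega> = tau_expr lam \<Delta> i (\<lambda>j. T j \<omega>) (\<lambda>j. V j \<omega>) (W \<omega>)"
    and tau_pos: "\<And>i \<omega>. i \<in> {1..n} \<Longrightarrow> \<omega> \<in> space M \<Longrightarrow> 0 < \<tau> i \<omega>"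
begin

abbreviation "L1 \<equiv> (PiM {1..n} (\<lambda>_. lborel)) :: (nat \<Rightarrow> real) measure"
abbreviation "L2 \<equiv> (PiM {1..n} (\<lambda>_. lborel \<Otimes>\<^sub>M lborel) \<Otimes>\<^sub>M lborel) :: ((nat \<Rightarrow> real \<times> real) \<times> real) measure"
abbreviation "B2 \<equiv> (PiM {1..n} (\<lambda>_. borel \<Otimes>\<^sub>M borel) \<Otimes>\<^sub>M borel) :: ((nat \<Rightarrow> real \<times> real) \<times> real) measure"
abbreviation "L3 \<equiv> (PiM {1..n} (\<lambda>_. lborel \<Otimes>\<^sub>M (lborel \<Otimes>\<^sub>M lborel)) \<Otimes>\<^sub>M lborel) :: ((nat \<Rightarrow> real \<times> (real \<times> real)) \<times> real) measure"

definition latent :: "'a \<Rightarrow> (nat \<Rightarrow> real \<times> real) \<times> real" where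
  "latent \<omega> = (\<lambda>i\<in>{1..n}. (T i \<omega>, V i \<omega>), W \<omega>)"

definition latent_density :: "(nat \<Rightarrow> real \<times> real) \<times> real \<Rightarrow> ennreal" where
  "latent_density u = (\<Prod>i\<in>{1..n}. ennreal (gamma_density (\<theta> * (lam * \<Delta>)) (fst (fst u i))) * fM (snd (fst u i))) * fv (snd u)"

definition tau_latent :: "nat \<Rightarrow> (nat \<Rightarrow> real \<times> real) \<times> real \<Rightarrow> real" where
  "tau_latent i u = tau_expr lam \<Delta> i (\<lambda>j. fst (fst u j)) (\<lambda>j. snd (fst u j)) (snd u)"

lemma sets_B2: "sets B2 = sets L2"
  by (intro sets_pair_measure_cong sets_PiM_cong refl) auto

lemma latent_measurable: "latent \<in> measurable M B2"
  unfolding latent_def[abs_def] using indep_W by (auto simp: indep_rv_def)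

lemma latent_measurable_L2: "latent \<in> measurable M L2"
  using latent_measurable unfolding measurable_cong_sets[OF refl sets_B2] .

lemma fv_measurable: "fv \<in> borel_measurable lborel"
  using W_law by (simp add: distributed_def)

lemma component_measurable:
  assumes "i \<in> {1..n}"
  shows "(\<lambda>u. fst (fst u i)) \<in> borel_measurable L2" "(\<lambda>u. snd (fst u i)) \<in> borel_measurable L2"
proof -
  have c: "(\<lambda>u. fst u i) \<in> measurable L2 (lborel \<Otimes>\<^sub>M lborel)"
    using measurable_compose[OF measurable_fst measurable_component_singleton[OF assms]] .
  show "(\<lambda>u. fst (fst u i)) \<in> borel_measurable L2" "(\<lambda>u. snd (fst u i)) \<in> borel_measurable L2"
    using measurable_compose[OF c measurable_fst] measurable_compose[OF c measurable_snd] by simp_all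
qed

lemma latent_density_measurable: "latent_density \<in> borel_measurable L2"
  unfolding latent_density_def[abs_def]
proof (intro borel_measurable_times_ennreal borel_measurable_prod_ennreal)
  fix i assume i: "i \<in> {1..n}"
  show "(\<lambda>u. ennreal (gamma_density (\<theta> * (lam * \<Delta>)) (fst (fst u i)))) \<in> borel_measurable L2"
    using component_measurable(1)[OF i] by measurable
  show "(\<lambda>u. fM (snd (fst u i))) \<in> borel_measurable L2"
    using measurable_compose[OF component_measurable(2)[OF i], of fM] fM by simp
next
  show "(\<lambda>u. fv (snd u)) \<in> borel_measurable L2"
    using measurable_compose[OF measurable_snd fv_measurable] .
qed

lemma tau_latent_measurable: "i \<in> {1..n} \<Longrightarrow> tau_latent i \<in> borel_measurable L2"
  unfolding tau_latent_def[abs_def]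
  by (intro measurable_tau_expr[of n] component_measurable) auto

lemma tau_eq_tau_latent:
  assumes "i \<in> {1..n}" "\<omega> \<in> space M"
  shows "\<tau> i \<omega> = tau_latent i (latent \<omega>)"
proof -
  have "tau_expr lam \<Delta> i (\<lambda>j. T j \<omega>) (\<lambda>j. V j \<omega>) (W \<omega>) = tau_latent i (latent \<omega>)"
    unfolding tau_latent_def latent_def fst_conv snd_conv by (rule tau_expr_cong[OF _ _ assms(1)]) auto
  then show ?thesis using tau[OF assms] by simp
qed

lemma latent_law: "distr M B2 latent = density L2 latent_density"
proof -
  let ?k = "\<theta> * (lam * \<Delta>)"
  let ?g = "density lborel (\<lambda>x. ennreal (gamma_density ?k x))"
  let ?q = "\<lambda>y. ennreal (gamma_density ?k (fst y)) * fM (snd y)"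
  have g: "gamma_law ?k = ?g"
  proof -
    have "?k \<noteq> 0" using shape_pos by linarith
    then show ?thesis unfolding gamma_law_def by (rule if_not_P)
  qed
  have gm: "(\<lambda>x. ennreal (gamma_density ?k x)) \<in> borel_measurable lborel" by simp
  interpret G: prob_space ?g using prob_space_gamma_law[OF shape_pos] unfolding g .
  interpret F: prob_space "density lborel fM" by (rule fM)
  have W: "distr M borel W = density lborel fv"
    using W_law by (simp add: distributed_def cong: distr_cong)
  interpret FW: prob_space "density lborel fv"
    unfolding W[symmetric] using indep_W by (intro prob_space_distr) (simp add: indep_rv_def)
  have GF: "?g \<Otimes>\<^sub>M density lborel fM = density (lborel \<Otimes>\<^sub>M lborel) ?q"
    using pair_measure_density[OF gm fM(1) lborel.sigma_finite_measure_axioms F.sigma_finite_measure_axioms]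
    by (simp add: split_beta')
  have sfGF: "sigma_finite_measure (density (lborel \<Otimes>\<^sub>M lborel) ?q)"
    unfolding GF[symmetric] by (rule sigma_finite_pair_measure) unfold_locales
  have qm: "?q \<in> borel_measurable (lborel \<Otimes>\<^sub>M lborel)"
    using fM by measurable
  have sf2: "sigma_finite_measure (lborel \<Otimes>\<^sub>M lborel :: (real \<times> real) measure)"
    by (rule sigma_finite_pair_measure) unfold_locales
  have one: "distr M (borel \<Otimes>\<^sub>M borel) (\<lambda>\<omega>. (T i \<omega>, V i \<omega>)) = density (lborel \<Otimes>\<^sub>M lborel) ?q" if "i \<in> {1..n}" for i
    using indep_rv_distr[OF prob_space_axioms pair[OF that]] unfolding T_law[OF that] V_law[OF that] g GF .
  have "distr M (PiM {1..n} (\<lambda>_. borel \<Otimes>\<^sub>M borel)) (\<lambda>\<omega>. \<lambda>i\<in>{1..n}. (T i \<omega>, V i \<omega>)) =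
      PiM {1..n} (\<lambda>i. distr M (borel \<Otimes>\<^sub>M borel) (\<lambda>\<omega>. (T i \<omega>, V i \<omega>)))"
    by (rule indep_vars_distr_PiM[OF _ blocks]) simp
  also have "\<dots> = PiM {1..n} (\<lambda>i. density (lborel \<Otimes>\<^sub>M lborel) ?q)"
    using one by (intro PiM_cong) auto
  also have "\<dots> = density (PiM {1..n} (\<lambda>_. lborel \<Otimes>\<^sub>M lborel)) (\<lambda>y. \<Prod>i\<in>{1..n}. ?q (y i))"
    using sf2 qm sfGF by (intro PiM_density) auto
  finally have TV: "distr M (PiM {1..n} (\<lambda>_. borel \<Otimes>\<^sub>M borel)) (\<lambda>\<omega>. \<lambda>i\<in>{1..n}. (T i \<omega>, V i \<omega>)) =
      density (PiM {1..n} (\<lambda>_. lborel \<Otimes>\<^sub>M lborel)) (\<lambda>y. \<Prod>i\<in>{1..n}. ?q (y i))" .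
  have pm: "(\<lambda>y. \<Prod>i\<in>{1..n}. ?q (y i)) \<in> borel_measurable (PiM {1..n} (\<lambda>_. lborel \<Otimes>\<^sub>M lborel))"
  proof (rule borel_measurable_prod_ennreal)
    fix i assume "i \<in> {1..n}"
    then show "(\<lambda>y. ?q (y i)) \<in> borel_measurable (PiM {1..n} (\<lambda>_. lborel \<Otimes>\<^sub>M lborel))"
      by (intro measurable_compose[OF _ qm] measurable_component_singleton)
  qed
  have "distr M B2 latent = density (PiM {1..n} (\<lambda>_. lborel \<Otimes>\<^sub>M lborel)) (\<lambda>y. \<Prod>i\<in>{1..n}. ?q (y i)) \<Otimes>\<^sub>M density lborel fv"
    unfolding latent_def[abs_def] indep_rv_distr[OF prob_space_axioms indep_W] TV W ..
  also have "\<dots> = density L2 (\<lambda>(y, w). (\<Prod>i\<in>{1..n}. ?q (y i)) * fv w)"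
    by (rule pair_measure_density[OF pm fv_measurable lborel.sigma_finite_measure_axioms FW.sigma_finite_measure_axioms])
  also have "(\<lambda>(y, w). (\<Prod>i\<in>{1..n}. ?q (y i)) * fv w) = latent_density"
    by (simp add: fun_eq_iff latent_density_def)
  finally show ?thesis .
qed

lemma nn_integral_latent:
  assumes "F \<in> borel_measurable L2"
  shows "(\<integral>\<^sup>+\<omega>. F (latent \<omega>) \<partial>M) = (\<integral>\<^sup>+u. latent_density u * F u \<partial>L2)"
proof -
  have "F \<in> borel_measurable B2" using assms unfolding measurable_cong_sets[OF sets_B2 refl] .
  then have "(\<integral>\<^sup>+\<omega>. F (latent \<omega>) \<partial>M) = (\<integral>\<^sup>+u. F u \<partial>distr M B2 latent)"
    by (subst nn_integral_distr[OF latent_measurable]) auto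
  also have "\<dots> = (\<integral>\<^sup>+u. latent_density u * F u \<partial>L2)"
    unfolding latent_law by (rule nn_integral_density[OF latent_density_measurable assms])
  finally show ?thesis .
qed

abbreviation pdfs :: "real \<Rightarrow> real \<Rightarrow> (nat \<Rightarrow> real) \<Rightarrow> (nat \<Rightarrow> real \<times> real) \<times> real \<Rightarrow> ennreal" where
  "pdfs \<mu> \<beta> x u \<equiv> \<Prod>i\<in>{1..n}. ennreal (normal_pdf (x i) (\<mu> * \<Delta> + \<beta> * tau_latent i u) (tau_latent i u))"

lemma pdfs_measurable:
  assumes x: "\<And>i. i \<in> {1..n} \<Longrightarrow> (\<lambda>z. x z i) \<in> borel_measurable N" and u: "u \<in> measurable N L2"
  shows "(\<lambda>z. pdfs \<mu> \<beta> (x z) (u z)) \<in> borel_measurable N"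
proof (intro borel_measurable_prod_ennreal measurable_compose[OF _ measurable_ennreal] measurable_normal_pdf x)
  fix i assume i: "i \<in> {1..n}"
  have [measurable]: "(\<lambda>z. tau_latent i (u z)) \<in> borel_measurable N"
    using measurable_compose[OF u tau_latent_measurable[OF i]] .
  show "(\<lambda>z. tau_latent i (u z)) \<in> borel_measurable N" "(\<lambda>z. \<mu> * \<Delta> + \<beta> * tau_latent i (u z)) \<in> borel_measurable N"
    by measurable
qed

lemma likelihood_eq_joint_density_integral:
  "likelihood M \<mu> \<beta> \<Delta> \<tau> n x =
    (\<integral>\<^sup>+(y, w). joint_density \<theta> lam \<Delta> \<mu> \<beta> n fM fv x (\<lambda>i. fst (y i)) (\<lambda>i. snd (y i)) w \<partial>L2)"
proof -
  have "likelihood M \<mu> \<beta> \<Delta> \<tau> n x = (\<integral>\<^sup>+\<omega>. pdfs \<mu> \<beta> x (latent \<omega>) \<partial>M)"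
    unfolding likelihood_def by (intro nn_integral_cong prod.cong refl) (simp add: tau_eq_tau_latent)
  also have "\<dots> = (\<integral>\<^sup>+u. latent_density u * pdfs \<mu> \<beta> x u \<partial>L2)"
    by (intro nn_integral_latent pdfs_measurable) auto
  also have "\<dots> = (\<integral>\<^sup>+(y, w). joint_density \<theta> lam \<Delta> \<mu> \<beta> n fM fv x (\<lambda>i. fst (y i)) (\<lambda>i. snd (y i)) w \<partial>L2)"
    by (intro nn_integral_cong) (simp add: split_beta' joint_density_eq latent_density_def tau_latent_def mult.commute)
  finally show ?thesis .
qed

text \<open>The conditional density of the observations given the latent variables times the density of the latter is a
  density on pairs of vectors; it is then transported to vectors of triples.\<close>

lemma joint_distributed:
  assumes eps: "iid_std_normal M n \<epsilon>"
    and ind: "indep_rv M (PiM {1..n} (\<lambda>_. borel)) (\<lambda>\<omega>. \<lambda>i\<in>{1..n}. \<epsilon> i \<omega>) B2 latent"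
  shows "distributed M L3 (\<lambda>\<omega>. (\<lambda>i\<in>{1..n}. (observation \<mu> \<beta> \<Delta> \<tau> \<epsilon> i \<omega>, T i \<omega>, V i \<omega>), W \<omega>))
    (\<lambda>(z, w). joint_density \<theta> lam \<Delta> \<mu> \<beta> n fM fv (\<lambda>i. fst (z i)) (\<lambda>i. fst (snd (z i))) (\<lambda>i. snd (snd (z i))) w)"
proof -
  let ?X = "\<lambda>\<omega>. \<lambda>i\<in>{1..n}. observation \<mu> \<beta> \<Delta> \<tau> \<epsilon> i \<omega>"
  let ?R = "\<lambda>\<omega>. (\<lambda>i\<in>{1..n}. (observation \<mu> \<beta> \<Delta> \<tau> \<epsilon> i \<omega>, T i \<omega>, V i \<omega>), W \<omega>)"
  let ?m = "\<lambda>x u. (\<lambda>i\<in>{1..n}. (x i, fst u i), snd u)"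
  let ?j = "\<lambda>q. joint_density \<theta> lam \<Delta> \<mu> \<beta> n fM fv (\<lambda>i. fst (fst q i)) (\<lambda>i. fst (snd (fst q i))) (\<lambda>i. snd (snd (fst q i))) (snd q)"
  let ?p = "\<lambda>q. (\<lambda>i\<in>{1..n}. snd (fst q i), snd q)"
  have m: "(\<lambda>z. ?m (fst z) (snd z)) \<in> measurable (L1 \<Otimes>\<^sub>M L2) L3"
  proof (intro measurable_Pair measurable_restrict)
    fix i assume i: "i \<in> {1..n}"
    note c1 = measurable_compose[OF measurable_fst measurable_component_singleton[OF i]]
    show "(\<lambda>z. fst z i) \<in> measurable (L1 \<Otimes>\<^sub>M L2) lborel"
      using c1 .
    show "(\<lambda>z. fst (snd z) i) \<in> measurable (L1 \<Otimes>\<^sub>M L2) (lborel \<Otimes>\<^sub>M lborel)"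
      using measurable_compose[OF measurable_snd c1] .
  next
    show "(\<lambda>z. snd (snd z)) \<in> measurable (L1 \<Otimes>\<^sub>M L2) lborel"
      using measurable_compose[OF measurable_snd measurable_snd] .
  qed
  have p: "?p \<in> measurable L3 L2"
  proof (intro measurable_Pair measurable_restrict measurable_snd)
    fix i assume i: "i \<in> {1..n}"
    show "(\<lambda>q. snd (fst q i)) \<in> measurable L3 (lborel \<Otimes>\<^sub>M lborel)"
      using measurable_compose[OF measurable_compose[OF measurable_fst measurable_component_singleton[OF i]] measurable_snd] .
  qed
  have j_eq: "?j q = pdfs \<mu> \<beta> (\<lambda>i. fst (fst q i)) (?p q) * latent_density (?p q)" for q
  proof -
    have "tau_latent i (?p q) = tau_expr lam \<Delta> i (\<lambda>i. fst (snd (fst q i))) (\<lambda>i. snd (snd (fst q i))) (snd q)" if "i \<in> {1..n}" for i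
      unfolding tau_latent_def fst_conv snd_conv by (rule tau_expr_cong[OF _ _ that]) auto
    then show ?thesis unfolding joint_density_eq latent_density_def by (intro arg_cong2[where f="(*)"] prod.cong refl) auto
  qed
  have j: "?j \<in> borel_measurable L3"
    unfolding j_eq
  proof (intro borel_measurable_times_ennreal pdfs_measurable p measurable_compose[OF p latent_density_measurable])
    fix i assume i: "i \<in> {1..n}"
    have c: "(\<lambda>q. fst q i) \<in> measurable L3 (lborel \<Otimes>\<^sub>M (lborel \<Otimes>\<^sub>M lborel))"
      using measurable_compose[OF measurable_fst measurable_component_singleton[OF i]] .
    show "(\<lambda>q. fst (fst q i)) \<in> borel_measurable L3"
      using measurable_compose[OF c measurable_fst] by simp
  qed
  have jm: "?j (?m x u) = pdfs \<mu> \<beta> x u * latent_density u" for x u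
  proof -
    have "tau_latent i (?p (?m x u)) = tau_latent i u" if "i \<in> {1..n}" for i
      unfolding tau_latent_def fst_conv snd_conv by (rule tau_expr_cong[OF _ _ that]) auto
    moreover have "latent_density (?p (?m x u)) = latent_density u" unfolding latent_density_def by (intro arg_cong2[where f="(*)"] prod.cong refl) auto
    ultimately show ?thesis unfolding j_eq by (intro arg_cong2[where f="(*)"] prod.cong refl) auto
  qed
  have tauM: "\<tau> i \<in> borel_measurable M" if "i \<in> {1..n}" for i
  proof -
    have "(\<lambda>\<omega>. tau_latent i (latent \<omega>)) \<in> borel_measurable M"
      using measurable_compose[OF latent_measurable_L2 tau_latent_measurable[OF that]] .
    then show ?thesis using tau_eq_tau_latent[OF that] by (subst measurable_cong) auto
  qed
  have "\<epsilon> i \<in> borel_measurable M" if "i \<in> {1..n}" for i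
    using eps that by (auto simp: iid_std_normal_def indep_vars_def)
  then have X: "?X \<in> measurable M L1" using tauM by (rule measurable_observation)
  have R_eq: "?R \<omega> = ?m (?X \<omega>) (latent \<omega>)" for \<omega>
    by (auto simp: latent_def)
  have R: "?R \<in> measurable M L3"
    using measurable_compose[OF measurable_Pair[OF X latent_measurable_L2] m] unfolding R_eq by simp
  have sf2: "sigma_finite_measure (lborel \<Otimes>\<^sub>M lborel :: (real \<times> real) measure)"
    by (rule sigma_finite_pair_measure) unfold_locales
  have "distr M L3 ?R = density L3 ?j"
  proof (rule measure_eqI)
    fix A assume "A \<in> sets (distr M L3 ?R)"
    then have A: "A \<in> sets L3" by simp
    let ?F = "\<lambda>z. indicator A (?m (fst z) (snd z)) :: ennreal"
    have F2: "?F \<in> borel_measurable (L1 \<Otimes>\<^sub>M L2)"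
      using measurable_compose[OF m borel_measurable_indicator[OF A]] .
    have F: "?F \<in> borel_measurable (L1 \<Otimes>\<^sub>M B2)"
      using F2 unfolding measurable_cong_sets[OF sets_pair_measure_cong[OF refl sets_B2] refl] .
    have L1: "sigma_finite_measure L1" by (intro sigma_finite_PiM lborel.sigma_finite_measure_axioms) simp
    have inner: "(\<lambda>u. \<integral>\<^sup>+x. pdfs \<mu> \<beta> x u * ?F (x, u) \<partial>L1) \<in> borel_measurable L2"
    proof (rule sigma_finite_measure.borel_measurable_nn_integral[OF L1])
      have 1: "(\<lambda>z. pdfs \<mu> \<beta> (snd z) (fst z)) \<in> borel_measurable (L2 \<Otimes>\<^sub>M L1)"
      proof (rule pdfs_measurable)
        fix i assume i: "i \<in> {1..n}"
        show "(\<lambda>z. snd z i) \<in> borel_measurable (L2 \<Otimes>\<^sub>M L1)"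
          using measurable_compose[OF measurable_snd measurable_component_singleton[OF i, of "\<lambda>_. lborel"]] by simp
      qed measurable
      have 2: "(\<lambda>z. ?F (snd z, fst z)) \<in> borel_measurable (L2 \<Otimes>\<^sub>M L1)"
        using measurable_compose[OF measurable_pair_swap' F2] by (simp add: split_beta')
      show "(\<lambda>(u, x). pdfs \<mu> \<beta> x u * ?F (x, u)) \<in> borel_measurable (L2 \<Otimes>\<^sub>M L1)"
        using borel_measurable_times_ennreal[OF 1 2] by (simp add: split_beta')
    qed
    have "emeasure (distr M L3 ?R) A = (\<integral>\<^sup>+\<omega>. indicator A (?R \<omega>) \<partial>M)"
      using A by (subst nn_integral_distr[OF R, symmetric]) auto
    also have "\<dots> = (\<integral>\<^sup>+\<omega>. ?F (?X \<omega>, latent \<omega>) \<partial>M)" unfolding R_eq by simp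
    also have "\<dots> = (\<integral>\<^sup>+\<omega>. \<integral>\<^sup>+x. (\<Prod>i\<in>{1..n}. ennreal (normal_pdf (x i) (\<mu> * \<Delta> + \<beta> * \<tau> i \<omega>) (\<tau> i \<omega>))) * ?F (x, latent \<omega>) \<partial>L1 \<partial>M)"
      by (rule observation_mixture[where t=tau_latent and \<tau>=\<tau> and Z=latent and F="?F", OF eps ind _ tau_eq_tau_latent tau_pos F])
        (rule tau_latent_measurable[unfolded measurable_cong_sets[OF sets_B2[symmetric] refl]])
    also have "\<dots> = (\<integral>\<^sup>+\<omega>. \<integral>\<^sup>+x. pdfs \<mu> \<beta> x (latent \<omega>) * ?F (x, latent \<omega>) \<partial>L1 \<partial>M)"
      by (intro nn_integral_cong arg_cong2[where f="(*)"] prod.cong refl) (simp add: tau_eq_tau_latent)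
    also have "\<dots> = (\<integral>\<^sup>+u. latent_density u * (\<integral>\<^sup>+x. pdfs \<mu> \<beta> x u * ?F (x, u) \<partial>L1) \<partial>L2)"
      by (rule nn_integral_latent[OF inner])
    also have "\<dots> = (\<integral>\<^sup>+u. \<integral>\<^sup>+x. latent_density u * (pdfs \<mu> \<beta> x u * ?F (x, u)) \<partial>L1 \<partial>L2)"
    proof (rule nn_integral_cong)
      fix u assume u: "u \<in> space L2"
      have "(\<lambda>x. pdfs \<mu> \<beta> x u * ?F (x, u)) \<in> borel_measurable L1"
      proof (intro borel_measurable_times_ennreal pdfs_measurable)
        show "(\<lambda>x. x i) \<in> borel_measurable L1" if "i \<in> {1..n}" for i
          using measurable_component_singleton[OF that, of "\<lambda>_. lborel"] by simp
        show "(\<lambda>_. u) \<in> measurable L1 L2" using u by simp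
        show "(\<lambda>x. ?F (x, u)) \<in> borel_measurable L1"
          using measurable_compose[OF measurable_Pair2'[OF u] F2] .
      qed
      then show "latent_density u * (\<integral>\<^sup>+x. pdfs \<mu> \<beta> x u * ?F (x, u) \<partial>L1) = (\<integral>\<^sup>+x. latent_density u * (pdfs \<mu> \<beta> x u * ?F (x, u)) \<partial>L1)"
        by (rule nn_integral_cmult[symmetric])
    qed
    also have "\<dots> = (\<integral>\<^sup>+u. \<integral>\<^sup>+x. ?j (?m x u) * indicator A (?m x u) \<partial>L1 \<partial>L2)"
      unfolding jm by (simp add: ac_simps)
    also have "\<dots> = (\<integral>\<^sup>+q. ?j q * indicator A q \<partial>L3)"
      using j A
      by (intro nn_integral_PiM_zip[symmetric, where f="\<lambda>q. ?j q * indicator A q"] sf2 lborel.sigma_finite_measure_axioms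
          borel_measurable_times_ennreal borel_measurable_indicator) auto
    also have "\<dots> = emeasure (density L3 ?j) A"
      by (rule emeasure_density[OF j A, symmetric])
    finally show "emeasure (distr M L3 ?R) A = emeasure (density L3 ?j) A" .
  qed simp
  then show ?thesis using j R by (simp add: distributed_def split_beta')
qed

end

section \<open>The discretely observed integrated OU-Gamma process\<close>

theorem proposition3p5:
  fixes \<Omega> :: "'a measure" and \<Omega>' :: "'b measure"
    and G :: "real \<Rightarrow> 'a \<Rightarrow> real" and v0 :: "'a \<Rightarrow> real"
    and P :: "'b \<Rightarrow> real measure"
    and \<tau> :: "nat \<Rightarrow> 'a \<Rightarrow> real" and r :: "nat \<Rightarrow> real"
    and \<theta> lam \<Delta> a :: real and n :: nat
  assumes "\<theta> > 0" and "lam > 0" and "\<Delta> > 0" and "a = lam * \<Delta>"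
    and "prob_space \<Omega>"
    and "gamma_subordinator \<Omega> \<theta> G"
    and "v0 \<in> borel_measurable \<Omega>" and "\<And>\<omega>. \<omega> \<in> space \<Omega> \<Longrightarrow> v0 \<omega> > 0"
    and "indep_rv \<Omega> borel v0 (PiM {0..} (\<lambda>_. borel)) (\<lambda>\<omega>. \<lambda>t\<in>{0..}. G t \<omega>)"
    and "prob_space \<Omega>'"
    and "dirichlet_process \<Omega>' (scale_measure (ennreal (\<theta> * a)) (F_dist a)) P"
    and "\<And>i. \<tau> i = integrated_OU_incr lam \<Delta> G v0 i"
    and "\<And>i. r i = exp (lam * real i * \<Delta>)"
  shows "\<exists>(T :: nat \<Rightarrow> 'a \<Rightarrow> real) (M :: nat \<Rightarrow> 'a \<Rightarrow> real).
    (\<forall>i\<in>{1..n}. \<forall>\<omega>\<in>space \<Omega>.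
       lam * \<tau> i \<omega> = (1 - exp (- lam * \<Delta>)) * OU lam G v0 (real (i - 1) * \<Delta>) \<omega>
                      + T i \<omega> * (1 - M i \<omega>) \<and>
       OU lam G v0 (real (i - 1) * \<Delta>) \<omega> =
         exp (- lam * real (i - 1) * \<Delta>) * (v0 \<omega> + (\<Sum>j\<in>{1..i - 1}. r j * T j \<omega> * M j \<omega>))) \<and>
    prob_space.indep_vars \<Omega> (\<lambda>_. borel \<Otimes>\<^sub>M borel) (\<lambda>i \<omega>. (T i \<omega>, M i \<omega>)) {1..n} \<and>
    (\<forall>i\<in>{1..n}. \<forall>j\<in>{1..n}.
       distr \<Omega> (borel \<Otimes>\<^sub>M borel) (\<lambda>\<omega>. (T i \<omega>, M i \<omega>)) =
       distr \<Omega> (borel \<Otimes>\<^sub>M borel) (\<lambda>\<omega>. (T j \<omega>, M j \<omega>))) \<and>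
    indep_rv \<Omega> (PiM {1..n} (\<lambda>_. borel \<Otimes>\<^sub>M borel)) (\<lambda>\<omega>. \<lambda>i\<in>{1..n}. (T i \<omega>, M i \<omega>))
      borel v0 \<and>
    (\<forall>i\<in>{1..n}. prob_space.indep_var \<Omega> borel (T i) borel (M i) \<and>
       distr \<Omega> borel (T i) = gamma_law (\<theta> * a) \<and>
       distr \<Omega> borel (M i) = distr \<Omega>' borel (random_mean P)) \<and>
    (\<forall>\<mu> \<beta> :: real.
       (\<forall>\<epsilon>. iid_std_normal \<Omega> n \<epsilon> \<longrightarrow>
          prob_space.indep_var \<Omega> (PiM {1..n} (\<lambda>_. borel)) (\<lambda>\<omega>. \<lambda>i\<in>{1..n}. \<epsilon> i \<omega>)
            (PiM {1..n} (\<lambda>_. borel)) (\<lambda>\<omega>. \<lambda>i\<in>{1..n}. \<tau> i \<omega>) \<longrightarrow>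
          distributed \<Omega> (PiM {1..n} (\<lambda>_. lborel))
            (\<lambda>\<omega>. \<lambda>i\<in>{1..n}. observation \<mu> \<beta> \<Delta> \<tau> \<epsilon> i \<omega>)
            (likelihood \<Omega> \<mu> \<beta> \<Delta> \<tau> n)) \<and>
       (\<forall>(fM :: real \<Rightarrow> ennreal) (fv :: real \<Rightarrow> ennreal).
          distributed \<Omega>' lborel (random_mean P) fM \<longrightarrow> distributed \<Omega> lborel v0 fv \<longrightarrow>
          (\<forall>x. likelihood \<Omega> \<mu> \<beta> \<Delta> \<tau> n x =
             (\<integral>\<^sup>+(y, w). joint_density \<theta> lam \<Delta> \<mu> \<beta> n fM fv x (\<lambda>i. fst (y i)) (\<lambda>i. snd (y i)) w
                \<partial>(PiM {1..n} (\<lambda>_. lborel \<Otimes>\<^sub>M lborel) \<Otimes>\<^sub>M lborel))) \<and>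
          (\<forall>\<epsilon>. iid_std_normal \<Omega> n \<epsilon> \<longrightarrow>
             indep_rv \<Omega> (PiM {1..n} (\<lambda>_. borel)) (\<lambda>\<omega>. \<lambda>i\<in>{1..n}. \<epsilon> i \<omega>)
               (borel \<Otimes>\<^sub>M PiM {0..} (\<lambda>_. borel)) (\<lambda>\<omega>. (v0 \<omega>, \<lambda>t\<in>{0..}. G t \<omega>)) \<longrightarrow>
             distributed \<Omega> (PiM {1..n} (\<lambda>_. lborel \<Otimes>\<^sub>M lborel \<Otimes>\<^sub>M lborel) \<Otimes>\<^sub>M lborel)
               (\<lambda>\<omega>. (\<lambda>i\<in>{1..n}. (observation \<mu> \<beta> \<Delta> \<tau> \<epsilon> i \<omega>, T i \<omega>, M i \<omega>), v0 \<omega>))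
               (\<lambda>(z, w). joint_density \<theta> lam \<Delta> \<mu> \<beta> n fM fv
                  (\<lambda>i. fst (z i)) (\<lambda>i. fst (snd (z i))) (\<lambda>i. snd (snd (z i))) w))))"
proof -
  interpret prob_space \<Omega> by fact
  interpret D: prob_space \<Omega>' by fact
  have a0: "0 < a" and \<kappa>0: "0 < \<theta> * a" using assms(1-4) by simp_all
  have sub: "subordinator \<Omega> G" using assms(6) by (simp add: gamma_subordinator_def)
  define s where "s i = real (i - 1) * a" for i :: nat
  have s0: "0 \<le> s i" "0 \<le> s i + a" for i using a0 by (simp_all add: s_def)
  define S where "S i \<omega> = discounted_increment (\<lambda>y. G y \<omega>) (s i) a" for i \<omega>
  define T where "T i \<omega> = G (s i + a) \<omega> - G (s i) \<omega>" for i \<omega>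
  define M where "M i \<omega> = S i \<omega> / T i \<omega>" for i \<omega>
  have path: "increasing_path (\<lambda>y. G y \<omega>)" if "\<omega> \<in> space \<Omega>" for \<omega>
    using sub that by (rule subordinator_path)
  have S_bounds: "0 \<le> S i \<omega>" "S i \<omega> \<le> T i \<omega>" if "\<omega> \<in> space \<Omega>" for i \<omega>
    using increasing_path.discounted_increment_bounds[OF path[OF that] s0(1) less_imp_le[OF a0]]
    unfolding S_def T_def by blast+
  \<comment> \<open>where \<open>T i\<close> vanishes, so does \<open>S i\<close>; the identity therefore holds everywhere and not only almost surely\<close>
  have TM: "T i \<omega> * M i \<omega> = S i \<omega>" if "\<omega> \<in> space \<Omega>" for i \<omega>
    using S_bounds[OF that, of i] by (cases "T i \<omega> = 0") (auto simp: M_def)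
  have pair: "gamma_mean_pair \<Omega> (\<theta> * a) a (S i) (T i)" for i
    unfolding S_def[abs_def] T_def[abs_def] by (rule gamma_subordinator_block_pair[OF assms(5,6) s0(1) a0])
  have S_m: "S i \<in> borel_measurable \<Omega>" and T_m: "T i \<in> borel_measurable \<Omega>" for i
    using pair by (auto simp: gamma_mean_pair_def)
  have M_m: "M i \<in> borel_measurable \<Omega>" for i
    unfolding M_def[abs_def] using S_m T_m by measurable
  obtain \<Gamma> where grm: "gamma_random_measure \<Omega>' (scale_measure (ennreal (\<theta> * a)) (F_dist a)) \<Gamma>"
    and P: "\<And>\<omega>. \<omega> \<in> space \<Omega>' \<Longrightarrow> P \<omega> = scale_measure (1 / emeasure (\<Gamma> \<omega>) UNIV) (\<Gamma> \<omega>)"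
    using assms(11) unfolding dirichlet_process_def by blast
  \<comment> \<open>the first moment of \<open>\<Gamma>\<close>, written as a multiple of the mean of \<open>P\<close>, whose measurability is known\<close>
  let ?T' = "\<lambda>\<omega>. measure (\<Gamma> \<omega>) UNIV" and ?S' = "\<lambda>\<omega>. measure (\<Gamma> \<omega>) UNIV * random_mean P \<omega>"
  have pair': "gamma_mean_pair \<Omega>' (\<theta> * a) a ?S' ?T'"
    by (rule gamma_random_measure_pair[OF assms(10) grm P \<kappa>0 a0])
  have ratio_m: "(\<lambda>z. fst z / snd z) \<in> borel_measurable (borel :: (real \<times> real) measure)"
    unfolding borel_prod[symmetric] by measurable
  have ST_m: "(\<lambda>\<omega>. (S i \<omega>, T i \<omega>)) \<in> borel_measurable \<Omega>" for i
    unfolding borel_prod[symmetric] using S_m T_m by measurable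
  have ST'_m: "(\<lambda>\<omega>. (?S' \<omega>, ?T' \<omega>)) \<in> borel_measurable \<Omega>'"
    unfolding borel_prod[symmetric] using pair' by (auto simp: gamma_mean_pair_def)
  have M_law: "distr \<Omega> borel (M i) = distr \<Omega>' borel (random_mean P)" for i
  proof -
    have "distr \<Omega> borel (M i) = distr (distr \<Omega> borel (\<lambda>\<omega>. (S i \<omega>, T i \<omega>))) borel (\<lambda>z. fst z / snd z)"
      unfolding distr_distr[OF ratio_m ST_m] by (simp add: comp_def M_def[abs_def])
    also have "\<dots> = distr (distr \<Omega>' borel (\<lambda>\<omega>. (?S' \<omega>, ?T' \<omega>))) borel (\<lambda>z. fst z / snd z)"
      unfolding gamma_mean_pair_distr_eq[OF assms(5) pair assms(10) pair'] ..
    also have "\<dots> = distr \<Omega>' borel (random_mean P)"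
      unfolding distr_distr[OF ratio_m ST'_m]
      by (rule distr_cong) (use random_mean_ratio[where P=P, OF grm _ P] in \<open>auto simp: comp_def\<close>)
    finally show ?thesis .
  qed
  have T_law: "distr \<Omega> borel (T i) = gamma_law (\<theta> * a)" for i
    by (rule gamma_mean_pair_total_law[OF assms(5) pair \<kappa>0])
  have TM_indep: "indep_rv \<Omega> borel (T i) borel (M i)" for i
    using gamma_mean_pair_indep[OF assms(5) pair, of i] unfolding M_def[abs_def] .
  have blocks: "indep_vars (\<lambda>_. borel \<Otimes>\<^sub>M borel) (\<lambda>i \<omega>. (T i \<omega>, M i \<omega>)) {1..n}"
  proof -
    have f: "(\<lambda>z. (snd z, fst z / snd z)) \<in> measurable (borel :: (real \<times> real) measure) (borel \<Otimes>\<^sub>M borel)"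
      unfolding borel_prod[symmetric] by measurable
    have "indep_vars (\<lambda>_. borel) (\<lambda>i \<omega>. (S i \<omega>, T i \<omega>)) {1..n}"
      using subordinator_blocks_indep[OF assms(5) sub less_imp_le[OF a0], of n] unfolding S_def T_def s_def .
    from indep_vars_compose2[OF this f] show ?thesis by (simp add: M_def)
  qed
  \<comment> \<open>equality of the laws of the pairs reduces to that of the marginals by independence\<close>
  have same_law: "distr \<Omega> (borel \<Otimes>\<^sub>M borel) (\<lambda>\<omega>. (T i \<omega>, M i \<omega>)) = distr \<Omega> (borel \<Otimes>\<^sub>M borel) (\<lambda>\<omega>. (T j \<omega>, M j \<omega>))" for i j
    unfolding indep_rv_distr[OF assms(5) TM_indep] T_law M_law ..
  \<comment> \<open>the block variables as a measurable function of the path, to which independence of the path from \<open>v0\<close> and the noise can be applied\<close>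
  define H where "H w = (\<lambda>i\<in>{1..n}. (w (s i + a) - w (s i), path_discounted (s i) a w / (w (s i + a) - w (s i))))"
    for w :: "real \<Rightarrow> real"
  have H_m: "H \<in> measurable (PiM {0..} (\<lambda>_. borel)) (PiM {1..n} (\<lambda>_. borel \<Otimes>\<^sub>M borel))"
    unfolding H_def
  proof (rule measurable_restrict)
    fix i :: nat
    have [measurable]: "(\<lambda>w. w (s i + a)) \<in> borel_measurable (PiM {0..} (\<lambda>_. borel :: real measure))"
      "(\<lambda>w. w (s i)) \<in> borel_measurable (PiM {0..} (\<lambda>_. borel :: real measure))"
      using s0[of i] by (simp_all add: measurable_component_singleton)
    have [measurable]: "path_discounted (s i) a \<in> borel_measurable (PiM {0..} (\<lambda>_. borel))"
      using s0 a0 by (intro measurable_path_discounted) auto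
    show "(\<lambda>w. (w (s i + a) - w (s i), path_discounted (s i) a w / (w (s i + a) - w (s i)))) \<in>
        measurable (PiM {0..} (\<lambda>_. borel)) (borel \<Otimes>\<^sub>M borel)"
      by measurable
  qed
  have H_path: "H (\<lambda>t\<in>{0..}. G t \<omega>) = (\<lambda>i\<in>{1..n}. (T i \<omega>, M i \<omega>))" if "\<omega> \<in> space \<Omega>" for \<omega>
    unfolding H_def path_discounted_eq[OF path[OF that] s0(1) less_imp_le[OF a0]]
    using s0 by (intro restrict_ext) (simp add: T_def M_def S_def)
  have indep_v0: "indep_rv \<Omega> (PiM {1..n} (\<lambda>_. borel \<Otimes>\<^sub>M borel)) (\<lambda>\<omega>. \<lambda>i\<in>{1..n}. (T i \<omega>, M i \<omega>)) borel v0"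
    by (rule indep_rv_compose[OF assms(5) indep_rv_sym[OF assms(5) assms(9)] H_m measurable_ident])
      (simp_all add: H_path)
  have OU: "OU lam G v0 (real (i - 1) * \<Delta>) \<omega> =
      exp (- lam * real (i - 1) * \<Delta>) * (v0 \<omega> + (\<Sum>j\<in>{1..i - 1}. r j * T j \<omega> * M j \<omega>))" if "\<omega> \<in> space \<Omega>" for i \<omega>
    using OU_block_representation[where G=G and \<omega>=\<omega>, OF path[OF that] assms(2-4), of v0 "i - 1"]
    by (simp add: assms(13) mult.assoc TM[OF that]) (simp add: S_def s_def mult.assoc)
  have tau_OU: "lam * \<tau> i \<omega> = (1 - exp (- lam * \<Delta>)) * OU lam G v0 (real (i - 1) * \<Delta>) \<omega> + T i \<omega> * (1 - M i \<omega>)"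
    if "i \<in> {1..n}" "\<omega> \<in> space \<Omega>" for i \<omega>
  proof -
    have "1 \<le> i" using that by simp
    have "T i \<omega> * (1 - M i \<omega>) = T i \<omega> - S i \<omega>" using TM[OF that(2), of i] by (simp add: right_diff_distrib)
    then show ?thesis
      using integrated_OU_incr_representation[where G=G and \<omega>=\<omega>, OF path[OF that(2)] assms(2-4) \<open>1 \<le> i\<close>, of v0]
      unfolding assms(12) S_def T_def s_def by simp
  qed
  have tau_expr: "\<tau> i \<omega> = tau_expr lam \<Delta> i (\<lambda>j. T j \<omega>) (\<lambda>j. M j \<omega>) (v0 \<omega>)"
    if "i \<in> {1..n}" "\<omega> \<in> space \<Omega>" for i \<omega>
  proof -
    have "\<tau> i \<omega> = 1 / lam * (lam * \<tau> i \<omega>)" using assms(2) by simp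
    also have "\<dots> = tau_expr lam \<Delta> i (\<lambda>j. T j \<omega>) (\<lambda>j. M j \<omega>) (v0 \<omega>)"
      unfolding tau_OU[OF that] OU[OF that(2)] tau_expr_def assms(13) by (simp only: mult.assoc)
    finally show ?thesis .
  qed
  have tau_pos: "0 < \<tau> i \<omega>" if "i \<in> {1..n}" "\<omega> \<in> space \<Omega>" for i \<omega>
  proof -
    have "0 \<le> (\<Sum>j\<in>{1..i - 1}. r j * T j \<omega> * M j \<omega>)"
      using S_bounds[OF that(2)] by (intro sum_nonneg) (simp add: mult.assoc TM[OF that(2)] assms(13))
    then have "0 < OU lam G v0 (real (i - 1) * \<Delta>) \<omega>"
      unfolding OU[OF that(2)] using assms(8)[OF that(2)] by (intro mult_pos_pos add_pos_nonneg) auto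
    moreover have "0 < 1 - exp (- lam * \<Delta>)" using assms(2,3) by simp
    moreover have "0 \<le> T i \<omega> * (1 - M i \<omega>)"
      using TM[OF that(2), of i] S_bounds[OF that(2), of i] by (simp add: right_diff_distrib)
    ultimately have "0 < lam * \<tau> i \<omega>" unfolding tau_OU[OF that] by (intro add_pos_nonneg mult_pos_pos)
    then show ?thesis using assms(2) by (simp add: zero_less_mult_iff)
  qed
  have model: "block_model \<Omega> T M v0 \<tau> \<theta> lam \<Delta> n fM fv"
    if fM: "distributed \<Omega>' lborel (random_mean P) fM" and fv: "distributed \<Omega> lborel v0 fv" for fM fv
  proof (intro block_model.intro block_model_axioms.intro)
    have "distr \<Omega>' borel (random_mean P) = distr \<Omega>' lborel (random_mean P)" by (rule distr_cong) simp_all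
    then have fM_law: "distr \<Omega>' borel (random_mean P) = density lborel fM" using fM by (simp add: distributed_def)
    show "prob_space (density lborel fM)"
      using fM D.prob_space_distr[of "random_mean P" lborel] by (simp add: distributed_def)
    show "distr \<Omega> borel (M i) = density lborel fM" for i using M_law fM_law by simp
    show "distr \<Omega> borel (T i) = gamma_law (\<theta> * (lam * \<Delta>))" for i using T_law assms(4) by simp
    show "fM \<in> borel_measurable lborel" using fM by (simp add: distributed_def)
    show "0 < \<theta> * (lam * \<Delta>)" using \<kappa>0 assms(4) by simp
  qed (rule prob_space_axioms blocks TM_indep indep_v0 fv tau_expr tau_pos | assumption)+
  have observations: "distributed \<Omega> (PiM {1..n} (\<lambda>_. lborel)) (\<lambda>\<omega>. \<lambda>i\<in>{1..n}. observation \<mu> \<beta> \<Delta> \<tau> \<epsilon> i \<omega>)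
      (likelihood \<Omega> \<mu> \<beta> \<Delta> \<tau> n)"
    if "iid_std_normal \<Omega> n \<epsilon>" "indep_var (PiM {1..n} (\<lambda>_. borel)) (\<lambda>\<omega>. \<lambda>i\<in>{1..n}. \<epsilon> i \<omega>)
      (PiM {1..n} (\<lambda>_. borel)) (\<lambda>\<omega>. \<lambda>i\<in>{1..n}. \<tau> i \<omega>)" for \<mu> \<beta> \<epsilon>
    by (rule observation_distributed[OF that(1) indep_var_imp_indep_rv[OF assms(5) that(2)] tau_pos])
  have joint: "distributed \<Omega> (PiM {1..n} (\<lambda>_. lborel \<Otimes>\<^sub>M lborel \<Otimes>\<^sub>M lborel) \<Otimes>\<^sub>M lborel)
      (\<lambda>\<omega>. (\<lambda>i\<in>{1..n}. (observation \<mu> \<beta> \<Delta> \<tau> \<epsilon> i \<omega>, T i \<omega>, M i \<omega>), v0 \<omega>))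
      (\<lambda>(z, w). joint_density \<theta> lam \<Delta> \<mu> \<beta> n fM fv
         (\<lambda>i. fst (z i)) (\<lambda>i. fst (snd (z i))) (\<lambda>i. snd (snd (z i))) w)"
    if dens: "distributed \<Omega>' lborel (random_mean P) fM" "distributed \<Omega> lborel v0 fv"
      and eps: "iid_std_normal \<Omega> n \<epsilon>"
      and ind: "indep_rv \<Omega> (PiM {1..n} (\<lambda>_. borel)) (\<lambda>\<omega>. \<lambda>i\<in>{1..n}. \<epsilon> i \<omega>)
        (borel \<Otimes>\<^sub>M PiM {0..} (\<lambda>_. borel)) (\<lambda>\<omega>. (v0 \<omega>, \<lambda>t\<in>{0..}. G t \<omega>))"
    for \<mu> \<beta> fM fv \<epsilon>
  proof -
    interpret B: block_model \<Omega> T M v0 \<tau> \<theta> lam \<Delta> n fM fv by (rule model[OF dens])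
    have g: "(\<lambda>z. (H (snd z), fst z)) \<in> measurable (borel \<Otimes>\<^sub>M PiM {0..} (\<lambda>_. borel))
        (PiM {1..n} (\<lambda>_. borel \<Otimes>\<^sub>M borel) \<Otimes>\<^sub>M borel)"
      by (intro measurable_Pair measurable_compose[OF measurable_snd H_m] measurable_fst)
    have "indep_rv \<Omega> (PiM {1..n} (\<lambda>_. borel)) (\<lambda>\<omega>. \<lambda>i\<in>{1..n}. \<epsilon> i \<omega>)
        (PiM {1..n} (\<lambda>_. borel \<Otimes>\<^sub>M borel) \<Otimes>\<^sub>M borel) B.latent"
      by (rule indep_rv_compose[OF assms(5) ind measurable_ident g]) (simp_all add: B.latent_def H_path)
    then show ?thesis by (rule B.joint_distributed[OF eps])
  qed
  show ?thesis
    by (rule exI[of _ T], rule exI[of _ M], intro conjI allI impI ballI)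
      (assumption | rule tau_OU OU blocks same_law indep_v0 indep_rv_imp_indep_var[OF assms(5) TM_indep] T_law M_law
        observations block_model.likelihood_eq_joint_density_integral[OF model] joint)+
qed

end
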